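(* Let $p,q\in\mathbb{F}[t]$ be monic polynomials of degree $2$. Assume that $p$ and $q$ are irreducible over $\mathbb{F}$ with distinct splitting fields in $\overline{\mathbb{F}}$, that $\mathbb{F}$ has characteristic $2$, and that $\operatorname{tr}p=\operatorname{tr}q\neq0$. Let $(b,u)$ be a symplectic pair over $\mathbb{F}$ in which $u$ is $(p,q)$-exceptional. The following conditions are equivalent: (i) $(b,u)$ is a symplectic $(p,q)$-difference; (ii) for every odd integer $k\geq1$, the number of invariant factors of $u$ that equal $\bigl(t^2-(\operatorname{tr}p)\,t+p(0)+q(0)\bigr)^k$ is a multiple of $4$.
   Context: $\overline{\mathbb{F}}$ is a fixed algebraic closure of the field $\mathbb{F}$; all vector spaces are finite-dimensional over $\mathbb{F}$. For a monic polynomial $r\in\mathbb{F}[t]$ of degree $n>0$, $\operatorname{tr}r$ is the opposite of the coefficient of $r$ on $t^{n-1}$, and $\operatorname{Root}(r)$ is the set of roots of $r$ in $\overline{\mathbb{F}}$; $\operatorname{Root}(p)-\operatorname{Root}(q):=\{x-y : x\in\operatorname{Root}(p),\,y\in\operatorname{Root}(q)\}$. An endomorphism is $(p,q)$-exceptional if all its eigenvalues in $\overline{\mathbb{F}}$ belong to $\operatorname{Root}(p)-\operatorname{Root}(q)$. A symplectic form is a non-degenerate alternating bilinear form. Given a symplectic form $b$ on $V$, an endomorphism $u$ of $V$ is $b$-alternating if $b(x,u(x))=0$ for all $x\in V$. A symplectic pair $(b,u)$ consists of a symplectic form $b$ on a vector space and a $b$-alternating endomorphism $u$ of it. It is a symplectic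 $(p,q)$-difference if there are $b$-alternating endomorphisms $u_1,u_2$ with $u=u_1-u_2$, $p(u_1)=0$ and $q(u_2)=0$. *)

theory Defs
  imports
    "HOL-Algebra.Algebraic_Closure_Type"
    "HOL-Algebra.Generated_Fields"
    "Jordan_Normal_Form.Char_Poly"
begin

section \<open>Polynomials and the algebraic closure\<close>

definition poly_tr :: "'a::field poly \<Rightarrow> 'a"
  where "poly_tr r = - Polynomial.coeff r (Polynomial.degree r - 1)"

definition Root :: "'a::field poly \<Rightarrow> 'a alg_closure set"
  where "Root r = {x. poly (map_poly to_ac r) x = 0}"

definition splitting_field :: "'a::field poly \<Rightarrow> 'a alg_closure set"
  where "splitting_field r =
    generate_field (ring_of_type_algebra :: 'a alg_closure ring) (range to_ac \<union> Root r)"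

section \<open>Endomorphisms\<close>

text \<open>
  A vector space over the field \<open>'a\<close> is a type \<open>'v\<close> together with a scalar multiplication
  \<open>scale\<close> satisfying the locale \<open>vector_space\<close> (or \<open>finite_dimensional_vector_space\<close>).
\<close>

definition poly_endo ::
    "('a::field \<Rightarrow> 'v::ab_group_add \<Rightarrow> 'v) \<Rightarrow> 'a poly \<Rightarrow> ('v \<Rightarrow> 'v) \<Rightarrow> 'v \<Rightarrow> 'v"
  where "poly_endo scale r u x =
    (\<Sum>i\<le>Polynomial.degree r. scale (Polynomial.coeff r i) ((u ^^ i) x))"

definition ordered_basis :: "('a::field \<Rightarrow> 'v::ab_group_add \<Rightarrow> 'v) \<Rightarrow> 'v list \<Rightarrow> bool"
  where "ordered_basis scale vs \<longleftrightarrow>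
    distinct vs \<and> \<not> module.dependent scale (set vs) \<and> module.span scale (set vs) = UNIV"

text \<open>The \<open>j\<close>-th column holds the coordinates of the image of the \<open>j\<close>-th basis vector.\<close>

definition matrix_wrt ::
    "('a::field \<Rightarrow> 'v::ab_group_add \<Rightarrow> 'v) \<Rightarrow> 'v list \<Rightarrow> ('v \<Rightarrow> 'v) \<Rightarrow> 'a mat"
  where "matrix_wrt scale vs u =
    mat (length vs) (length vs)
      (\<lambda>(i, j). module.representation scale (set vs) (u (vs ! j)) (vs ! i))"

text \<open>
  An eigenvalue of \<open>u\<close> in the algebraic closure is an eigenvalue of the scalar extension of \<open>u\<close>,
  which in a basis of the space is given by the matrix of \<open>u\<close> read over the closure.
\<close>

definition ac_eigenvalues ::
    "('a::field \<Rightarrow> 'v::ab_group_add \<Rightarrow> 'v) \<Rightarrow> ('v \<Rightarrow> 'v) \<Rightarrow> 'a alg_closure set"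
  where "ac_eigenvalues scale u =
    {x. \<exists>vs. ordered_basis scale vs \<and> eigenvalue (map_mat to_ac (matrix_wrt scale vs u)) x}"

definition exceptional_endo ::
    "('a::field \<Rightarrow> 'v::ab_group_add \<Rightarrow> 'v) \<Rightarrow> 'a poly \<Rightarrow> 'a poly \<Rightarrow> ('v \<Rightarrow> 'v) \<Rightarrow> bool"
  where "exceptional_endo scale p q u \<longleftrightarrow>
    ac_eigenvalues scale u \<subseteq> {x - y | x y. x \<in> Root p \<and> y \<in> Root q}"

section \<open>Invariant factors\<close>

definition companion_mat :: "'a::field poly \<Rightarrow> 'a mat"
  where "companion_mat r =
    mat (Polynomial.degree r) (Polynomial.degree r)
      (\<lambda>(i, j). if j = Polynomial.degree r - 1 then - Polynomial.coeff r i
                else if i = j + 1 then 1 else 0)"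

definition is_invariant_factors ::
    "('a::field \<Rightarrow> 'v::ab_group_add \<Rightarrow> 'v) \<Rightarrow> ('v \<Rightarrow> 'v) \<Rightarrow> 'a poly list \<Rightarrow> bool"
  where "is_invariant_factors scale u rs \<longleftrightarrow>
    (\<forall>r\<in>set rs. Polynomial.lead_coeff r = 1 \<and> Polynomial.degree r > 0) \<and>
    sorted_wrt (\<lambda>r s. s dvd r) rs \<and>
    (\<exists>vs. ordered_basis scale vs \<and>
          matrix_wrt scale vs u = diag_block_mat (map companion_mat rs))"

text \<open>
  By the Frobenius normal form theorem, every endomorphism of a finite-dimensional vector space
  has exactly one such list, the non-constant invariant factors with multiplicity.
\<close>

definition invariant_factors ::
    "('a::field \<Rightarrow> 'v::ab_group_add \<Rightarrow> 'v) \<Rightarrow> ('v \<Rightarrow> 'v) \<Rightarrow> 'a poly list"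
  where "invariant_factors scale u = (THE rs. is_invariant_factors scale u rs)"

section \<open>Symplectic pairs\<close>

definition bilinear_form ::
    "('a::field \<Rightarrow> 'v::ab_group_add \<Rightarrow> 'v) \<Rightarrow> ('v \<Rightarrow> 'v \<Rightarrow> 'a) \<Rightarrow> bool"
  where "bilinear_form scale b \<longleftrightarrow>
    (\<forall>x. Vector_Spaces.linear scale (*) (\<lambda>y. b x y)) \<and>
    (\<forall>y. Vector_Spaces.linear scale (*) (\<lambda>x. b x y))"

text \<open>An alternating form is skew-symmetric, so its left and right radicals coincide.\<close>

definition symplectic_form ::
    "('a::field \<Rightarrow> 'v::ab_group_add \<Rightarrow> 'v) \<Rightarrow> ('v \<Rightarrow> 'v \<Rightarrow> 'a) \<Rightarrow> bool"
  where "symplectic_form scale b \<longleftrightarrow>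
    bilinear_form scale b \<and> (\<forall>x. b x x = 0) \<and> (\<forall>x. (\<forall>y. b x y = 0) \<longrightarrow> x = 0)"

definition alternating_endo ::
    "('a::field \<Rightarrow> 'v::ab_group_add \<Rightarrow> 'v) \<Rightarrow> ('v \<Rightarrow> 'v \<Rightarrow> 'a) \<Rightarrow> ('v \<Rightarrow> 'v) \<Rightarrow> bool"
  where "alternating_endo scale b u \<longleftrightarrow>
    Vector_Spaces.linear scale scale u \<and> (\<forall>x. b x (u x) = 0)"

definition symplectic_pair ::
    "('a::field \<Rightarrow> 'v::ab_group_add \<Rightarrow> 'v) \<Rightarrow> ('v \<Rightarrow> 'v \<Rightarrow> 'a) \<Rightarrow> ('v \<Rightarrow> 'v) \<Rightarrow> bool"
  where "symplectic_pair scale b u \<longleftrightarrow> symplectic_form scale b \<and> alternating_endo scale b u"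

definition symplectic_difference ::
    "('a::field \<Rightarrow> 'v::ab_group_add \<Rightarrow> 'v) \<Rightarrow> 'a poly \<Rightarrow> 'a poly \<Rightarrow>
      ('v \<Rightarrow> 'v \<Rightarrow> 'a) \<Rightarrow> ('v \<Rightarrow> 'v) \<Rightarrow> bool"
  where "symplectic_difference scale p q b u \<longleftrightarrow>
    (\<exists>u1 u2. alternating_endo scale b u1 \<and> alternating_endo scale b u2 \<and>
      (\<forall>x. u x = u1 x - u2 x) \<and>
      (\<forall>x. poly_endo scale p u1 x = 0) \<and> (\<forall>x. poly_endo scale q u2 x = 0))"

end

theory Submission
  imports Defs "HOL-Library.Function_Algebras"
begin

text \<open>
  In characteristic \<open>2\<close> write \<open>p = t\<^sup>2 + \<tau> t + a\<close>, \<open>q = t\<^sup>2 + \<tau> t + c\<close> and \<open>r = t\<^sup>2 + \<tau> t + (a + c)\<close>. The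
  exceptional \<open>u\<close> is \<open>r\<close>-primary, and \<open>(b, u)\<close> is a difference iff there is a \<open>b\<close>-alternating \<open>v\<close> with
  \<open>v\<^sup>2 + \<tau> v + a = 0\<close> and \<open>v u + u v = r(u)\<close>; thus \<open>v\<close> acts as a lift of the derivation \<open>r d/dt\<close>.

  Necessity: for \<open>k = 2 m + 1\<close>, let \<open>S\<close> be the intersection of the image of \<open>r(u)\<^sup>m\<close> with the kernel of
  \<open>r(u)\<^sup>m\<^sup>+\<^sup>1\<close>. The space \<open>S / (S \<inter> S\<^sup>\<bottom>)\<close> has dimension twice the number of invariant factors \<open>r\<^sup>k\<close>. On it
  \<open>u\<close> and \<open>v\<close> commute and generate a field of degree \<open>4\<close> (this uses that the splitting fields differ), and
  \<open>b\<close> is alternating over that field. A maximal isotropic subspace over this field is its own orthogonal,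
  so the dimension is divisible by \<open>8\<close>.

  Sufficiency: \<open>V\<close> is an orthogonal sum of planes \<open>(F[t]/(r\<^sup>k))\<^sup>2\<close> on which \<open>b\<close> reads off the top coefficient
  of a product modulo \<open>r\<^sup>k\<close>. Coordinatewise \<open>r d/dt\<close> plus a constant matrix gives \<open>v\<close> on one plane if \<open>k\<close> is
  even and on the sum of two equal planes if \<open>k\<close> is odd.
\<close>

section \<open>The module structure given by an endomorphism\<close>

text \<open>With \<open>u2 = v + u\<close>, substituting \<open>v\<^sup>2 = \<tau> v + a\<close>
  into \<open>q(u2) = 0\<close> leaves \<open>v u + u v + r(u) = 0\<close>, because the traces
  agree. The obstacle is that \<open>v\<close> is not linear over \<open>F[u]\<close>: it obeys a
  Leibniz rule and becomes linear where \<open>r(u)\<close> acts as zero, whence the passage to a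
  quotient. That the splitting fields differ is used in the form that \<open>r\<close> has no root
  in \<open>F\<close>. The parity of \<open>k\<close> comes from the second highest coefficient of
  \<open>r\<^sup>k\<close>, which is \<open>k \<tau>\<close>: by it the top coefficient of
  \<open>r h'\<close> modulo \<open>r\<^sup>k\<close> is \<open>\<tau>\<close> times that of
  \<open>h\<close> for even \<open>k\<close> and zero for odd \<open>k\<close>. For even
  \<open>k\<close> the defect \<open>\<tau>\<close> is the trace of a matrix annihilated by
  \<open>p\<close>, and squares have top coefficient zero, so one plane suffices. For odd
  \<open>k\<close> a constant alternating matrix on one plane is scalar, and no scalar is a root of
  \<open>p\<close>; a matrix on one half of the sum of two planes and its transpose on the other
  half avoid this.\<close>

locale endo = vector_space scale
  for scale :: "'a::field \<Rightarrow> 'v::ab_group_add \<Rightarrow> 'v" (infixr "*s" 75) +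
  fixes u :: "'v \<Rightarrow> 'v"
  assumes u_linear: "Vector_Spaces.linear scale scale u"
begin

definition act :: "'a poly \<Rightarrow> 'v \<Rightarrow> 'v"
  where "act f x = poly_endo scale f u x"

lemma u_add: "u (x + y) = u x + u y"
  using u_linear by (rule Vector_Spaces.linear.axioms(3)[THEN module_hom.add])

lemma u_scale: "u (c *s x) = c *s u x"
  using u_linear by (rule Vector_Spaces.linear.axioms(3)[THEN module_hom.scale])

lemma u_zero [simp]: "u 0 = 0"
  using u_scale[of 0 0] by simp

lemma u_sum: "u (sum g A) = (\<Sum>i\<in>A. u (g i))"
  by (induction A rule: infinite_finite_induct) (auto simp: u_add)

lemma act_bound:
  assumes "Polynomial.degree f < n"
  shows "act f x = (\<Sum>i<n. Polynomial.coeff f i *s (u ^^ i) x)"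
proof -
  have "(\<Sum>i\<le>Polynomial.degree f. Polynomial.coeff f i *s (u ^^ i) x)
      = (\<Sum>i<n. Polynomial.coeff f i *s (u ^^ i) x)"
    using assms by (intro sum.mono_neutral_left) (auto simp: coeff_eq_0 not_le)
  then show ?thesis by (simp add: act_def poly_endo_def)
qed

lemma act_0_left [simp]: "act 0 x = 0"
  by (simp add: act_def poly_endo_def)

lemma act_pCons [simp]: "act (pCons a f) x = a *s x + u (act f x)"
proof -
  let ?n = "Suc (max (Polynomial.degree f) (Polynomial.degree (pCons a f)))"
  have "act (pCons a f) x = (\<Sum>i<Suc ?n. Polynomial.coeff (pCons a f) i *s (u ^^ i) x)"
    by (rule act_bound) auto
  also have "\<dots> = a *s x + (\<Sum>i<?n. Polynomial.coeff f i *s u ((u ^^ i) x))"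
    by (subst sum.lessThan_Suc_shift) (simp del: sum.lessThan_Suc)
  also have "(\<Sum>i<?n. Polynomial.coeff f i *s u ((u ^^ i) x)) = u (act f x)"
    by (subst act_bound[of f ?n]) (auto simp: u_sum u_scale simp del: sum.lessThan_Suc)
  finally show ?thesis .
qed

lemma act_add_left: "act (f + g) x = act f x + act g x"
  by (induction f g rule: poly_induct2) (auto simp: u_add algebra_simps)

lemma act_add_right: "act f (x + y) = act f x + act f y"
  by (induction f) (auto simp: u_add algebra_simps)

lemma act_smult: "act (Polynomial.smult c f) x = c *s act f x"
  by (induction f) (auto simp: u_scale scale_right_distrib)

lemma act_mult: "act (f * g) x = act f (act g x)"
  by (induction f) (auto simp: act_add_left act_smult)

lemma act_1 [simp]: "act 1 x = x"
  unfolding one_pCons by simp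

sublocale pm: Modules.module act
  by standard (auto simp: act_add_left act_add_right act_mult)

lemma act_const: "act [:c:] x = c *s x"
  by simp

lemma act_scale: "act f (c *s x) = c *s act f x"
  by (metis act_const act_mult mult.commute)

lemma act_u: "act f (u x) = u (act f x)"
  by (induction f) (auto simp: u_add u_scale)

lemma act_monom: "act (Polynomial.monom c n) x = c *s (u ^^ n) x"
  by (induction n) (auto simp: monom_0 monom_Suc u_scale)

lemma pm_subspace_imp: "pm.subspace W \<Longrightarrow> subspace W"
  unfolding pm.subspace_def subspace_def by (metis act_const)

lemma pm_subspaceI:
  assumes "subspace W" "\<And>x. x \<in> W \<Longrightarrow> u x \<in> W"
  shows "pm.subspace W"
proof -
  have "act f x \<in> W" if "x \<in> W" for f x
    using that by (induction f) (auto intro!: subspace_add subspace_scale subspace_0 assms)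
  then show ?thesis
    using assms unfolding pm.subspace_def subspace_def by blast
qed

lemma pm_subspace_u: "pm.subspace W \<Longrightarrow> x \<in> W \<Longrightarrow> u x \<in> W"
  using pm.subspace_scale[of W x "[:0,1:]"] by simp

text \<open>A relation among the first \<open>n\<close> iterates of \<open>x\<close> modulo
  \<open>W\<close> is a nonzero polynomial of degree below \<open>n\<close> sending \<open>x\<close>
  into \<open>W\<close>. The case \<open>W = {0}\<close> yields annihilators; a general
  \<open>W\<close> lets a basis of \<open>W\<close> be extended by a cyclic summand.\<close>

lemma krylov_independent:
  assumes W: "span B = W" "independent B"
    and ann: "\<And>f. f \<noteq> 0 \<Longrightarrow> Polynomial.degree f < n \<Longrightarrow> act f x \<notin> W"
  shows "independent ((\<lambda>j. (u ^^ j) x) ` {..<n} \<union> B) \<and> inj_on (\<lambda>j. (u ^^ j) x) {..<n}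
    \<and> (\<lambda>j. (u ^^ j) x) ` {..<n} \<inter> B = {}"
  using ann
proof (induction n)
  case 0
  then show ?case using W by simp
next
  case (Suc n)
  let ?K = "(\<lambda>j. (u ^^ j) x) ` {..<n}"
  have IH: "independent (?K \<union> B)" "inj_on (\<lambda>j. (u ^^ j) x) {..<n}" "?K \<inter> B = {}"
    using Suc by auto
  have not: "(u ^^ n) x \<notin> span (?K \<union> B)"
  proof
    assume "(u ^^ n) x \<in> span (?K \<union> B)"
    then obtain y z where yz: "(u ^^ n) x = y + z" "y \<in> span ?K" "z \<in> W"
      unfolding span_Un W(1) by blast
    from yz(2) obtain c where c: "y = (\<Sum>v\<in>?K. c v *s v)"
      by (auto simp: span_finite)
    have y: "y = (\<Sum>j<n. c ((u ^^ j) x) *s (u ^^ j) x)"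
      unfolding c by (subst sum.reindex[OF IH(2)]) simp
    define g where "g = (\<Sum>j<n. Polynomial.monom (c ((u ^^ j) x)) j)"
    have g: "act g x = y" unfolding g_def y by (simp add: pm.scale_sum_left act_monom)
    have dg: "Polynomial.coeff g j = 0" if "j \<ge> n" for j
      unfolding g_def coeff_sum using that by (intro sum.neutral) auto
    \<comment> \<open>The new iterate enters with coefficient 1, which makes \<open>f\<close> monic
      of degree \<open>n\<close> and so nonzero.\<close>
    define f where "f = Polynomial.monom 1 n - g"
    have "Polynomial.coeff f n = 1" unfolding f_def by (simp add: dg)
    then have "f \<noteq> 0" by auto
    moreover have "Polynomial.degree f \<le> n" unfolding f_def
      by (rule degree_le) (auto simp: dg)
    moreover have "act f x = z" unfolding f_def
      by (simp add: pm.scale_left_diff_distrib act_monom g yz(1))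
    ultimately show False using Suc.prems[of f] yz(3) by auto
  qed
  have "independent (insert ((u ^^ n) x) (?K \<union> B))"
    using IH(1) not by (rule independent_insertI[rotated])
  moreover have "(u ^^ n) x \<notin> ?K \<union> B" using not span_base by metis
  moreover have "(\<lambda>j. (u ^^ j) x) ` {..<Suc n} = insert ((u ^^ n) x) ?K"
    by (simp add: lessThan_Suc)
  moreover have "inj_on (\<lambda>j. (u ^^ j) x) {..<Suc n}"
    using IH(2) \<open>(u ^^ n) x \<notin> ?K \<union> B\<close> by (subst lessThan_Suc, subst inj_on_insert) auto
  ultimately show ?case using IH(3) by (metis Int_insert_left Un_iff Un_insert_left)
qed

lemma krylov_span:
  assumes "Polynomial.degree s = n" "lead_coeff s = 1" "act s x = 0"
  shows "span ((\<lambda>j. (u ^^ j) x) ` {..<n}) = {act f x | f. True}"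
proof -
  let ?K = "(\<lambda>j. (u ^^ j) x) ` {..<n}"
  have "act f x \<in> span ?K" for f
  proof -
    obtain g where g: "act f x = act g x" "n = 0 \<Longrightarrow> g = 0" "n > 0 \<Longrightarrow> Polynomial.degree g < n"
    proof (cases "n = 0")
      case True
      then have "s = 1" using assms(1,2) by (auto elim!: degree_eq_zeroE)
      then have "x = 0" using assms(3) by simp
      then show ?thesis using that[of 0] True by auto
    next
      case False
      have s0: "s \<noteq> 0" using assms(2) by auto
      have "f = f div s * s + f mod s" by simp
      then have "act f x = act (f div s) (act s x) + act (f mod s) x"
        by (metis act_add_left act_mult)
      moreover have "Polynomial.degree (f mod s) < n"
        using degree_mod_less[OF s0, of f] False assms(1) by auto
      ultimately show ?thesis using that[of "f mod s"] assms(3) False by simp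
    qed
    show ?thesis
    proof (cases "n = 0")
      case True then show ?thesis using g span_zero by simp
    next
      case False
      then have "act g x = (\<Sum>i<n. Polynomial.coeff g i *s (u ^^ i) x)"
        using g act_bound by blast
      also have "\<dots> \<in> span ?K"
        by (intro span_sum span_scale span_base) auto
      finally show ?thesis using g by simp
    qed
  qed
  moreover have "span ?K \<subseteq> {act f x | f. True}"
  proof (rule span_minimal)
    have "(u ^^ j) x = act (Polynomial.monom 1 j) x" for j by (simp add: act_monom)
    then show "?K \<subseteq> {act f x | f. True}" by blast
    show "subspace {act f x | f. True}"
      unfolding subspace_def
      by (auto; metis act_add_left act_smult act_0_left)
  qed
  ultimately show ?thesis by auto
qed

end

section \<open>Eigenvalues in the algebraic closure\<close>

context vector_space
begin

lemma sum_nth_set: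
  assumes "distinct vs"
  shows "(\<Sum>i<length vs. g (vs ! i)) = (\<Sum>v\<in>set vs. g v)"
  using assms by (metis bij_betw_nth lessThan_atLeast0 sum.reindex_bij_betw)

lemma ordered_basis_expand:
  assumes "ordered_basis scale vs"
  shows "(\<Sum>i<length vs. representation (set vs) x (vs ! i) *s vs ! i) = x"
proof -
  have "distinct vs" "independent (set vs)" "x \<in> span (set vs)"
    using assms by (auto simp: ordered_basis_def)
  then show ?thesis
    using sum_nth_set[of vs "\<lambda>v. representation (set vs) x v *s v"]
      sum_representation_eq[of "set vs" x "set vs"] by simp
qed

lemma representation_sum_nth:
  assumes "distinct vs" "independent (set vs)" "j < length vs"
  shows "representation (set vs) (\<Sum>i<length vs. c i *s vs ! i) (vs ! j) = c j"
proof -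
  have vs: "vs ! i \<in> span (set vs)" if "i < length vs" for i
    using that by (simp add: span_base)
  have "representation (set vs) (\<Sum>i<length vs. c i *s vs ! i) (vs ! j)
      = (\<Sum>i<length vs. representation (set vs) (c i *s vs ! i) (vs ! j))"
    using assms(2) vs span_scale by (subst representation_sum) auto
  also have "\<dots> = (\<Sum>i<length vs. c i * representation (set vs) (vs ! i) (vs ! j))"
    using assms(2) vs by (intro sum.cong) (auto simp: representation_scale)
  also have "\<dots> = (\<Sum>i<length vs. if i = j then c i else 0)"
    using assms by (intro sum.cong) (auto simp: representation_basis nth_eq_iff_index_eq)
  finally show ?thesis using assms(3) by simp
qed

lemma ordered_basis_representation_linear:
  assumes "ordered_basis scale vs"
  shows "representation (set vs) (x + y) v = representation (set vs) x v + representation (set vs) y v"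
    and "representation (set vs) (c *s x) v = c * representation (set vs) x v"
  using assms by (auto simp: ordered_basis_def representation_add representation_scale)

end

lemma (in finite_dimensional_vector_space) ordered_basis_exists:
  "\<exists>vs. ordered_basis scale vs"
  using finite_Basis independent_Basis span_Basis finite_distinct_list
  unfolding ordered_basis_def by metis

text \<open>Linear factors \<open>t - l\<close> of \<open>h\<close> are applied to \<open>x\<close>
  one at a time; the last nonzero vector is an eigenvector. It is returned as a polynomial in
  \<open>u\<close> applied to \<open>x\<close>, so it lies in every invariant subspace that contains
  \<open>x\<close>.\<close>

lemma eigenvector_of_annihilated:
  fixes scale :: "'k::alg_closed_field \<Rightarrow> 'w::ab_group_add \<Rightarrow> 'w"
  assumes "endo scale u" and "h \<noteq> 0" and "endo.act scale u h x = 0" and "x \<noteq> 0"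
  shows "\<exists>l g. poly h l = 0 \<and> endo.act scale u g x \<noteq> 0 \<and>
    u (endo.act scale u g x) = scale l (endo.act scale u g x)"
proof -
  interpret endo scale u by fact
  show ?thesis using assms(2-4)
  proof (induction "Polynomial.degree h" arbitrary: h x)
    case 0
    then obtain c where "h = [:c:]" by (metis degree_eq_zeroE)
    then show ?case using 0 by auto
  next
    case (Suc n)
    then obtain l where l: "poly h l = 0" using alg_closed_imp_poly_has_root[of h] by auto
    then obtain k where k: "h = [:-l, 1:] * k" by (metis dvdE poly_eq_0_iff_dvd)
    let ?y = "act [:-l, 1:] x"
    show ?case
    proof (cases "?y = 0")
      case True
      then have "u (act 1 x) = scale l (act 1 x)" by (simp add: scale_minus_left)
      then show ?thesis using l Suc.prems by (metis act_1)
    next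
      case False
      have "k \<noteq> 0" using k Suc.prems by auto
      moreover have "n = Polynomial.degree k"
        using Suc.hyps(2) \<open>k \<noteq> 0\<close> unfolding k by (subst (asm) degree_mult_eq) auto
      moreover have "act k ?y = 0"
        using Suc.prems(2) unfolding k by (metis act_mult mult.commute)
      ultimately obtain l' g where "poly k l' = 0" "act g ?y \<noteq> 0"
          "u (act g ?y) = scale l' (act g ?y)"
        using Suc.hyps(1) False by blast
      then show ?thesis unfolding k
        by (intro exI[of _ l'] exI[of _ "g * [:-l, 1:]"]) (auto simp only: act_mult poly_mult mult_zero_right)
    qed
  qed
qed

locale fd_endo = finite_dimensional_vector_space scale Basis + endo scale u
  for scale :: "'a::field \<Rightarrow> 'v::ab_group_add \<Rightarrow> 'v" (infixr "*s" 75)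
    and Basis :: "'v set" and u :: "'v \<Rightarrow> 'v"
begin

lemma annihilator_vector: "\<exists>f. f \<noteq> 0 \<and> act f x = 0"
proof (rule ccontr)
  assume "\<not> ?thesis"
  then have ann: "f \<noteq> 0 \<Longrightarrow> Polynomial.degree f < Suc dimension \<Longrightarrow> act f x \<notin> {0}" for f
    by auto
  have kry: "independent ((\<lambda>j. (u ^^ j) x) ` {..<Suc dimension} \<union> {}) \<and>
      inj_on (\<lambda>j. (u ^^ j) x) {..<Suc dimension} \<and> (\<lambda>j. (u ^^ j) x) ` {..<Suc dimension} \<inter> {} = {}"
    by (rule krylov_independent[OF span_empty independent_empty]) (rule ann)
  have *: "independent ((\<lambda>j. (u ^^ j) x) ` {..<Suc dimension})"
    "inj_on (\<lambda>j. (u ^^ j) x) {..<Suc dimension}"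
    using kry unfolding Un_empty_right by blast+
  have "card ((\<lambda>j. (u ^^ j) x) ` {..<Suc dimension}) = Suc dimension"
    using card_image[OF *(2)] by simp
  moreover have "card ((\<lambda>j. (u ^^ j) x) ` {..<Suc dimension}) \<le> dimension"
    using dim_eq_card_independent[OF *(1)] dim_subset_UNIV[of "(\<lambda>j. (u ^^ j) x) ` {..<Suc dimension}"]
    by simp
  ultimately show False by simp
qed

lemma annihilator_exists: "\<exists>f. f \<noteq> 0 \<and> (\<forall>x. act f x = 0)"
proof -
  obtain m where m: "\<And>x. m x \<noteq> 0 \<and> act (m x) x = 0" using annihilator_vector by metis
  let ?f = "\<Prod>x\<in>Basis. m x"
  have "act ?f x = 0" for x
  proof -
    have "x \<in> span Basis" using span_Basis by auto
    then show ?thesis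
    proof (induction rule: span_induct_alt)
      case (step c y z)
      have "m y dvd ?f" using step finite_Basis by (intro dvd_prodI) auto
      then obtain g where g: "?f = g * m y" unfolding dvd_def by (auto simp: mult.commute)
      have "act ?f y = 0" unfolding g act_mult using m[of y] by simp
      then show ?case using step(2) by (simp only: act_add_right act_scale) simp
    qed simp
  qed
  moreover have "?f \<noteq> 0" using m finite_Basis by simp
  ultimately show ?thesis by blast
qed

text \<open>Torsion by \<open>h\<close> survives extension of scalars, and over the closure it
  produces an eigenvector whose eigenvalue is a root of \<open>h\<close>. This is how the condition
  on eigenvalues becomes a condition on annihilating polynomials.\<close>

lemma ac_eigenvalue_of_annihilated:
  assumes "x \<noteq> 0" "act h x = 0" "h \<noteq> 0"
  shows "\<exists>l \<in> ac_eigenvalues scale u. poly (map_poly to_ac h) l = 0"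
proof -
  obtain vs where vs: "ordered_basis scale vs" using ordered_basis_exists by blast
  define n where "n = length vs"
  let ?M = "map_mat to_ac (matrix_wrt scale vs u)"
  let ?rep = "representation (set vs)"
  \<comment> \<open>The extended space is modelled by functions on \<open>nat\<close>;
    \<open>A\<close> is the matrix of \<open>u\<close> acting on the first \<open>n\<close>
    coordinates, and \<open>\<phi>\<close> sends a vector to its coordinates, with zeros from index
    \<open>n\<close> on.\<close>
  define ks where "ks = (\<lambda>(a::'a alg_closure) f (i::nat). a * f i)"
  define A where "A = (\<lambda>f i. if i < n then \<Sum>j<n. ?M $$ (i, j) * f j else 0)"
  define \<phi> where "\<phi> = (\<lambda>x i. if i < n then to_ac (?rep x (vs ! i)) else 0)"
  have M: "?M $$ (i, j) = to_ac (?rep (u (vs ! j)) (vs ! i))" if "i < n" "j < n" for i j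
    using that by (simp add: matrix_wrt_def n_def)
  interpret K: vector_space ks
    by standard (auto simp: ks_def algebra_simps)
  interpret K: endo ks A
  proof
    show "A (f + g) = A f + A g" for f g
      by (auto simp: A_def algebra_simps sum.distrib)
    show "A (ks c f) = ks c (A f)" for c f
      by (auto simp: A_def ks_def algebra_simps sum_distrib_left)
  qed
  have \<phi>_add: "\<phi> (x + y) = \<phi> x + \<phi> y" for x y
    using ordered_basis_representation_linear(1)[OF vs] by (auto simp: \<phi>_def)
  have \<phi>_scale: "\<phi> (c *s x) = ks (to_ac c) (\<phi> x)" for c x
    using ordered_basis_representation_linear(2)[OF vs] by (auto simp: \<phi>_def ks_def)
  have \<phi>_u: "\<phi> (u x) = A (\<phi> x)" for x
  proof
    fix i
    show "\<phi> (u x) i = A (\<phi> x) i"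
    proof (cases "i < n")
      case True
      have "u x = (\<Sum>j<n. ?rep x (vs ! j) *s u (vs ! j))"
        by (subst ordered_basis_expand[OF vs, of x, symmetric]) (simp only: u_sum u_scale n_def)
      then have "?rep (u x) (vs ! i) = (\<Sum>j<n. ?rep x (vs ! j) * ?rep (u (vs ! j)) (vs ! i))"
        using vs by (simp add: ordered_basis_def representation_sum representation_scale)
      then show ?thesis using True M
        by (simp add: \<phi>_def A_def to_ac_sum mult.commute)
    qed (simp add: \<phi>_def A_def)
  qed
  have "\<phi> 0 = 0" by (simp add: \<phi>_def representation_zero fun_eq_iff)
  then have \<phi>_act: "\<phi> (act g x) = K.act (map_poly to_ac g) (\<phi> x)" for g x
    by (induction g) (auto simp: \<phi>_add \<phi>_scale \<phi>_u map_poly_pCons)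
  have "\<phi> x \<noteq> 0"
  proof
    assume "\<phi> x = 0"
    then have "?rep x (vs ! i) = 0" if "i < n" for i
      using that by (auto simp: \<phi>_def fun_eq_iff split: if_splits)
    then have "x = 0" using ordered_basis_expand[OF vs, of x] by (simp add: n_def)
    then show False using assms by simp
  qed
  moreover have "K.act (map_poly to_ac h) (\<phi> x) = 0"
    using \<phi>_act[of h x] assms(2) \<open>\<phi> 0 = 0\<close> by simp
  moreover have "map_poly to_ac h \<noteq> 0"
    using assms(3) by (subst map_poly_eq_0_iff) auto
  ultimately obtain l g where lg: "poly (map_poly to_ac h) l = 0" "K.act g (\<phi> x) \<noteq> 0"
      "A (K.act g (\<phi> x)) = ks l (K.act g (\<phi> x))"
    using eigenvector_of_annihilated[OF K.endo_axioms] by blast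
  define c where "c = K.act g (\<phi> x)"
  \<comment> \<open>The ambient function space is infinite-dimensional, so the eigenvector must
    still be shown to live on the first \<open>n\<close> coordinates. It is a polynomial in
    \<open>A\<close> applied to \<open>\<phi> x\<close>, which does.\<close>
  have "K.subspace {f. \<forall>i\<ge>n. f i = 0}"
    unfolding K.subspace_def by (simp add: ks_def)
  then have "K.pm.subspace {f. \<forall>i\<ge>n. f i = 0}"
    by (rule K.pm_subspaceI) (simp add: A_def)
  then have "c \<in> {f. \<forall>i\<ge>n. f i = 0}"
    unfolding c_def by (rule K.pm.subspace_scale) (auto simp: \<phi>_def)
  then have c0: "c i = 0" if "i \<ge> n" for i using that by auto
  have "eigenvector ?M (vec n c) l"
    unfolding eigenvector_def
  proof (intro conjI)
    have dim: "dim_row ?M = n" "dim_col ?M = n" by (auto simp: matrix_wrt_def n_def)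
    show "vec n c \<in> carrier_vec (dim_row ?M)" using dim by simp
    show "vec n c \<noteq> 0\<^sub>v (dim_row ?M)"
    proof
      assume eq: "vec n c = 0\<^sub>v (dim_row ?M)"
      have "c i = 0" if "i < n" for i
      proof -
        have "vec n c $ i = 0" unfolding eq using that dim by simp
        then show ?thesis using that by simp
      qed
      then have "c i = 0" for i using c0 by (cases "i < n") auto
      then have "c = 0" by (simp add: fun_eq_iff)
      then show False using lg(2) c_def by simp
    qed
    show "?M *\<^sub>v vec n c = l \<cdot>\<^sub>v vec n c"
    proof (intro eq_vecI)
      fix i assume "i < dim_vec (l \<cdot>\<^sub>v vec n c)"
      then have i: "i < n" by simp
      have "(?M *\<^sub>v vec n c) $ i = (\<Sum>j<n. ?M $$ (i, j) * c j)"
        using i dim by (simp add: scalar_prod_def lessThan_atLeast0)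
      also have "\<dots> = A c i" using i by (simp add: A_def)
      also have "\<dots> = l * c i" using lg(3) unfolding c_def[symmetric] by (simp add: ks_def)
      finally show "(?M *\<^sub>v vec n c) $ i = (l \<cdot>\<^sub>v vec n c) $ i" using i by simp
    qed (use dim in simp)
  qed
  then have "l \<in> ac_eigenvalues scale u"
    using vs unfolding ac_eigenvalues_def eigenvalue_def by blast
  then show ?thesis using lg(1) by blast
qed

end

section \<open>Cyclic decompositions and companion matrices\<close>

context endo
begin

text \<open>A basis-free form of a decomposition into cyclic modules. The two conditions on
  \<open>x\<close> say that its annihilator is generated by \<open>s\<close> both absolutely and
  modulo \<open>W\<close>, so the cyclic module of \<open>x\<close> is \<open>F[t]/(s)\<close> and
  meets \<open>W\<close> only in 0.\<close>

inductive cyclic_sum :: "'v set \<Rightarrow> 'a poly list \<Rightarrow> bool" where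
  cyclic_sum_Nil: "cyclic_sum {0} []"
| cyclic_sum_Cons: "cyclic_sum W rs \<Longrightarrow> lead_coeff s = 1 \<Longrightarrow> Polynomial.degree s > 0 \<Longrightarrow> act s x = 0
    \<Longrightarrow> (\<And>f. act f x \<in> W \<Longrightarrow> s dvd f) \<Longrightarrow> cyclic_sum {y. \<exists>f. y - act f x \<in> W} (s # rs)"

lemma cyclic_sum_subspace: "cyclic_sum W rs \<Longrightarrow> pm.subspace W"
proof (induction rule: cyclic_sum.induct)
  case (cyclic_sum_Cons W rs s x)
  then have W: "pm.subspace W" by simp
  show ?case
    unfolding pm.subspace_def mem_Collect_eq
  proof (intro conjI ballI allI)
    show "\<exists>f. 0 - act f x \<in> W" using pm.subspace_0[OF W] by (intro exI[of _ 0]) simp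
  next
    fix y y' assume "y \<in> {y. \<exists>f. y - act f x \<in> W}" "y' \<in> {y. \<exists>f. y - act f x \<in> W}"
    then obtain f f' where "y - act f x \<in> W" "y' - act f' x \<in> W" by auto
    from pm.subspace_add[OF W this] show "\<exists>f. y + y' - act f x \<in> W"
      by (intro exI[of _ "f + f'"]) (simp only: act_add_left add_diff_add)
  next
    fix c y assume "y \<in> {y. \<exists>f. y - act f x \<in> W}"
    then obtain f where "y - act f x \<in> W" by auto
    from pm.subspace_scale[OF W this, of c] show "\<exists>f. act c y - act f x \<in> W"
      by (intro exI[of _ "c * f"]) (simp only: act_mult pm.scale_right_diff_distrib)
  qed
qed simp

lemma cyclic_sum_monic:
  "cyclic_sum W rs \<Longrightarrow> r \<in> set rs \<Longrightarrow> lead_coeff r = 1 \<and> Polynomial.degree r > 0"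
  by (induction rule: cyclic_sum.induct) auto

text \<open>Unlike \<open>matrix_wrt\<close>, this makes sense for a list that does not span the
  whole space, so a block matrix can be peeled off one block at a time.\<close>

definition column_rel :: "'v list \<Rightarrow> 'a mat \<Rightarrow> bool"
  where "column_rel vs M \<longleftrightarrow> M \<in> carrier_mat (length vs) (length vs) \<and>
    (\<forall>j<length vs. u (vs ! j) = (\<Sum>i<length vs. M $$ (i, j) *s vs ! i))"

lemma matrix_wrt_eq_iff:
  assumes "ordered_basis scale vs"
  shows "matrix_wrt scale vs u = M \<longleftrightarrow> column_rel vs M"
proof
  assume "matrix_wrt scale vs u = M"
  then show "column_rel vs M"
    using ordered_basis_expand[OF assms] by (auto simp: column_rel_def matrix_wrt_def)
next
  assume M: "column_rel vs M"
  show "matrix_wrt scale vs u = M"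
  proof (rule eq_matI)
    fix i j assume "i < dim_row M" "j < dim_col M"
    then have "i < length vs" "j < length vs"
      using M by (auto simp: column_rel_def dest: carrier_matD)
    then show "matrix_wrt scale vs u $$ (i, j) = M $$ (i, j)"
      using M assms representation_sum_nth[of vs i "\<lambda>i. M $$ (i, j)"]
      by (simp add: column_rel_def matrix_wrt_def ordered_basis_def)
  qed (use M in \<open>auto simp: column_rel_def matrix_wrt_def\<close>)
qed

lemma column_rel_block:
  assumes A: "A \<in> carrier_mat (length xs) (length xs)" and B: "B \<in> carrier_mat (length ys) (length ys)"
  defines "F \<equiv> four_block_mat A (0\<^sub>m (length xs) (length ys)) (0\<^sub>m (length ys) (length xs)) B"
  shows "column_rel (xs @ ys) F \<longleftrightarrow> column_rel xs A \<and> column_rel ys B"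
proof -
  let ?m = "length xs" and ?n = "length ys"
  have F: "F \<in> carrier_mat (?m + ?n) (?m + ?n)"
    unfolding F_def using A B by auto
  have split: "(\<Sum>i<?m + n. g i) = (\<Sum>i<?m. g i) + (\<Sum>i<n. g (?m + i))"
    for g :: "nat \<Rightarrow> 'v" and n
    by (induction n) (simp_all add: add.assoc)
  have c1: "(\<Sum>i<?m + ?n. F $$ (i, j) *s (xs @ ys) ! i) = (\<Sum>i<?m. A $$ (i, j) *s xs ! i)"
    if "j < ?m" for j
    unfolding split using that A B by (simp add: F_def nth_append)
  have c2: "(\<Sum>i<?m + ?n. F $$ (i, ?m + j) *s (xs @ ys) ! i) = (\<Sum>i<?n. B $$ (i, j) *s ys ! i)"
    if "j < ?n" for j
    unfolding split using that A B by (simp add: F_def nth_append)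
  have all: "(\<forall>j<?m + ?n. P j) \<longleftrightarrow> (\<forall>j<?m. P j) \<and> (\<forall>j<?n. P (?m + j))" (is "?A \<longleftrightarrow> ?B") for P
  proof
    assume B: ?B
    show ?A
    proof (intro allI impI)
      fix j assume "j < ?m + ?n"
      then show "P j" using B by (cases "j < ?m") (auto dest: spec[of _ "j - ?m"])
    qed
  qed auto
  show ?thesis
    unfolding column_rel_def length_append all using F A B c1 c2
    by (simp add: nth_append)
qed

lemma companion_column:
  assumes "Polynomial.degree s = n" "j < n"
  shows "(\<Sum>i<n. companion_mat s $$ (i, j) *s e i)
    = (if j = n - 1 then - (\<Sum>i<n. Polynomial.coeff s i *s e i) else e (Suc j))"
proof (cases "j = n - 1")
  case True
  then show ?thesis using assms by (simp add: companion_mat_def sum_negf)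
next
  case False
  then have "(\<Sum>i<n. companion_mat s $$ (i, j) *s e i) = (\<Sum>i<n. if i = Suc j then e i else 0)"
    using assms by (intro sum.cong) (auto simp: companion_mat_def)
  moreover have "Suc j < n" using False assms(2) by linarith
  ultimately show ?thesis using False by simp
qed

lemma act_monic:
  assumes "Polynomial.degree s = n" "lead_coeff s = 1"
  shows "act s x = (\<Sum>i<n. Polynomial.coeff s i *s (u ^^ i) x) + (u ^^ n) x"
  using act_bound[of s "Suc n" x] assms by simp

text \<open>All columns but the last say that each vector is the image of the preceding one; the
  last column then says that \<open>s\<close> kills the first vector.\<close>

lemma column_rel_companion:
  assumes "Polynomial.degree s = n" "lead_coeff s = 1" "n > 0" "length xs = n"
  shows "column_rel xs (companion_mat s) \<longleftrightarrow>
    xs = map (\<lambda>j. (u ^^ j) (hd xs)) [0..<n] \<and> act s (hd xs) = 0" (is "?L \<longleftrightarrow> ?R")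
proof
  assume ?L
  then have col: "u (xs ! j) = (if j = n - 1 then - (\<Sum>i<n. Polynomial.coeff s i *s xs ! i) else xs ! Suc j)"
    if "j < n" for j
    using that assms companion_column[of s n j "\<lambda>i. xs ! i"] by (simp add: column_rel_def)
  have hd: "hd xs = xs ! 0" using assms by (subst hd_conv_nth) auto
  have pow: "xs ! j = (u ^^ j) (hd xs)" if "j < n" for j
    using that
  proof (induction j)
    case (Suc j)
    then have "j < n" "j \<noteq> n - 1" by auto
    then have "xs ! Suc j = u (xs ! j)" using col[of j] by simp
    then show ?case using Suc by simp
  qed (simp add: hd)
  have "(u ^^ n) (hd xs) = u (xs ! (n - 1))"
    using assms(3) pow[of "n - 1"] by (cases n) auto
  also have "\<dots> = - (\<Sum>i<n. Polynomial.coeff s i *s (u ^^ i) (hd xs))"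
    using col[of "n - 1"] assms(3) pow by simp
  finally have "act s (hd xs) = 0" using act_monic[OF assms(1,2)] by simp
  then show ?R using pow assms(4) by (auto intro!: nth_equalityI)
next
  assume R: ?R
  have pow: "xs ! j = (u ^^ j) (hd xs)" if "j < n" for j
    using arg_cong[OF conjunct1[OF R], of "\<lambda>l. l ! j"] that by simp
  have un: "(u ^^ n) (hd xs) = - (\<Sum>i<n. Polynomial.coeff s i *s (u ^^ i) (hd xs))"
    using R act_monic[OF assms(1,2), of "hd xs"] by (simp add: eq_neg_iff_add_eq_0 add.commute)
  have "u (xs ! j) = (\<Sum>i<n. companion_mat s $$ (i, j) *s xs ! i)" if "j < n" for j
  proof (cases "j = n - 1")
    case True
    then have "u (xs ! j) = (u ^^ n) (hd xs)" using that pow[of j] by (cases n) auto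
    then show ?thesis
      using True that un pow companion_column[OF assms(1) that, of "\<lambda>i. xs ! i"] by simp
  next
    case False
    then have "Suc j < n" using that by simp
    then show ?thesis
      using False that pow companion_column[OF assms(1) that, of "\<lambda>i. xs ! i"] by simp
  qed
  then show ?L using assms by (simp add: column_rel_def companion_mat_def)
qed

end

lemma diag_companion_carrier:
  "diag_block_mat (map companion_mat rs) \<in> carrier_mat (sum_list (map Polynomial.degree rs)) (sum_list (map Polynomial.degree rs))"
  by (intro carrier_matI) (simp_all add: dim_diag_block_mat comp_def companion_mat_def)

context endo
begin

lemma column_rel_diag_Cons:
  assumes "length xs = Polynomial.degree s"
    and "length ys = sum_list (map Polynomial.degree rs)"
  shows "column_rel (xs @ ys) (diag_block_mat (map companion_mat (s # rs))) \<longleftrightarrow>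
    column_rel xs (companion_mat s) \<and> column_rel ys (diag_block_mat (map companion_mat rs))"
proof -
  let ?A = "companion_mat s" and ?B = "diag_block_mat (map companion_mat rs)"
  have A: "?A \<in> carrier_mat (length xs) (length xs)" using assms by (simp add: companion_mat_def)
  have B: "?B \<in> carrier_mat (length ys) (length ys)" using assms diag_companion_carrier[of rs] by simp
  have "diag_block_mat (map companion_mat (s # rs)) =
      four_block_mat ?A (0\<^sub>m (length xs) (length ys)) (0\<^sub>m (length ys) (length xs)) ?B"
    using carrier_matD[OF A] carrier_matD[OF B] by (simp add: Let_def)
  then show ?thesis using column_rel_block[OF A B] by simp
qed

lemma column_rel_length:
  assumes "column_rel vs (diag_block_mat (map companion_mat rs))"
  shows "length vs = sum_list (map Polynomial.degree rs)"
proof -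
  have "diag_block_mat (map companion_mat rs) \<in> carrier_mat (length vs) (length vs)"
    using assms unfolding column_rel_def by (rule conjunct1)
  from carrier_matD(1)[OF this] carrier_matD(1)[OF diag_companion_carrier[of rs]]
  show ?thesis by (rule trans[OF sym])
qed

lemma span_krylov_append:
  assumes "Polynomial.degree s = n" "lead_coeff s = 1" "act s x = 0"
  shows "span (set (map (\<lambda>j. (u ^^ j) x) [0..<n] @ ys)) = {y. \<exists>f. y - act f x \<in> span (set ys)}"
proof -
  have "set (map (\<lambda>j. (u ^^ j) x) [0..<n] @ ys) = (\<lambda>j. (u ^^ j) x) ` {..<n} \<union> set ys"
    by (simp add: atLeast0LessThan)
  then have "span (set (map (\<lambda>j. (u ^^ j) x) [0..<n] @ ys))
      = {y + z |y z. y \<in> {act f x |f. True} \<and> z \<in> span (set ys)}"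
    by (simp only: span_Un krylov_span[OF assms])
  also have "\<dots> = {y. \<exists>f. y - act f x \<in> span (set ys)}"
  proof (intro equalityI subsetI)
    fix y assume "y \<in> {y. \<exists>f. y - act f x \<in> span (set ys)}"
    then obtain f where "y - act f x \<in> span (set ys)" by auto
    moreover have "y = act f x + (y - act f x)" by simp
    ultimately show "y \<in> {y + z |y z. y \<in> {act f x |f. True} \<and> z \<in> span (set ys)}" by blast
  next
    fix y assume "y \<in> {y + z |y z. y \<in> {act f x |f. True} \<and> z \<in> span (set ys)}"
    then obtain f z where "y = act f x + z" "z \<in> span (set ys)" by auto
    then have "y - act f x \<in> span (set ys)" by simp
    then show "y \<in> {y. \<exists>f. y - act f x \<in> span (set ys)}" by auto
  qed
  finally show ?thesis .
qed

text \<open>If the remainder of \<open>f\<close> modulo \<open>s\<close> is nonzero, its leading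
  coefficient is the coordinate of \<open>act f x\<close> at an iterate of \<open>x\<close>, whereas
  elements of the span of \<open>ys\<close> have coordinate zero there.\<close>

lemma krylov_dvd:
  assumes vs: "distinct vs" "independent (set vs)"
    and eq: "vs = map (\<lambda>j. (u ^^ j) x) [0..<n] @ ys"
    and s: "Polynomial.degree s = n" "n > 0" "act s x = 0"
    and f: "act f x \<in> span (set ys)"
  shows "s dvd f"
proof (rule ccontr)
  assume "\<not> s dvd f"
  define g where "g = f mod s"
  have "g \<noteq> 0" using \<open>\<not> s dvd f\<close> by (simp add: g_def dvd_eq_mod_eq_0)
  have s0: "s \<noteq> 0" using s by auto
  have deg: "Polynomial.degree g < n"
    using degree_mod_less[OF s0, of f] \<open>g \<noteq> 0\<close> s(1) unfolding g_def by auto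
  have "f = f div s * s + g" by (simp add: g_def)
  then have "act f x = act (f div s * s) x + act g x" by (simp only: act_add_left flip: act_add_left)
  then have gx: "act g x \<in> span (set ys)" using f s(3) by (simp add: act_mult)
  have len: "n \<le> length vs" by (simp add: eq)
  have nth: "vs ! i = (u ^^ i) x" if "i < n" for i using that by (simp add: eq nth_append)
  have "act g x = (\<Sum>i<n. Polynomial.coeff g i *s vs ! i)"
    using act_bound[OF deg, of x] nth by simp
  also have "\<dots> = (\<Sum>i<length vs. Polynomial.coeff g i *s vs ! i)"
    using len deg by (intro sum.mono_neutral_left) (auto simp: coeff_eq_0)
  finally have gsum: "act g x = (\<Sum>i<length vs. Polynomial.coeff g i *s vs ! i)" .
  let ?i = "Polynomial.degree g"
  have i: "?i < length vs" using deg len by simp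
  have "representation (set vs) (act g x) (vs ! ?i) = lead_coeff g"
    unfolding gsum using representation_sum_nth[OF vs i] .
  moreover have "representation (set vs) (act g x) = representation (set ys) (act g x)"
    using vs gx by (intro representation_extend) (auto simp: eq)
  ultimately have "vs ! ?i \<in> set ys"
    using \<open>g \<noteq> 0\<close> representation_ne_zero[of "set ys" "act g x" "vs ! ?i"] by simp
  moreover have "vs ! ?i \<in> set (map (\<lambda>j. (u ^^ j) x) [0..<n])"
    using nth[OF deg] deg by simp
  ultimately show False using vs(1) unfolding eq by auto
qed

lemma cyclic_sum_of_column_rel:
  assumes "\<forall>s\<in>set rs. lead_coeff s = 1 \<and> Polynomial.degree s > 0"
    and "column_rel vs (diag_block_mat (map companion_mat rs))"
    and "distinct vs" and "independent (set vs)"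
  shows "cyclic_sum (span (set vs)) rs"
  using assms
proof (induction rs arbitrary: vs)
  case Nil
  then have "vs = []" using column_rel_length[of vs "[]"] by simp
  then show ?case by (simp add: cyclic_sum_Nil)
next
  case (Cons s rs)
  let ?n = "Polynomial.degree s"
  have s: "lead_coeff s = 1" "?n > 0" using Cons.prems by auto
  have "length vs = ?n + sum_list (map Polynomial.degree rs)"
    using column_rel_length[OF Cons.prems(2)] by simp
  then have len: "length (take ?n vs) = ?n" "length (drop ?n vs) = sum_list (map Polynomial.degree rs)"
    by simp_all
  have rel: "column_rel (take ?n vs) (companion_mat s)"
    "column_rel (drop ?n vs) (diag_block_mat (map companion_mat rs))"
    using Cons.prems(2) column_rel_diag_Cons[OF len] unfolding append_take_drop_id by blast+
  define x where "x = hd (take ?n vs)"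
  have x: "take ?n vs = map (\<lambda>j. (u ^^ j) x) [0..<?n]" "act s x = 0"
    using rel(1) column_rel_companion[OF refl s len(1)] unfolding x_def by blast+
  have vs: "vs = map (\<lambda>j. (u ^^ j) x) [0..<?n] @ drop ?n vs"
    unfolding x(1)[symmetric] by (rule append_take_drop_id[symmetric])
  have IH: "cyclic_sum (span (set (drop ?n vs))) rs"
  proof (rule Cons.IH)
    show "independent (set (drop ?n vs))"
      using independent_mono[OF Cons.prems(4) set_drop_subset] .
  qed (use Cons.prems rel in auto)
  have "span (set vs) = {y. \<exists>f. y - act f x \<in> span (set (drop ?n vs))}"
    using span_krylov_append[OF refl s(1) x(2), of "drop ?n vs"] vs by simp
  moreover have "cyclic_sum {y. \<exists>f. y - act f x \<in> span (set (drop ?n vs))} (s # rs)"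
    using cyclic_sum_Cons[OF IH s x(2)] krylov_dvd[OF Cons.prems(3,4) vs refl s(2) x(2)] by blast
  ultimately show ?case by simp
qed

lemma column_rel_of_cyclic_sum:
  assumes "cyclic_sum W rs"
  shows "\<exists>vs. column_rel vs (diag_block_mat (map companion_mat rs)) \<and> distinct vs \<and>
    independent (set vs) \<and> span (set vs) = W"
  using assms
proof (induction rule: cyclic_sum.induct)
  case cyclic_sum_Nil
  show ?case by (intro exI[of _ "[]"]) (simp add: column_rel_def independent_empty)
next
  case (cyclic_sum_Cons W rs s x)
  then obtain ys where ys: "column_rel ys (diag_block_mat (map companion_mat rs))" "distinct ys"
    "independent (set ys)" "span (set ys) = W" by auto
  let ?n = "Polynomial.degree s"
  let ?xs = "map (\<lambda>j. (u ^^ j) x) [0..<?n]"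
  have K: "set ?xs = (\<lambda>j. (u ^^ j) x) ` {..<?n}" by (simp add: atLeast0LessThan)
  have ann: "act f x \<notin> W" if "f \<noteq> 0" "Polynomial.degree f < ?n" for f
    using cyclic_sum_Cons(5)[of f] that dvd_imp_degree_le[of s f] by auto
  have ind: "independent (set ?xs \<union> set ys) \<and> inj_on (\<lambda>j. (u ^^ j) x) {..<?n} \<and> set ?xs \<inter> set ys = {}"
    unfolding K by (rule krylov_independent[OF ys(4,3)]) (rule ann)
  have "hd ?xs = x" using cyclic_sum_Cons(3) by (subst hd_conv_nth) auto
  then have "column_rel ?xs (companion_mat s)"
    using cyclic_sum_Cons(2-4) by (subst column_rel_companion[of s ?n]) auto
  moreover have "length ys = sum_list (map Polynomial.degree rs)"
    using column_rel_length[OF ys(1)] .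
  ultimately have "column_rel (?xs @ ys) (diag_block_mat (map companion_mat (s # rs)))"
    using ys(1) by (subst column_rel_diag_Cons) auto
  moreover have "distinct (?xs @ ys)"
    using ind ys(2) by (auto simp: distinct_map atLeast0LessThan)
  moreover have "independent (set (?xs @ ys))" using ind by simp
  moreover have "span (set (?xs @ ys)) = {y. \<exists>f. y - act f x \<in> W}"
    using span_krylov_append[OF refl cyclic_sum_Cons(2,4), of ys] ys(4) by simp
  ultimately show ?case by blast
qed

text \<open>This turns the normal form from a statement on matrices into one on modules, the form in
  which existence and uniqueness are treated below.\<close>

lemma is_invariant_factors_iff:
  "is_invariant_factors scale u rs \<longleftrightarrow> cyclic_sum UNIV rs \<and> sorted_wrt (\<lambda>r s. s dvd r) rs"
proof
  assume "is_invariant_factors scale u rs"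
  then obtain vs where "\<forall>s\<in>set rs. lead_coeff s = 1 \<and> Polynomial.degree s > 0"
      "sorted_wrt (\<lambda>r s. s dvd r) rs" "ordered_basis scale vs"
      "column_rel vs (diag_block_mat (map companion_mat rs))"
    unfolding is_invariant_factors_def using matrix_wrt_eq_iff by auto
  then show "cyclic_sum UNIV rs \<and> sorted_wrt (\<lambda>r s. s dvd r) rs"
    using cyclic_sum_of_column_rel[of rs vs] by (simp add: ordered_basis_def)
next
  assume rs: "cyclic_sum UNIV rs \<and> sorted_wrt (\<lambda>r s. s dvd r) rs"
  then obtain vs where "column_rel vs (diag_block_mat (map companion_mat rs))" "ordered_basis scale vs"
    using column_rel_of_cyclic_sum[of UNIV rs] unfolding ordered_basis_def by auto
  then have "\<exists>vs. ordered_basis scale vs \<and> matrix_wrt scale vs u = diag_block_mat (map companion_mat rs)"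
    using matrix_wrt_eq_iff by auto
  then show "is_invariant_factors scale u rs"
    using rs cyclic_sum_monic[of UNIV rs] unfolding is_invariant_factors_def by auto
qed

end

section \<open>The polynomial r\<close>

lemma inverse_mod_shift: "(h::'b::comm_ring_1) * l = 1 + y * s \<Longrightarrow> h * (d * s + l) + - (h * d + y) * s = 1"
  by (simp add: algebra_simps)

text \<open>If \<open>h\<close> inverts \<open>g\<close> modulo \<open>w\<close>, dividing the
  binary form by \<open>g\<^sup>2\<close> leaves the value of \<open>X\<^sup>2 + t X + a\<close> at
  \<open>h f\<close>; the last summand collects the error modulo \<open>w\<close>.\<close>

lemma norm_form_scale:
  fixes h :: "'b::comm_ring_1"
  assumes "h * g + s * w = 1"
  shows "(h * f)\<^sup>2 + t * (h * f) + a
    = h\<^sup>2 * (f\<^sup>2 + t * f * g + a * g\<^sup>2) + (t * (h * f) * s + a * s * (1 + h * g)) * w"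
proof -
  have w: "s * w = 1 - h * g" using assms by (simp add: eq_diff_eq add.commute)
  have "h\<^sup>2 * (f\<^sup>2 + t * f * g + a * g\<^sup>2) + (t * (h * f) * s + a * s * (1 + h * g)) * w
      = h\<^sup>2 * f\<^sup>2 + t * (h * f) * (h * g) + a * (h * g)\<^sup>2 + t * (h * f) * (s * w) + a * (s * w) * (1 + h * g)"
    by (simp add: algebra_simps power2_eq_square)
  also have "\<dots> = (h * f)\<^sup>2 + t * (h * f) + a"
    unfolding w by (simp add: algebra_simps power2_eq_square)
  finally show ?thesis by simp
qed

lemma quadratic_mod_shift:
  fixes l :: "'b::comm_ring_1"
  assumes "l\<^sup>2 + t * l + a = y * w + z"
  shows "(d * w + l)\<^sup>2 + t * (d * w + l) + a = (d\<^sup>2 * w + 2 * d * l + t * d + y) * w + z"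
proof -
  have "(d * w + l)\<^sup>2 + t * (d * w + l) + a = (d\<^sup>2 * w + 2 * d * l + t * d) * w + (l\<^sup>2 + t * l + a)"
    by (simp add: algebra_simps power2_eq_square)
  then show ?thesis unfolding assms by (simp add: algebra_simps)
qed

locale char2_quadratics =
  fixes a c \<tau> :: "'a::field"
  assumes two: "(2::'a) = 0"
    and tau_nz: "\<tau> \<noteq> 0"
    and no_root_p: "s ^ 2 + \<tau> * s + a \<noteq> 0"
    and no_root_q: "s ^ 2 + \<tau> * s + c \<noteq> 0"
    and no_root_r: "s ^ 2 + \<tau> * s + (a + c) \<noteq> 0"
begin

definition r :: "'a poly" where "r = [:a + c, \<tau>, 1:]"

lemma add_self [simp]: "(x::'a) + x = 0"
  using two by (metis mult_2 mult_zero_left)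

lemma minus_self [simp]: "- (x::'a) = x"
  using add_self by (rule minus_unique)

lemma of_nat_parity: "(of_nat n :: 'a) = (if even n then 0 else 1)"
  by (induction n) auto

lemma poly_two: "(2::'a poly) = 0"
  by (simp add: numeral_poly two)

lemma poly_add_self [simp]: "(f::'a poly) + f = 0"
  by (metis mult_2 mult_zero_left poly_two)

lemma poly_minus_self [simp]: "- (f::'a poly) = f"
  by (rule poly_eqI) simp

lemma poly_diff_add: "(f::'a poly) - g = f + g"
  by (metis diff_conv_add_uminus poly_minus_self)

lemma coeff_r: "Polynomial.coeff r 0 = a + c" "Polynomial.coeff r (Suc 0) = \<tau>"
  "Polynomial.coeff r 2 = 1" "Polynomial.coeff r (Suc (Suc 0)) = 1"
  by (simp_all add: r_def numeral_2_eq_2)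

lemma degree_r [simp]: "Polynomial.degree r = 2"
  by (simp add: r_def)

lemma r_nz [simp]: "r \<noteq> 0"
  by (simp add: r_def)

lemma degree_r_power: "Polynomial.degree (r ^ k) = 2 * k"
  by (simp add: degree_power_eq)

lemma degree_r_power_Suc: "Polynomial.degree (r ^ Suc k) = Suc (Suc (2 * k))"
  unfolding degree_r_power by simp

lemma lead_r_power: "lead_coeff (r ^ k) = 1"
  by (simp only: lead_coeff_power degree_r coeff_r power_one)

lemma r_power_inject: "r ^ n = r ^ m \<longleftrightarrow> n = m"
proof
  assume "r ^ n = r ^ m"
  then have "Polynomial.degree (r ^ n) = Polynomial.degree (r ^ m)" by (rule arg_cong)
  then show "n = m" unfolding degree_r_power by simp
qed (rule arg_cong)

lemma r_dvd_linear:
  assumes "r dvd [:x, y:]"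
  shows "x = 0 \<and> y = 0"
proof (rule ccontr)
  assume "\<not> (x = 0 \<and> y = 0)"
  then have "[:x, y:] \<noteq> 0" by auto
  then have "Polynomial.degree r \<le> Polynomial.degree [:x, y:]"
    using assms dvd_imp_degree_le by blast
  then show False by (simp split: if_splits)
qed

lemma mod_r:
  obtains x y where "f mod r = [:x, y:]"
proof -
  have deg: "f mod r = 0 \<or> Polynomial.degree (f mod r) < 2"
    using degree_mod_less[OF r_nz, of f] by simp
  have "f mod r = [:Polynomial.coeff (f mod r) 0, Polynomial.coeff (f mod r) 1:]"
  proof (rule poly_eqI)
    fix n
    show "Polynomial.coeff (f mod r) n
        = Polynomial.coeff [:Polynomial.coeff (f mod r) 0, Polynomial.coeff (f mod r) 1:] n"
    proof (cases "n < 2")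
      case True
      then have "n = 0 \<or> n = 1" by auto
      then show ?thesis by auto
    next
      case False
      then have "Polynomial.coeff (f mod r) n = 0" using deg by (auto intro: coeff_eq_0)
      then show ?thesis using False by (simp add: coeff_pCons split: nat.split)
    qed
  qed
  then show ?thesis using that by blast
qed

text \<open>The inverse of \<open>x + y t\<close> modulo \<open>r\<close> is its conjugate divided
  by its norm, and the norm is nonzero since \<open>r\<close> has no root.\<close>

lemma r_coprime:
  assumes "\<not> r dvd f"
  shows "\<exists>h s. h * f + s * r = 1"
proof -
  obtain x y where xy: "f mod r = [:x, y:]" by (rule mod_r)
  define d where "d = f div r"
  have f: "f = d * r + [:x, y:]" using xy unfolding d_def by (metis div_mult_mod_eq)
  define n where "n = x ^ 2 + \<tau> * x * y + (a + c) * y ^ 2"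
  have "n \<noteq> 0"
  proof (cases "y = 0")
    case True
    then have "x \<noteq> 0" using assms xy by (auto simp: dvd_eq_mod_eq_0)
    then show ?thesis using True by (simp add: n_def)
  next
    case False
    then have "n = y ^ 2 * ((x / y) ^ 2 + \<tau> * (x / y) + (a + c))"
      by (simp add: n_def field_simps power2_eq_square)
    then show ?thesis using False no_root_r[of "x / y"] by simp
  qed
  \<comment> \<open>The second factor is the conjugate: conjugation modulo \<open>r\<close> sends
    \<open>t\<close> to \<open>t + \<tau>\<close>.\<close>
  have "[:x, y:] * [:x + \<tau> * y, y:] = [:n:] + [:y ^ 2:] * r"
    by (simp add: n_def r_def power2_eq_square algebra_simps two)
  then have "[:1 / n:] * ([:x, y:] * [:x + \<tau> * y, y:]) = [:1 / n:] * [:n:] + [:1 / n:] * [:y ^ 2:] * r"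
    by (simp only: distrib_left mult.assoc)
  moreover have "[:1 / n:] * [:n:] = 1" using \<open>n \<noteq> 0\<close> by simp
  ultimately have e: "[:1 / n:] * [:x + \<tau> * y, y:] * [:x, y:] = 1 + [:1 / n:] * [:y ^ 2:] * r"
    by (simp only: mult_ac)
  let ?h = "[:1 / n:] * [:x + \<tau> * y, y:]"
  have "?h * f + - (?h * d + [:1 / n:] * [:y ^ 2:]) * r = 1"
    unfolding f using e by (rule inverse_mod_shift)
  then show ?thesis by blast
qed

lemma r_prime: "r dvd f * g \<Longrightarrow> r dvd f \<or> r dvd g"
proof (rule disjCI)
  assume fg: "r dvd f * g" and "\<not> r dvd g"
  then obtain h s where "h * g + s * r = 1" using r_coprime by blast
  then have "f = f * (h * g + s * r)" by simp
  also have "\<dots> = h * (f * g) + f * s * r" by (simp add: algebra_simps)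
  also have "r dvd \<dots>" by (rule dvd_add[OF dvd_mult[OF fg] dvd_triv_right])
  finally show "r dvd f" .
qed

lemma monic_dvd_r_power:
  assumes "lead_coeff s = 1" "s dvd r ^ n"
  shows "\<exists>k\<le>n. s = r ^ k"
  using assms
proof (induction n arbitrary: s)
  case 0
  then have "s dvd 1" by simp
  then obtain x where "s = [:x:]" using is_unit_polyE by blast
  then show ?case using 0 by (intro exI[of _ 0]) simp
next
  case (Suc n)
  show ?case
  proof (cases "r dvd s")
    case True
    then obtain t where t: "s = r * t" by (elim dvdE)
    then have "t dvd r ^ n" using Suc.prems(2) by simp
    moreover have "lead_coeff t = 1"
      using Suc.prems(1) unfolding t lead_coeff_mult by (simp add: coeff_r)
    ultimately obtain k where "k \<le> n" "t = r ^ k" using Suc.IH by blast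
    then show ?thesis using t by (intro exI[of _ "Suc k"]) simp
  next
    case False
    then obtain h g where "h * s + g * r = 1" using r_coprime[OF False] by blast
    then have "r ^ n = r ^ n * (h * s + g * r)" by simp
    also have "\<dots> = h * r ^ n * s + g * r ^ Suc n" by (simp add: algebra_simps)
    also have "s dvd \<dots>" using Suc.prems(2) by (intro dvd_add dvd_mult) auto
    finally have "s dvd r ^ n" .
    then obtain k where "k \<le> n" "s = r ^ k" using Suc.IH[OF Suc.prems(1)] by blast
    then show ?thesis by (intro exI[of _ k]) simp
  qed
qed

lemma r_power_dvd_cancel:
  assumes "i \<le> n"
  shows "r ^ n dvd r ^ i * f \<longleftrightarrow> r ^ (n - i) dvd f"
proof -
  have "r ^ n = r ^ i * r ^ (n - i)" using assms by (simp flip: power_add)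
  then show ?thesis by simp
qed

text \<open>The form is anisotropic modulo \<open>r\<close>: \<open>t\<^sup>2 + \<tau> t + a\<close> has no root in the field defined by \<open>r\<close>.\<close>

lemma norm_form_anisotropic:
  assumes "r dvd f ^ 2 + [:\<tau>:] * f * g + [:a:] * g ^ 2"
  shows "r dvd f \<and> r dvd g"
proof (cases "r dvd g")
  case True
  then have "r dvd [:\<tau>:] * f * g + [:a:] * g ^ 2"
    unfolding power2_eq_square by (intro dvd_add dvd_mult True)
  then have "r dvd (f ^ 2 + [:\<tau>:] * f * g + [:a:] * g ^ 2) - ([:\<tau>:] * f * g + [:a:] * g ^ 2)"
    by (rule dvd_diff[OF assms])
  then have "r dvd f * f" by (simp add: power2_eq_square)
  then show ?thesis using True r_prime[of f f] by simp
next
  case False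
  then obtain h s where hs: "h * g + s * r = 1" using r_coprime[OF False] by auto
  define t where "t = h * f"
  have "t ^ 2 + [:\<tau>:] * t + [:a:] = h ^ 2 * (f ^ 2 + [:\<tau>:] * f * g + [:a:] * g ^ 2)
      + ([:\<tau>:] * t * s + [:a:] * s * (1 + h * g)) * r"
    unfolding t_def using hs by (rule norm_form_scale)
  also have "r dvd \<dots>" by (intro dvd_add[OF dvd_mult[OF assms] dvd_triv_right])
  finally have rt: "r dvd t ^ 2 + [:\<tau>:] * t + [:a:]" .
  obtain x y where xy: "t mod r = [:x, y:]" by (rule mod_r)
  define d where "d = t div r"
  have t: "t = d * r + [:x, y:]" using xy unfolding d_def by (metis div_mult_mod_eq)
  have id: "[:x, y:] ^ 2 + [:\<tau>:] * [:x, y:] + [:a:]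
      = [:y ^ 2:] * r + [:x ^ 2 + \<tau> * x + a + (a + c) * y ^ 2, \<tau> * y + \<tau> * y ^ 2:]"
    by (simp add: r_def power2_eq_square algebra_simps two)
  have eq: "t ^ 2 + [:\<tau>:] * t + [:a:]
      = (d ^ 2 * r + 2 * d * [:x, y:] + [:\<tau>:] * d + [:y ^ 2:]) * r
        + [:x ^ 2 + \<tau> * x + a + (a + c) * y ^ 2, \<tau> * y + \<tau> * y ^ 2:]"
    unfolding t using id by (rule quadratic_mod_shift)
  have "r dvd [:x ^ 2 + \<tau> * x + a + (a + c) * y ^ 2, \<tau> * y + \<tau> * y ^ 2:]"
    using rt unfolding eq by (simp only: dvd_add_times_triv_left_iff)
  note z = conjunct1[OF r_dvd_linear[OF this]] conjunct2[OF r_dvd_linear[OF this]]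
  \<comment> \<open>The coefficient of \<open>t\<close> leaves only \<open>y = 0\<close> and
    \<open>y = 1\<close>; the constant term then exhibits \<open>x\<close> as a root of
    \<open>p\<close> or of \<open>q\<close>.\<close>
  have "\<tau> * (y * (1 + y)) = 0" using z(2) by (simp add: power2_eq_square algebra_simps)
  then have "y = 0 \<or> y = 1" using tau_nz by (auto simp: add_eq_0_iff)
  then show ?thesis
  proof
    assume "y = 0"
    then show ?thesis using z(1) no_root_p[of x] by simp
  next
    assume "y = 1"
    then have "x ^ 2 + \<tau> * x + (a + a) + c = 0" using z(1) by (simp only: power_one mult_1_right add.assoc)
    then show ?thesis using no_root_q[of x] by simp
  qed
qed

text \<open>The index \<open>2 * k - 1\<close> is one less than the degree of
  \<open>r\<^sup>k\<close>. Every linear form on \<open>F[t]/(r\<^sup>k)\<close> is this one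
  composed with multiplication by some element. For \<open>k = 0\<close> it is zero.\<close>

definition top_coeff :: "nat \<Rightarrow> 'a poly \<Rightarrow> 'a"
  where "top_coeff k f = Polynomial.coeff (f mod r ^ k) (2 * k - 1)"

lemma top_coeff_add: "top_coeff k (f + g) = top_coeff k f + top_coeff k g"
  by (simp add: top_coeff_def poly_mod_add_left)

lemma top_coeff_smult: "top_coeff k (Polynomial.smult x f) = x * top_coeff k f"
  by (simp add: top_coeff_def mod_smult_left)

lemma top_coeff_dvd: "r ^ k dvd f \<Longrightarrow> top_coeff k f = 0"
  by (simp add: top_coeff_def)

lemma top_coeff_cong: "r ^ k dvd f + g \<Longrightarrow> top_coeff k f = top_coeff k g"
  using top_coeff_dvd[of k "f + g"] top_coeff_add[of k f g] by (simp add: add_eq_0_iff)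

lemma top_coeff_reduced: "Polynomial.degree f < 2 * k \<Longrightarrow> top_coeff k f = Polynomial.coeff f (2 * k - 1)"
  by (simp add: top_coeff_def mod_poly_less degree_r_power)

text \<open>A monomial lifts the reduced representative to degree exactly \<open>2 * k - 1\<close>,
  where no reduction takes place and the leading coefficient is read off.\<close>

lemma top_coeff_nondegenerate:
  assumes "\<And>g. top_coeff k (f * g) = 0"
  shows "r ^ k dvd f"
proof (rule ccontr)
  assume nd: "\<not> r ^ k dvd f"
  define f0 where "f0 = f mod r ^ k"
  have f0: "f0 \<noteq> 0" using nd by (simp add: f0_def dvd_eq_mod_eq_0)
  have "Polynomial.degree f0 < 2 * k"
    using degree_mod_less[of "r ^ k" f] f0 by (auto simp: f0_def degree_r_power)
  define e where "e = 2 * k - 1 - Polynomial.degree f0"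
  have e: "e + Polynomial.degree f0 = 2 * k - 1" using \<open>Polynomial.degree f0 < 2 * k\<close> by (simp add: e_def)
  let ?g = "Polynomial.monom 1 e :: 'a poly"
  have deg: "Polynomial.degree (f0 * ?g) = 2 * k - 1"
    using f0 e by (simp add: degree_mult_eq monom_eq_0_iff degree_monom_eq)
  have "r ^ k dvd f * ?g + f0 * ?g"
  proof -
    have "r ^ k dvd f - f0" unfolding f0_def by (rule dvd_minus_mod)
    then have "r ^ k dvd f + f0" unfolding poly_diff_add .
    then have "r ^ k dvd (f + f0) * ?g" by (rule dvd_mult2)
    then show ?thesis by (simp only: distrib_right)
  qed
  then have "top_coeff k (f0 * ?g) = 0" using top_coeff_cong[of k "f * ?g"] assms[of ?g] by simp
  moreover have "top_coeff k (f0 * ?g) = Polynomial.coeff (f0 * ?g) (2 * k - 1)"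
    using deg \<open>Polynomial.degree f0 < 2 * k\<close> by (intro top_coeff_reduced) linarith
  moreover have "Polynomial.coeff (f0 * ?g) (2 * k - 1) \<noteq> 0"
    using f0 leading_coeff_0_iff[of "f0 * ?g"] unfolding deg by (simp add: monom_eq_0_iff)
  ultimately show False by simp
qed

section \<open>Coefficients of powers of \<open>r\<close> and the derivation
  \<open>r d/dt\<close>\<close>

lemma coeff_r_mult:
  "Polynomial.coeff (r * g) (Suc (Suc n)) = (a + c) * Polynomial.coeff g (Suc (Suc n))
    + \<tau> * Polynomial.coeff g (Suc n) + Polynomial.coeff g n"
  by (simp add: r_def add.assoc)

lemma coeff_r_mult_1: "Polynomial.coeff (r * g) (Suc 0) = (a + c) * Polynomial.coeff g (Suc 0) + \<tau> * Polynomial.coeff g 0"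
  by (simp add: r_def)

text \<open>The factor \<open>of_nat (Suc k)\<close> is the source of the dependence on parity in
  \<open>top_coeff_der\<close>.\<close>

lemma coeff_r_power: "Polynomial.coeff (r ^ Suc k) (Suc (2 * k)) = of_nat (Suc k) * \<tau>"
proof (induction k)
  case 0
  then show ?case by (simp add: coeff_r)
next
  case (Suc k)
  have "Polynomial.coeff (r ^ Suc k) (Suc (Suc (2 * k))) = 1" "Polynomial.coeff (r ^ Suc k) (Suc (Suc (Suc (2 * k)))) = 0"
    using lead_r_power[of "Suc k"] coeff_eq_0[of "r ^ Suc k"] unfolding degree_r_power_Suc by blast+
  then have "Polynomial.coeff (r * r ^ Suc k) (Suc (Suc (Suc (2 * k)))) = \<tau> + of_nat (Suc k) * \<tau>"
    unfolding coeff_r_mult Suc by (simp del: of_nat_Suc)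
  then show ?case by (simp add: distrib_right)
qed

text \<open>The factor \<open>r\<close> makes the derivation preserve every ideal
  \<open>(r\<^sup>k)\<close> and so pass to the quotients; its value \<open>r\<close> at
  \<open>t\<close> matches the commutator of \<open>v\<close> and \<open>u\<close>.\<close>

definition der :: "'a poly \<Rightarrow> 'a poly" where "der f = r * pderiv f"

lemma pderiv_r: "pderiv r = [:\<tau>:]"
  by (simp add: r_def pderiv_pCons)

lemma der_add: "der (f + g) = der f + der g"
  by (simp add: der_def pderiv_add distrib_left)

lemma der_mult: "der (f * g) = f * der g + der f * g"
  by (simp add: der_def pderiv_mult algebra_simps)

lemma der_smult: "der (Polynomial.smult x f) = Polynomial.smult x (der f)"
  by (simp add: der_def pderiv_smult)

lemma der_dvd: "r ^ k dvd f \<Longrightarrow> r ^ k dvd der f"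
proof -
  assume "r ^ k dvd f"
  then obtain g where f: "f = r ^ k * g" by (elim dvdE)
  have "r ^ k dvd der (r ^ k)"
  proof (induction k)
    case (Suc k)
    have "der (r ^ Suc k) = r * der (r ^ k) + r ^ Suc k * [:\<tau>:]"
      by (simp only: power_Suc der_mult) (simp add: der_def pderiv_r algebra_simps)
    also have "r ^ Suc k dvd \<dots>"
      unfolding power_Suc[of r k] by (intro dvd_add mult_dvd_mono Suc dvd_refl dvd_triv_left)
    finally show ?case .
  qed simp
  then show ?thesis unfolding f der_mult by simp
qed

text \<open>Second derivatives vanish in characteristic 2, and \<open>r\<close> has derivative
  \<open>\<tau>\<close>. Thus \<open>der\<close> satisfies \<open>X\<^sup>2 + \<tau> X = 0\<close>;
  the constant term \<open>a\<close> has to come from a matrix.\<close>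

lemma der_der: "der (der f) = [:\<tau>:] * der f"
proof -
  have "pderiv (pderiv f) = 0"
    by (rule poly_eqI) (auto simp: coeff_pderiv of_nat_parity simp del: of_nat_Suc)
  then show ?thesis by (simp add: der_def pderiv_mult pderiv_r algebra_simps)
qed

text \<open>Let \<open>h0\<close> be reduced with top coefficient \<open>e\<close>. Then
  \<open>r h0'\<close> has the coefficient \<open>e\<close> in degree \<open>2 k + 2\<close> and
  \<open>\<tau> e\<close> in degree \<open>2 k + 1\<close>, as odd coefficients of a derivative
  vanish. Reduction by \<open>e\<close> times \<open>r\<^sup>k\<^sup>+\<^sup>1\<close> adds
  \<open>(k + 1) \<tau> e\<close> to the latter.\<close>

lemma top_coeff_der:
  "top_coeff (Suc k) (der h) = (if even k then 0 else \<tau> * top_coeff (Suc k) h)"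
proof -
  let ?R = "r ^ Suc k"
  define h0 where "h0 = h mod ?R"
  have deg0: "Polynomial.coeff h0 n = 0" if "n \<ge> Suc (Suc (2 * k))" for n
    using that degree_mod_less[of ?R h] unfolding h0_def
    by (cases "h mod ?R = 0") (auto intro!: coeff_eq_0 simp: degree_r_power_Suc simp del: power_Suc)
  have "?R dvd h - h0" unfolding h0_def by (rule dvd_minus_mod)
  then have R: "?R dvd h + h0" unfolding poly_diff_add .
  have 1: "top_coeff (Suc k) h = top_coeff (Suc k) h0" by (rule top_coeff_cong[OF R])
  have "?R dvd der h + der h0" using der_dvd[OF R] unfolding der_add .
  then have 2: "top_coeff (Suc k) (der h) = top_coeff (Suc k) (der h0)" by (rule top_coeff_cong)
  let ?c = "Polynomial.coeff h0 (Suc (2 * k))"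
  define T where "T = der h0 + Polynomial.smult ?c ?R"
  have g: "Polynomial.coeff (pderiv h0) n = (if even n then Polynomial.coeff h0 (Suc n) else 0)" for n
    by (simp add: coeff_pderiv of_nat_parity del: of_nat_Suc)
  have top: "Polynomial.coeff ?R (Suc (Suc (2 * k))) = 1"
    using lead_r_power[of "Suc k"] unfolding degree_r_power_Suc .
  have Tn: "Polynomial.coeff T n = 0" if n: "n \<ge> Suc (Suc (2 * k))" for n
  proof -
    define m :: nat where "m = n - 2"
    have m: "n = Suc (Suc m)" "m \<ge> 2 * k" using n by (auto simp: m_def)
    show ?thesis
    proof (cases "m = 2 * k")
      case True
      then show ?thesis unfolding m T_def der_def coeff_add coeff_r_mult g coeff_smult using top deg0 by simp
    next
      case False
      then have "Polynomial.coeff ?R n = 0" using m by (intro coeff_eq_0) (simp add: degree_r_power_Suc del: power_Suc)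
      then show ?thesis using False m(2) deg0
        unfolding T_def der_def coeff_add coeff_smult m(1) coeff_r_mult g by simp
    qed
  qed
  then have "Polynomial.degree T < 2 * Suc k"
    by (intro degree_lessI) auto
  then have "top_coeff (Suc k) T = Polynomial.coeff T (Suc (2 * k))"
    by (subst top_coeff_reduced) auto
  also have "\<dots> = \<tau> * ?c + ?c * (of_nat (Suc k) * \<tau>)"
  proof (cases k)
    case 0
    then show ?thesis
      unfolding T_def der_def coeff_add coeff_smult coeff_r_power
      using deg0[of 2] by (simp add: coeff_r_mult_1 g)
  next
    case (Suc j)
    then have e: "Suc (2 * k) = Suc (Suc (Suc (2 * j)))" by simp
    have "Polynomial.coeff (r * pderiv h0) (Suc (2 * k)) = \<tau> * ?c"
      unfolding e coeff_r_mult g using deg0 by simp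
    then show ?thesis unfolding T_def der_def coeff_add coeff_smult coeff_r_power by simp
  qed
  finally have "top_coeff (Suc k) T = (if even k then 0 else \<tau> * ?c)"
    by (simp add: of_nat_parity mult.commute del: of_nat_Suc)
  moreover have "top_coeff (Suc k) (der h0) = top_coeff (Suc k) T"
    by (rule top_coeff_cong) (simp add: T_def add.assoc[symmetric] dvd_smult)
  moreover have "top_coeff (Suc k) h0 = ?c"
  proof -
    have "Polynomial.degree h0 < 2 * Suc k" using deg0 by (intro degree_lessI) auto
    then show ?thesis by (subst top_coeff_reduced) auto
  qed
  ultimately show ?thesis using 1 2 by simp
qed

text \<open>For even \<open>k\<close> both \<open>f\<^sup>2\<close> and \<open>r\<^sup>k\<close>
  have derivative zero. Differentiating the division of \<open>f\<^sup>2\<close> by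
  \<open>r\<^sup>k\<close> with remainder \<open>s\<close> makes \<open>s'\<close> a multiple of
  \<open>r\<^sup>k\<close>, hence zero by degree; and \<open>s'\<close> carries the coefficient of
  \<open>s\<close> at the odd index \<open>2 * k - 1\<close>.\<close>

lemma top_coeff_square:
  assumes "even k"
  shows "top_coeff k (f ^ 2) = 0"
proof (cases k)
  case 0
  then show ?thesis by (simp add: top_coeff_def)
next
  case (Suc j)
  define s where "s = f ^ 2 mod r ^ k"
  define q where "q = f ^ 2 div r ^ k"
  have e: "f ^ 2 = q * r ^ k + s" unfolding q_def s_def by (rule div_mult_mod_eq[symmetric])
  have "pderiv (f ^ 2) = f * pderiv f + f * pderiv f"
    by (simp only: power2_eq_square pderiv_mult)
  then have "pderiv (f ^ 2) = 0" by simp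
  moreover have "pderiv (r ^ k) = 0"
    using assms unfolding Suc pderiv_power_Suc by (simp add: of_nat_parity del: of_nat_Suc)
  ultimately have p: "pderiv q * r ^ k + pderiv s = 0"
    unfolding e by (simp add: pderiv_add pderiv_mult mult.commute)
  have degs: "Polynomial.coeff s n = 0" if "n \<ge> 2 * k" for n
    using that degree_mod_less[of "r ^ k" "f ^ 2"] unfolding s_def
    by (cases "f ^ 2 mod r ^ k = 0") (auto intro!: coeff_eq_0 simp: degree_r_power)
  have ps: "pderiv s = pderiv q * r ^ k" using p by (metis add_eq_0_iff poly_minus_self)
  have "pderiv q = 0"
  proof (rule ccontr)
    assume "pderiv q \<noteq> 0"
    then have "pderiv s \<noteq> 0" unfolding ps by simp
    moreover have "Polynomial.degree (pderiv s) \<ge> 2 * k"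
      using \<open>pderiv q \<noteq> 0\<close> unfolding ps by (simp add: degree_mult_eq degree_r_power)
    ultimately show False
      using degs[of "Suc (Polynomial.degree (pderiv s))"] leading_coeff_0_iff[of "pderiv s"]
      unfolding coeff_pderiv by simp
  qed
  then have "Polynomial.coeff (pderiv s) (2 * j) = 0" using ps by simp
  then have "Polynomial.coeff s (2 * k - 1) = 0"
    unfolding coeff_pderiv Suc by (simp add: of_nat_parity del: of_nat_Suc)
  then show ?thesis unfolding top_coeff_def s_def[symmetric] .
qed

end

section \<open>Counting invariant factors\<close>

locale r_endo = fd_endo scale Basis u + char2_quadratics a c \<tau>
  for scale :: "'a::field \<Rightarrow> 'v::ab_group_add \<Rightarrow> 'v" (infixr "*s" 75)
    and Basis :: "'v set" and u :: "'v \<Rightarrow> 'v" and a c \<tau> :: 'a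
begin

lemma v_add_self [simp]: "(x::'v) + x = 0"
proof -
  have "x + x = (1 + 1) *s x" by (simp only: scale_left_distrib scale_one)
  then show ?thesis by simp
qed

lemma v_minus_self [simp]: "- (x::'v) = x"
  using v_add_self by (rule minus_unique)

lemma v_diff_add: "(x::'v) - y = x + y"
  by (metis diff_conv_add_uminus v_minus_self)

text \<open>
  On a sum of modules \<open>F[t]/(r\<^sup>n)\<close>, the quotient of \<open>slice i j\<close> by \<open>subslice i j\<close> is carried by the
  summands with \<open>n = i + j + 1\<close>, and each of these contributes dimension \<open>2\<close>.
\<close>

definition slice :: "nat \<Rightarrow> nat \<Rightarrow> 'v set \<Rightarrow> 'v set"
  where "slice i j W = {z. (\<exists>y\<in>W. z = act (r ^ i) y) \<and> act (r ^ Suc j) z = 0}"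

definition subslice :: "nat \<Rightarrow> nat \<Rightarrow> 'v set \<Rightarrow> 'v set"
  where "subslice i j W = {z \<in> slice i j W. \<exists>y\<in>W. act (r ^ j) (z - act (r ^ Suc i) y) = 0}"

definition set_sum :: "'v set \<Rightarrow> 'v set \<Rightarrow> 'v set"
  where "set_sum A B = {x + y |x y. x \<in> A \<and> y \<in> B}"

lemma set_sumI: "x \<in> A \<Longrightarrow> y \<in> B \<Longrightarrow> x + y \<in> set_sum A B"
  unfolding set_sum_def by blast

lemma set_sumE:
  assumes "z \<in> set_sum A B"
  obtains x y where "z = x + y" "x \<in> A" "y \<in> B"
  using assms unfolding set_sum_def by blast

lemma slice_subset: "pm.subspace W \<Longrightarrow> slice i j W \<subseteq> W"
  by (auto simp: slice_def pm.subspace_scale)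

lemma act_commute: "act f (act g x) = act g (act f x)"
  by (metis act_mult mult.commute)

lemma pm_subspace_slice:
  assumes "pm.subspace W"
  shows "pm.subspace (slice i j W)"
  unfolding pm.subspace_def
proof (intro conjI ballI allI)
  show "0 \<in> slice i j W" using pm.subspace_0[OF assms] by (auto simp: slice_def intro!: bexI[of _ 0])
next
  fix x y assume "x \<in> slice i j W" "y \<in> slice i j W"
  then obtain x' y' where "x' \<in> W" "x = act (r ^ i) x'" "act (r ^ Suc j) x = 0"
    "y' \<in> W" "y = act (r ^ i) y'" "act (r ^ Suc j) y = 0" unfolding slice_def by blast
  then show "x + y \<in> slice i j W" unfolding slice_def mem_Collect_eq
    by (intro conjI bexI[of _ "x' + y'"])
      (simp_all only: act_add_right pm.subspace_add[OF assms] add_0_left)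
next
  fix f x assume "x \<in> slice i j W"
  then obtain x' where x: "x' \<in> W" "x = act (r ^ i) x'" "act (r ^ Suc j) x = 0"
    unfolding slice_def by blast
  have "act (r ^ Suc j) (act f x) = 0" unfolding act_commute[of "r ^ Suc j" f] x(3) by simp
  moreover have "act f x = act (r ^ i) (act f x')" unfolding x(2) by (rule act_commute)
  ultimately show "act f x \<in> slice i j W"
    unfolding slice_def using pm.subspace_scale[OF assms x(1)] by blast
qed

lemma pm_subspace_subslice:
  assumes "pm.subspace W"
  shows "pm.subspace (subslice i j W)"
  unfolding pm.subspace_def
proof (intro conjI ballI allI)
  note sl = pm_subspace_slice[OF assms, of i j]
  show "0 \<in> subslice i j W" using pm.subspace_0[OF assms] pm.subspace_0[OF sl]
    by (auto simp: subslice_def intro!: bexI[of _ 0])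
  fix x assume x: "x \<in> subslice i j W"
  then obtain x' where x': "x' \<in> W" "act (r ^ j) (x - act (r ^ Suc i) x') = 0" "x \<in> slice i j W"
    unfolding subslice_def by blast
  show "x + y \<in> subslice i j W" if y: "y \<in> subslice i j W" for y
  proof -
    obtain y' where y': "y' \<in> W" "act (r ^ j) (y - act (r ^ Suc i) y') = 0" "y \<in> slice i j W"
      using y unfolding subslice_def by blast
    have "act (r ^ j) (x + y - act (r ^ Suc i) (x' + y'))
        = act (r ^ j) (x - act (r ^ Suc i) x') + act (r ^ j) (y - act (r ^ Suc i) y')"
      by (simp only: act_add_right[symmetric] add_diff_add[symmetric])
    also have "\<dots> = 0" unfolding x'(2) y'(2) by simp
    finally have "act (r ^ j) (x + y - act (r ^ Suc i) (x' + y')) = 0" .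
    then show ?thesis unfolding subslice_def
      using pm.subspace_add[OF sl x'(3) y'(3)] pm.subspace_add[OF assms x'(1) y'(1)] by blast
  qed
  show "act f x \<in> subslice i j W" for f
  proof -
    have "act (r ^ j) (act f x - act (r ^ Suc i) (act f x')) = act f (act (r ^ j) (x - act (r ^ Suc i) x'))"
      by (simp only: act_commute[of _ f] pm.scale_right_diff_distrib)
    also have "\<dots> = 0" unfolding x'(2) by simp
    finally have "act (r ^ j) (act f x - act (r ^ Suc i) (act f x')) = 0" .
    then show ?thesis unfolding subslice_def
      using pm.subspace_scale[OF sl x'(3)] pm.subspace_scale[OF assms x'(1)] by blast
  qed
qed

lemma direct_zero:
  assumes "pm.subspace C" "C \<inter> W = {0}" "x \<in> C" "y \<in> W" "x + y = 0"
  shows "x = 0 \<and> y = 0"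
proof -
  have "y = x" using assms(5) by (metis add_eq_0_iff v_minus_self)
  then have "x \<in> C \<inter> W" using assms(3,4) by simp
  then have "x \<in> {0}" unfolding assms(2) .
  then show ?thesis using \<open>y = x\<close> by simp
qed

lemma slice_sum:
  assumes C: "pm.subspace C" and W: "pm.subspace W" and CW: "C \<inter> W = {0}"
  shows "slice i j (set_sum C W) = set_sum (slice i j C) (slice i j W)"
proof (intro equalityI subsetI)
  fix z assume "z \<in> slice i j (set_sum C W)"
  then obtain s where s: "s \<in> set_sum C W" "z = act (r ^ i) s" "act (r ^ Suc j) z = 0"
    unfolding slice_def by blast
  from s(1) obtain c y where cy: "s = c + y" "c \<in> C" "y \<in> W" by (rule set_sumE)
  note * = cy(2,3) s(2)[unfolded cy(1)] s(3)
  let ?c = "act (r ^ i) c" and ?y = "act (r ^ i) y"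
  have z: "z = ?c + ?y" using *(3) by (simp only: act_add_right)
  have "act (r ^ Suc j) ?c + act (r ^ Suc j) ?y = 0" using *(4) unfolding z act_add_right .
  then have "act (r ^ Suc j) ?c = 0 \<and> act (r ^ Suc j) ?y = 0"
    by (rule direct_zero[OF C CW pm.subspace_scale[OF C pm.subspace_scale[OF C *(1)]]
          pm.subspace_scale[OF W pm.subspace_scale[OF W *(2)]]])
  then have "?c \<in> slice i j C" "?y \<in> slice i j W" using * unfolding slice_def by blast+
  then show "z \<in> set_sum (slice i j C) (slice i j W)" unfolding z by (rule set_sumI)
next
  fix z assume "z \<in> set_sum (slice i j C) (slice i j W)"
  then obtain x y where xy: "z = x + y" "x \<in> slice i j C" "y \<in> slice i j W" by (rule set_sumE)
  from xy(2) obtain x' where x: "x' \<in> C" "x = act (r ^ i) x'" "act (r ^ Suc j) x = 0"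
    unfolding slice_def by blast
  from xy(3) obtain y' where y: "y' \<in> W" "y = act (r ^ i) y'" "act (r ^ Suc j) y = 0"
    unfolding slice_def by blast
  have "act (r ^ Suc j) z = 0" unfolding xy(1) act_add_right x(3) y(3) by simp
  moreover have "z = act (r ^ i) (x' + y')" unfolding xy(1) act_add_right x(2) y(2) ..
  ultimately show "z \<in> slice i j (set_sum C W)"
    unfolding slice_def using set_sumI[OF x(1) y(1)] by blast
qed

lemma subslice_sum:
  assumes C: "pm.subspace C" and W: "pm.subspace W" and CW: "C \<inter> W = {0}"
  shows "subslice i j (set_sum C W) = set_sum (subslice i j C) (subslice i j W)"
proof (intro equalityI subsetI)
  have eq: "act (r ^ j) (x + y - act (r ^ Suc i) (c + d))
      = act (r ^ j) (x - act (r ^ Suc i) c) + act (r ^ j) (y - act (r ^ Suc i) d)" for x y c d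
    by (simp only: act_add_right[symmetric] add_diff_add[symmetric])
  fix z
  { assume "z \<in> subslice i j (set_sum C W)"
    then have "z \<in> slice i j (set_sum C W)"
      and "\<exists>y\<in>set_sum C W. act (r ^ j) (z - act (r ^ Suc i) y) = 0"
      unfolding subslice_def by blast+
    then obtain t where z: "z \<in> set_sum (slice i j C) (slice i j W)" and t: "t \<in> set_sum C W"
      "act (r ^ j) (z - act (r ^ Suc i) t) = 0"
      unfolding slice_sum[OF assms] by blast
    from z obtain x y where xy: "z = x + y" "x \<in> slice i j C" "y \<in> slice i j W" by (rule set_sumE)
    from t(1) obtain c d where cd: "t = c + d" "c \<in> C" "d \<in> W" by (rule set_sumE)
    note * = xy cd(2,3) t(2)[unfolded cd(1)]
    have "x \<in> C" "y \<in> W" using *(2,3) slice_subset[OF C] slice_subset[OF W] by blast+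
    then have m: "act (r ^ j) (x - act (r ^ Suc i) c) \<in> C" "act (r ^ j) (y - act (r ^ Suc i) d) \<in> W"
      using pm.subspace_scale[OF C pm.subspace_diff[OF C _ pm.subspace_scale[OF C *(4)]]]
        pm.subspace_scale[OF W pm.subspace_diff[OF W _ pm.subspace_scale[OF W *(5)]]] by blast+
    have "act (r ^ j) (x - act (r ^ Suc i) c) + act (r ^ j) (y - act (r ^ Suc i) d) = 0"
      using *(6) unfolding *(1) eq .
    from direct_zero[OF C CW m this]
    have "x \<in> subslice i j C" "y \<in> subslice i j W" unfolding subslice_def using * by blast+
    then show "z \<in> set_sum (subslice i j C) (subslice i j W)" unfolding *(1) by (rule set_sumI) }
  { assume "z \<in> set_sum (subslice i j C) (subslice i j W)"
    then obtain x y where z: "z = x + y" "x \<in> subslice i j C" "y \<in> subslice i j W" by (rule set_sumE)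
    then obtain c d where cd: "c \<in> C" "act (r ^ j) (x - act (r ^ Suc i) c) = 0" "x \<in> slice i j C"
      "d \<in> W" "act (r ^ j) (y - act (r ^ Suc i) d) = 0" "y \<in> slice i j W"
      unfolding subslice_def by blast
    have "z \<in> slice i j (set_sum C W)" unfolding slice_sum[OF assms] z(1) by (rule set_sumI[OF cd(3,6)])
    moreover have "act (r ^ j) (z - act (r ^ Suc i) (c + d)) = 0"
      unfolding z(1) eq cd by simp
    ultimately show "z \<in> subslice i j (set_sum C W)"
      unfolding subslice_def using set_sumI[OF cd(1,4)] by blast }
qed

lemma dim_set_sum:
  assumes "subspace A" "subspace B" "A \<subseteq> C" "B \<subseteq> W" "C \<inter> W = {0}"
  shows "dim (set_sum A B) = dim A + dim B"
proof -
  have "A \<inter> B \<subseteq> {0}" using assms by blast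
  then have "dim (A \<inter> B) = 0" using dim_le_card[of "A \<inter> B" "{}"] by simp
  then show ?thesis using dim_sums_Int[OF assms(1,2)] unfolding set_sum_def by linarith
qed

lemma pm_subspace_cyclic: "pm.subspace (range (\<lambda>f. act f x))"
  unfolding pm.subspace_def
proof (intro conjI ballI allI)
  show "0 \<in> range (\<lambda>f. act f x)" by (rule range_eqI[of _ _ 0]) simp
next
  fix y z assume "y \<in> range (\<lambda>f. act f x)" "z \<in> range (\<lambda>f. act f x)"
  then show "y + z \<in> range (\<lambda>f. act f x)" by (auto simp flip: act_add_left)
next
  fix y f assume "y \<in> range (\<lambda>f. act f x)"
  then show "act f y \<in> range (\<lambda>f. act f x)" by (auto simp flip: act_mult)
qed

text \<open>If \<open>n \<le> i + j\<close>, then \<open>r\<^sup>j\<close> already kills the slice;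
  if \<open>n > i + j + 1\<close>, whatever of it \<open>r\<^sup>j\<^sup>+\<^sup>1\<close> kills
  lies in the image of \<open>r\<^sup>i\<^sup>+\<^sup>1\<close>. For \<open>n = i + j + 1\<close>
  there remain the multiples of \<open>r\<^sup>i\<close> modulo those of
  \<open>r\<^sup>i\<^sup>+\<^sup>1\<close>, a copy of \<open>F[t]/(r)\<close>.\<close>

lemma slice_cyclic_dim:
  assumes ann: "\<And>f. act f x = 0 \<longleftrightarrow> r ^ n dvd f"
  defines "C \<equiv> range (\<lambda>f. act f x)"
  shows "dim (slice i j C) = dim (subslice i j C) + (if n = i + j + 1 then 2 else 0)"
proof (cases "n = i + j + 1")
  case False
  have "slice i j C \<subseteq> subslice i j C"
  proof
    fix z assume z: "z \<in> slice i j C"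
    then obtain f where f: "z = act (r ^ i) (act f x)" "act (r ^ Suc j) z = 0"
      unfolding slice_def C_def by blast
    have "\<exists>y\<in>C. act (r ^ j) (z - act (r ^ Suc i) y) = 0"
    proof (cases "n < i + j + 1")
      case True
      then have "r ^ n dvd r ^ (j + i)" by (intro le_imp_power_dvd) simp
      then have "r ^ n dvd r ^ j * r ^ i * f" by (simp only: power_add dvd_mult2)
      then have "act (r ^ j) z = 0" unfolding f(1) act_mult[symmetric] ann by (simp only: mult.assoc)
      then show ?thesis using pm.subspace_0[OF pm_subspace_cyclic, of x] unfolding C_def
        by (intro bexI[of _ 0]) simp_all
    next
      case False
      have "r ^ n dvd r ^ (Suc j + i) * f"
        using f(2) unfolding f(1) act_mult[symmetric] ann power_add by (simp only: mult.assoc)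
      then have "r ^ (n - (Suc j + i)) dvd f"
        using False \<open>n \<noteq> i + j + 1\<close> by (subst (asm) r_power_dvd_cancel) auto
      moreover have "r dvd r ^ (n - (Suc j + i))"
        using False \<open>n \<noteq> i + j + 1\<close> by (intro dvd_power) auto
      ultimately obtain g where "f = r * g" by (metis dvd_trans dvdE)
      then have "z = act (r ^ Suc i) (act g x)"
        unfolding f(1) act_mult[symmetric] power_Suc2 by (simp only: mult.assoc)
      then show ?thesis unfolding C_def by (intro bexI[of _ "act g x"]) auto
    qed
    then show "z \<in> subslice i j C" using z unfolding subslice_def by blast
  qed
  then have eq: "slice i j C = subslice i j C" unfolding subslice_def by blast
  have if0: "(if n = i + j + 1 then 2 else 0) = (0::nat)" by (rule if_not_P[OF False])
  have d: "dim (slice i j C) = dim (subslice i j C)" by (rule arg_cong[OF eq])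
  show ?thesis unfolding if0 d by (rule add_0_right[symmetric])
next
  case True
  have sl: "slice i j C = range (\<lambda>f. act (r ^ i * f) x)"
  proof (intro equalityI subsetI)
    fix z assume "z \<in> slice i j C"
    then obtain f where "z = act (r ^ i) (act f x)" unfolding slice_def C_def by blast
    then show "z \<in> range (\<lambda>f. act (r ^ i * f) x)" by (intro range_eqI[of _ _ f]) (simp only: act_mult)
  next
    fix z assume "z \<in> range (\<lambda>f. act (r ^ i * f) x)"
    then obtain f where f: "z = act (r ^ i * f) x" by blast
    have n: "r ^ n = r ^ Suc j * r ^ i" unfolding True by (simp add: power_add mult_ac)
    have "r ^ n dvd r ^ Suc j * (r ^ i * f)" unfolding n mult.assoc[symmetric] by (rule dvd_triv_left)
    then have "act (r ^ Suc j) z = 0" unfolding f act_mult[symmetric] ann .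
    then show "z \<in> slice i j C" unfolding slice_def C_def f act_mult by blast
  qed
  have sub: "act (r ^ i * f) x \<in> subslice i j C \<longleftrightarrow> r dvd f" for f
  proof -
    have "act (r ^ i * f) x \<in> subslice i j C
        \<longleftrightarrow> (\<exists>g. act (r ^ j) (act (r ^ i * f) x - act (r ^ Suc i) (act g x)) = 0)"
      unfolding subslice_def sl unfolding C_def by blast
    also have "\<dots> \<longleftrightarrow> (\<exists>g. r dvd f - r * g)"
    proof -
      have "act (r ^ j) (act (r ^ i * f) x - act (r ^ Suc i) (act g x))
          = act (r ^ (j + i) * (f - r * g)) x" for g
        unfolding act_mult[symmetric] pm.scale_left_diff_distrib[symmetric]
        by (simp add: power_add right_diff_distrib mult_ac)
      moreover have "r ^ n dvd r ^ (j + i) * h \<longleftrightarrow> r dvd h" for h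
        using r_power_dvd_cancel[of "j + i" n h] True by simp
      ultimately show ?thesis by (simp only: ann)
    qed
    also have "\<dots> \<longleftrightarrow> r dvd f"
    proof
      assume "\<exists>g. r dvd f - r * g"
      then obtain g where "r dvd f - r * g" by blast
      then have "r dvd (f - r * g) + r * g" by (intro dvd_add) auto
      then show "r dvd f" by simp
    next
      assume "r dvd f"
      then show "\<exists>g. r dvd f - r * g" by (intro exI[of _ 0]) simp
    qed
    finally show ?thesis .
  qed
  let ?S = "subslice i j C"
  have pmC: "pm.subspace C" unfolding C_def by (rule pm_subspace_cyclic)
  have S: "subspace ?S" by (rule pm_subspace_imp[OF pm_subspace_subslice[OF pmC]])
  have X: "subspace (slice i j C)" by (rule pm_subspace_imp[OF pm_subspace_slice[OF pmC]])
  \<comment> \<open>The images of 1 and \<open>t\<close>, a basis of \<open>F[t]/(r)\<close>, in the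
    slice.\<close>
  define e where "e = act (r ^ i) x"
  define e' where "e' = act (r ^ i * [:0, 1:]) x"
  have comb: "k *s e + l *s e' = act (r ^ i * [:k, l:]) x" for k l
  proof -
    have "[:k, l:] = [:k:] + [:0, 1:] * [:l:]" by simp
    then have "r ^ i * [:k, l:] = [:k:] * r ^ i + [:l:] * (r ^ i * [:0, 1:])"
      by (simp only: distrib_left mult_ac)
    then show ?thesis unfolding e_def e'_def by (simp only: act_add_left act_mult act_const)
  qed
  have notin: "k *s e + l *s e' \<in> ?S \<longleftrightarrow> k = 0 \<and> l = 0" for k l
    unfolding comb sub using r_dvd_linear[of k l] by auto
  have n1: "e' \<notin> span ?S" using notin[of 0 1] S by (simp add: span_eq_iff[THEN iffD2])
  have n2: "e \<notin> span (insert e' ?S)"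
  proof
    assume "e \<in> span (insert e' ?S)"
    then obtain k where "e - k *s e' \<in> span ?S" using span_breakdown_eq by blast
    then have "1 *s e + k *s e' \<in> ?S" using S unfolding v_diff_add by (simp add: span_eq_iff[THEN iffD2])
    then show False unfolding notin by simp
  qed
  have "span (insert e (insert e' ?S)) = slice i j C"
  proof (intro equalityI span_minimal X subsetI)
    fix z assume "z \<in> insert e (insert e' ?S)"
    then show "z \<in> slice i j C"
    proof (elim insertE)
      assume "z = e" then show ?thesis unfolding sl e_def by (intro range_eqI[of _ _ 1]) simp
    next
      assume "z = e'" then show ?thesis unfolding sl e'_def by (intro range_eqI[of _ _ "[:0,1:]"]) simp
    qed (simp add: subslice_def)
  next
    fix z assume "z \<in> slice i j C"
    then obtain f where f: "z = act (r ^ i * f) x" unfolding sl by blast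
    obtain k l where kl: "f mod r = [:k, l:]" by (rule mod_r)
    have "r dvd f - [:k, l:]" unfolding kl[symmetric] by (rule dvd_minus_mod)
    then have 1: "act (r ^ i * (f - [:k, l:])) x \<in> ?S" unfolding sub .
    have "f = (f - [:k, l:]) + [:k, l:]" by (rule diff_add_cancel[symmetric])
    then have "r ^ i * f = r ^ i * (f - [:k, l:]) + r ^ i * [:k, l:]"
      unfolding distrib_left[symmetric] by (rule arg_cong)
    then have z: "z = act (r ^ i * (f - [:k, l:])) x + (k *s e + l *s e')"
      unfolding f comb act_add_left[symmetric] by (rule arg_cong)
    show "z \<in> span (insert e (insert e' ?S))"
      unfolding z by (intro span_add span_scale span_base) (use 1 in simp_all)
  qed
  then have "dim (slice i j C) = dim (insert e (insert e' ?S))"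
    using dim_span[of "insert e (insert e' ?S)"] by simp
  also have "\<dots> = dim ?S + 2" using n1 n2 by (simp add: dim_insert)
  finally show ?thesis using True by simp
qed

text \<open>Multiplicities become dimensions of spaces defined by \<open>u\<close> alone. The choice
  \<open>i = 0\<close> serves the uniqueness of the invariant factors, the symmetric choice
  \<open>i = j\<close> the orthogonality argument.\<close>

lemma slice_dim:
  assumes "cyclic_sum W rs" "\<And>s. s \<in> set rs \<Longrightarrow> \<exists>k. s = r ^ k"
  shows "dim (slice i j W) = dim (subslice i j W) + 2 * count_list rs (r ^ (i + j + 1))"
  using assms
proof (induction rule: cyclic_sum.induct)
  case cyclic_sum_Nil
  have "slice i j {0} \<subseteq> {0}" "subslice i j {0} \<subseteq> {0}" by (auto simp: slice_def subslice_def)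
  then have d: "dim (slice i j {0}) = 0" "dim (subslice i j {0}) = 0"
    using dim_le_card[of _ "{}"] by simp_all
  show ?case unfolding d by simp
next
  case (cyclic_sum_Cons W rs s x)
  obtain n where s: "s = r ^ n" using cyclic_sum_Cons.prems[of s] by auto
  let ?C = "range (\<lambda>f. act f x)"
  note C = pm_subspace_cyclic[of x] and W = cyclic_sum_subspace[OF cyclic_sum_Cons(1)]
  have sum: "{y. \<exists>f. y - act f x \<in> W} = set_sum ?C W"
  proof (intro equalityI subsetI)
    fix y assume "y \<in> {y. \<exists>f. y - act f x \<in> W}"
    then obtain f where "y - act f x \<in> W" by blast
    then have "act f x + (y - act f x) \<in> set_sum ?C W" by (intro set_sumI) auto
    then show "y \<in> set_sum ?C W" by simp
  next
    fix y assume "y \<in> set_sum ?C W"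
    then obtain b z where bz: "y = b + z" "b \<in> ?C" "z \<in> W" by (rule set_sumE)
    then obtain f where "b = act f x" by blast
    then have "y - act f x = z" using bz(1) by simp
    then show "y \<in> {y. \<exists>f. y - act f x \<in> W}" using bz(3) by auto
  qed
  have ann: "act f x = 0 \<longleftrightarrow> r ^ n dvd f" for f
  proof
    assume "act f x = 0"
    then show "r ^ n dvd f" using cyclic_sum_Cons(5)[of f] pm.subspace_0[OF W] s by simp
  next
    assume "r ^ n dvd f"
    then obtain g where "f = r ^ n * g" by (elim dvdE)
    then have "act f x = act g (act s x)" unfolding s act_mult[symmetric] by (simp only: mult.commute)
    then show "act f x = 0" using cyclic_sum_Cons(4) by simp
  qed
  have CW: "?C \<inter> W = {0}"
  proof (intro equalityI subsetI)
    fix y assume "y \<in> ?C \<inter> W"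
    then obtain f where "y = act f x" "act f x \<in> W" by blast
    then show "y \<in> {0}" using cyclic_sum_Cons(5)[of f] ann[of f] s by simp
  next
    fix y assume "y \<in> {0::'v}"
    then show "y \<in> ?C \<inter> W" using pm.subspace_0[OF C] pm.subspace_0[OF W] by blast
  qed
  have sub: "subslice i j V \<subseteq> V" if "pm.subspace V" for V
    using slice_subset[OF that, of i j] unfolding subslice_def by blast
  have 1: "dim (slice i j (set_sum ?C W)) = dim (slice i j ?C) + dim (slice i j W)"
    unfolding slice_sum[OF C W CW]
    by (rule dim_set_sum[OF pm_subspace_imp[OF pm_subspace_slice[OF C]]
          pm_subspace_imp[OF pm_subspace_slice[OF W]] slice_subset[OF C] slice_subset[OF W] CW])
  have 2: "dim (subslice i j (set_sum ?C W)) = dim (subslice i j ?C) + dim (subslice i j W)"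
    unfolding subslice_sum[OF C W CW]
    by (rule dim_set_sum[OF pm_subspace_imp[OF pm_subspace_subslice[OF C]]
          pm_subspace_imp[OF pm_subspace_subslice[OF W]] sub[OF C] sub[OF W] CW])
  have IH: "dim (slice i j W) = dim (subslice i j W) + 2 * count_list rs (r ^ (i + j + 1))"
    using cyclic_sum_Cons by simp
  show ?case
    unfolding sum 1 2 slice_cyclic_dim[OF ann] IH using r_power_inject[of n "i + j + 1"] s by simp
qed

lemma cyclic_sum_dvd:
  "cyclic_sum W rs \<Longrightarrow> (\<And>x. x \<in> W \<Longrightarrow> act g x = 0) \<Longrightarrow> s \<in> set rs \<Longrightarrow> s dvd g"
proof (induction rule: cyclic_sum.induct)
  case (cyclic_sum_Cons W rs s' x)
  note W = cyclic_sum_subspace[OF cyclic_sum_Cons(1)]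
  show ?case
  proof (cases "s = s'")
    case True
    have "x - act 1 x \<in> W" using pm.subspace_0[OF W] by simp
    then have "act g x = 0" using cyclic_sum_Cons.prems(1)[of x] by blast
    then show ?thesis using cyclic_sum_Cons(5)[of g] pm.subspace_0[OF W] True by simp
  next
    case False
    have "act g y = 0" if "y \<in> W" for y
    proof -
      have "y - act 0 x \<in> W" using that by simp
      then show ?thesis using cyclic_sum_Cons.prems(1)[of y] by blast
    qed
    then show ?thesis using cyclic_sum_Cons False by simp
  qed
qed simp

end

section \<open>Alternating forms and orthogonality\<close>

locale symplectic_endo = r_endo scale Basis u a c \<tau>
  for scale :: "'a::field \<Rightarrow> 'v::ab_group_add \<Rightarrow> 'v" (infixr "*s" 75)
    and Basis :: "'v set" and u :: "'v \<Rightarrow> 'v" and a c \<tau> :: 'a +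
  fixes b :: "'v \<Rightarrow> 'v \<Rightarrow> 'a"
  assumes symplectic: "symplectic_pair scale b u"
begin

lemma b_linear: "Vector_Spaces.linear scale (*) (b x)" "Vector_Spaces.linear scale (*) (\<lambda>x. b x y)"
  using symplectic by (auto simp: symplectic_pair_def symplectic_form_def bilinear_form_def)

lemma b_add_right: "b x (y + z) = b x y + b x z"
  using b_linear(1) by (rule Vector_Spaces.linear.axioms(3)[THEN module_hom.add])

lemma b_add_left: "b (x + y) z = b x z + b y z"
  using b_linear(2) by (rule Vector_Spaces.linear.axioms(3)[THEN module_hom.add])

lemma b_scale_right: "b x (k *s y) = k * b x y"
  using b_linear(1) by (rule Vector_Spaces.linear.axioms(3)[THEN module_hom.scale])

lemma b_scale_left: "b (k *s x) y = k * b x y"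
  using b_linear(2) by (rule Vector_Spaces.linear.axioms(3)[THEN module_hom.scale])

lemma b_self [simp]: "b x x = 0"
  using symplectic by (simp add: symplectic_pair_def symplectic_form_def)

lemma b_zero_right [simp]: "b x 0 = 0"
  using b_scale_right[of x 0 0] by simp

lemma b_zero_left [simp]: "b 0 x = 0"
  using b_scale_left[of 0 0 x] by simp

lemma b_nondegenerate: "(\<And>y. b x y = 0) \<Longrightarrow> x = 0"
  using symplectic by (simp add: symplectic_pair_def symplectic_form_def)

lemma b_sym: "b x y = b y x"
proof -
  have "b (x + y) (x + y) = (b x x + b y x) + (b x y + b y y)" by (simp only: b_add_left b_add_right)
  then have "b y x + b x y = 0" unfolding b_self by simp
  then show ?thesis by (simp add: add_eq_0_iff)
qed

lemma alternating_adjoint: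
  assumes "\<And>x y. h (x + y) = h x + h y" "\<And>x. b x (h x) = 0"
  shows "b (h x) y = b x (h y)"
proof -
  have "b (x + y) (h (x + y)) = (b x (h x) + b y (h x)) + (b x (h y) + b y (h y))"
    by (simp only: b_add_left b_add_right assms(1))
  then have "b y (h x) + b x (h y) = 0" unfolding assms(2) by simp
  then show ?thesis using b_sym[of y "h x"] by (simp add: add_eq_0_iff)
qed

lemma b_u_self [simp]: "b x (u x) = 0"
  using symplectic by (simp add: symplectic_pair_def alternating_endo_def)

lemma b_u: "b (u x) y = b x (u y)"
  by (rule alternating_adjoint) (simp_all add: u_add)

lemma b_act: "b (act f x) y = b x (act f y)"
proof (induction f arbitrary: y)
  case (pCons k f)
  then show ?case by (simp add: b_add_left b_add_right b_scale_left b_scale_right b_u act_u)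
qed simp

text \<open>Self-adjointness does not give this in characteristic 2. An even power of
  \<open>u\<close> is split into equal halves and \<open>b\<close> is alternating; an odd power
  leaves one \<open>u\<close> in the middle, and \<open>u\<close> is alternating.\<close>

lemma b_act_self: "b x (act f x) = 0"
proof -
  have pow: "b x ((u ^^ (m + n)) y) = b ((u ^^ m) x) ((u ^^ n) y)" for m n x y
  proof (induction m arbitrary: x)
    case (Suc m)
    have "b x ((u ^^ (Suc m + n)) y) = b (u x) ((u ^^ (m + n)) y)" by (simp add: b_u)
    also have "\<dots> = b ((u ^^ m) (u x)) ((u ^^ n) y)" by (rule Suc.IH)
    also have "(u ^^ m) (u x) = (u ^^ Suc m) x" by (simp add: funpow_swap1)
    finally show ?case .
  qed simp
  have zero: "b x ((u ^^ n) x) = 0" for n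
  proof (cases "even n")
    case True
    then obtain m where "n = 2 * m" by (elim evenE)
    then have "n = m + m" by simp
    then show ?thesis using pow[of x m m x] by simp
  next
    case False
    then obtain m where "n = 2 * m + 1" by (elim oddE)
    then have "n = m + Suc m" by simp
    then show ?thesis using pow[of x m "Suc m" x] by simp
  qed
  have "b x (\<Sum>i\<in>A. Polynomial.coeff f i *s (u ^^ i) x) = 0" for A
    by (induction A rule: infinite_finite_induct) (simp_all add: b_add_right b_scale_right zero)
  then show ?thesis unfolding act_def poly_endo_def .
qed

section \<open>Orthogonals inside a possibly degenerate subspace\<close>

definition perp_in :: "'v set \<Rightarrow> 'v set \<Rightarrow> 'v set"
  where "perp_in G W = {y \<in> G. \<forall>x\<in>W. b x y = 0}"

lemma subspace_perp_in: "subspace G \<Longrightarrow> subspace (perp_in G W)"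
  unfolding perp_in_def subspace_def by (simp add: b_add_right b_scale_right)

lemma pm_subspace_perp_in:
  assumes "pm.subspace G" "pm.subspace W"
  shows "pm.subspace (perp_in G W)"
proof (rule pm_subspaceI)
  show "subspace (perp_in G W)" by (rule subspace_perp_in[OF pm_subspace_imp[OF assms(1)]])
  fix x assume "x \<in> perp_in G W"
  then show "u x \<in> perp_in G W"
    using pm_subspace_u[OF assms(1)] pm_subspace_u[OF assms(2)] unfolding perp_in_def
    by (simp add: b_u[symmetric])
qed

lemma perp_in_span: "perp_in G (span S) = perp_in G S"
proof (intro equalityI subsetI)
  fix y assume y: "y \<in> perp_in G S"
  have "b x y = 0" if "x \<in> span S" for x
    using that
  proof (induction rule: span_induct_alt)
    case (step k z w)
    then show ?case using y by (simp add: perp_in_def b_add_left b_scale_left)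
  qed simp
  then show "y \<in> perp_in G (span S)" using y by (simp add: perp_in_def)
qed (auto simp: perp_in_def span_base)

lemma dim_kernel_le:
  assumes "subspace Z"
  shows "dim Z \<le> dim {z \<in> Z. b x z = 0} + 1"
proof (cases "\<forall>z\<in>Z. b x z = 0")
  case True
  then have "{z \<in> Z. b x z = 0} = Z" by blast
  then show ?thesis by simp
next
  case False
  then obtain e where e: "e \<in> Z" "b x e \<noteq> 0" by blast
  let ?K = "{z \<in> Z. b x z = 0}"
  have "Z \<subseteq> span (insert e ?K)"
  proof
    fix z assume z: "z \<in> Z"
    let ?k = "b x z / b x e"
    have "b x (z + ?k *s e) = 0" using e(2) by (simp add: b_add_right b_scale_right)
    moreover have "z + ?k *s e \<in> Z" using assms z e(1) by (simp add: subspace_add subspace_scale)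
    ultimately have "z + ?k *s e \<in> ?K" by simp
    then have "z - ?k *s e \<in> span ?K" unfolding v_diff_add by (rule span_base)
    then show "z \<in> span (insert e ?K)" unfolding span_breakdown_eq by blast
  qed
  then have "dim Z \<le> dim (span (insert e ?K))" by (rule dim_subset)
  also have "\<dots> \<le> dim ?K + 1" by (simp add: dim_insert)
  finally show ?thesis .
qed

text \<open>Enlarging \<open>W\<close> by one vector imposes one more linear condition on the
  orthogonal, whose dimension therefore drops by at most one.\<close>

lemma dim_plus_perp_mono:
  assumes "subspace G" "subspace W" "subspace W'" "W \<subseteq> W'"
  shows "dim W + dim (perp_in G W) \<le> dim W' + dim (perp_in G W')"
  using assms(2-4)
proof (induction "dim W' - dim W" arbitrary: W rule: less_induct)
  case less
  show ?case
  proof (cases "W = W'")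
    case False
    then obtain x where x: "x \<in> W'" "x \<notin> W" using less.prems by blast
    let ?W = "span (insert x W)"
    have sp: "span W = W" using less.prems(1) by (simp add: span_eq_iff)
    have dW: "dim ?W = dim W + 1" using x(2) by (simp add: dim_insert sp)
    have sub: "?W \<subseteq> W'" using x(1) less.prems by (intro span_minimal) auto
    have "dim ?W \<le> dim W'" by (rule dim_subset[OF sub])
    then have "dim ?W + dim (perp_in G ?W) \<le> dim W' + dim (perp_in G W')"
      using dW sub less.prems(2) by (intro less.hyps) simp_all
    moreover have "perp_in G ?W = {z \<in> perp_in G W. b x z = 0}"
      unfolding perp_in_span by (auto simp: perp_in_def)
    moreover have "dim (perp_in G W) \<le> dim {z \<in> perp_in G W. b x z = 0} + 1"
      by (rule dim_kernel_le[OF subspace_perp_in[OF assms(1)]])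
    ultimately show ?thesis using dW by simp
  qed simp
qed

text \<open>The monotone sum is squeezed between its values at the radical, whose orthogonal is all
  of \<open>G\<close>, and at \<open>G\<close>; both are
  \<open>dim G + dim (perp_in G G)\<close>.\<close>

lemma dim_plus_perp:
  assumes "subspace G" "subspace W" "perp_in G G \<subseteq> W" "W \<subseteq> G"
  shows "dim W + dim (perp_in G W) = dim G + dim (perp_in G G)"
proof -
  have "perp_in G (perp_in G G) = G"
    unfolding perp_in_def using b_sym by auto
  then show ?thesis
    using dim_plus_perp_mono[OF assms(1) subspace_perp_in[OF assms(1)] assms(2,3)]
      dim_plus_perp_mono[OF assms(1,2,1,4)] by simp
qed

lemma perp_in_perp_in:
  assumes "subspace G" "subspace W" "perp_in G G \<subseteq> {0}" "W \<subseteq> G"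
  shows "perp_in G (perp_in G W) = W"
proof -
  have sub: "W \<subseteq> perp_in G (perp_in G W)" using assms(4) b_sym unfolding perp_in_def by auto
  have P: "subspace (perp_in G W)" by (rule subspace_perp_in[OF assms(1)])
  have PP: "subspace (perp_in G (perp_in G W))" by (rule subspace_perp_in[OF assms(1)])
  have 0: "perp_in G G \<subseteq> V" if "subspace V" for V
    using assms(3) subspace_0[OF that] by blast
  have PG: "perp_in G W \<subseteq> G" by (auto simp: perp_in_def)
  have "dim (perp_in G (perp_in G W)) \<le> dim W"
    using dim_plus_perp[OF assms(1,2) 0[OF assms(2)] assms(4)] dim_plus_perp[OF assms(1) P 0[OF P] PG]
    by linarith
  then show ?thesis using subspace_dim_equal[OF assms(2) PP sub] by simp
qed

lemma perp_UNIV: "perp_in UNIV UNIV \<subseteq> {0}"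
proof
  fix x assume "x \<in> perp_in UNIV UNIV"
  then have "b x y = 0" for y using b_sym[of x y] by (simp add: perp_in_def)
  then show "x \<in> {0}" using b_nondegenerate[of x] by simp
qed

end

section \<open>Divisibility by eight\<close>

context r_endo
begin

lemma pm_subspace_set_sum:
  assumes "pm.subspace A" "pm.subspace B"
  shows "pm.subspace (set_sum A B)"
  unfolding pm.subspace_def
proof (intro conjI ballI allI)
  show "0 \<in> set_sum A B"
    using set_sumI[OF pm.subspace_0[OF assms(1)] pm.subspace_0[OF assms(2)]] by simp
next
  fix x y assume "x \<in> set_sum A B" "y \<in> set_sum A B"
  then obtain x1 x2 y1 y2 where *: "x = x1 + x2" "x1 \<in> A" "x2 \<in> B" "y = y1 + y2" "y1 \<in> A" "y2 \<in> B"
    by (elim set_sumE) blast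
  have "x + y = (x1 + y1) + (x2 + y2)" unfolding *(1,4) by (simp only: add_ac)
  then show "x + y \<in> set_sum A B"
    using set_sumI[OF pm.subspace_add[OF assms(1) *(2,5)] pm.subspace_add[OF assms(2) *(3,6)]] by simp
next
  fix f x assume "x \<in> set_sum A B"
  then obtain x1 x2 where *: "x = x1 + x2" "x1 \<in> A" "x2 \<in> B" by (rule set_sumE)
  show "act f x \<in> set_sum A B" unfolding *(1) act_add_right
    by (rule set_sumI[OF pm.subspace_scale[OF assms(1) *(2)] pm.subspace_scale[OF assms(2) *(3)]])
qed

end

text \<open>
  Writing \<open>u = u\<^sub>1 - u\<^sub>2\<close> with \<open>v = u\<^sub>1\<close>, the conditions \<open>p(u\<^sub>1) = 0\<close> and \<open>q(u\<^sub>2) = 0\<close> say that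
  \<open>v\<^sup>2 + \<tau> v + a = 0\<close> and \<open>v u + u v = r(u)\<close>.
\<close>

locale splitting = r_endo scale Basis u a c \<tau>
  for scale :: "'a::field \<Rightarrow> 'v::ab_group_add \<Rightarrow> 'v" (infixr "*s" 75)
    and Basis :: "'v set" and u :: "'v \<Rightarrow> 'v" and a c \<tau> :: 'a +
  fixes v :: "'v \<Rightarrow> 'v"
  assumes v_add: "v (x + y) = v x + v y" and v_scale: "v (k *s x) = k *s v x"
    and v_v: "v (v x) = \<tau> *s v x + a *s x"
    and v_u: "v (u x) = u (v x) + act r x"
begin

lemma v_zero [simp]: "v 0 = 0"
  using v_scale[of 0 0] by simp

lemma v_act: "v (act f x) = act f (v x) + act (der f) x"
proof (induction f)
  case (pCons k f)
  have der: "der (pCons k f) = r * f + [:0, 1:] * der f"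
    by (simp add: der_def pderiv_pCons distrib_left)
  have "v (act (pCons k f) x) = k *s v x + (u (act f (v x)) + u (act (der f) x)) + act r (act f x)"
    by (simp add: v_add v_scale v_u pCons.IH u_add add_ac del: pm.scale_scale)
  moreover have "act (der (pCons k f)) x = act r (act f x) + u (act (der f) x)"
    unfolding der act_add_left act_mult by simp
  ultimately show ?case by (simp add: add_ac)
qed (simp add: der_def)

section \<open>Subspaces stable under \<open>u\<close> and \<open>v\<close>\<close>

definition stable :: "'v set \<Rightarrow> bool"
  where "stable W \<longleftrightarrow> pm.subspace W \<and> (\<forall>x\<in>W. v x \<in> W)"

lemma der_r_power: "\<exists>g. der (r ^ n) = g * r ^ n"
  using der_dvd[OF dvd_refl, of n] by (auto elim!: dvdE simp: mult.commute)

text \<open>Although \<open>v\<close> does not commute with \<open>r(u)\<^sup>n\<close>, the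
  correction \<open>der (r ^ n)\<close> is a multiple of \<open>r ^ n\<close>; so kernels, and by
  \<open>v_image\<close> also images, are preserved.\<close>

lemma v_kernel:
  assumes "act (r ^ n) z = 0"
  shows "act (r ^ n) (v z) = 0"
proof -
  obtain g where g: "der (r ^ n) = g * r ^ n" using der_r_power by blast
  have "0 = act (r ^ n) (v z) + act g (act (r ^ n) z)"
    using v_act[of "r ^ n" z] unfolding g act_mult assms by simp
  then show ?thesis unfolding assms by simp
qed

lemma v_image: "\<exists>y'. v (act (r ^ n) y) = act (r ^ n) y'"
proof -
  obtain g where g: "der (r ^ n) = g * r ^ n" using der_r_power by blast
  have "v (act (r ^ n) y) = act (r ^ n) (v y + act g y)"
    unfolding v_act g by (simp only: act_add_right act_mult act_commute[of g])
  then show ?thesis by blast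
qed

lemma stable_slice: "stable (slice i j UNIV)"
  unfolding stable_def
proof (intro conjI ballI)
  show "pm.subspace (slice i j UNIV)" by (rule pm_subspace_slice) simp
  fix z assume "z \<in> slice i j UNIV"
  then obtain y where y: "z = act (r ^ i) y" "act (r ^ Suc j) z = 0" unfolding slice_def by blast
  then show "v z \<in> slice i j UNIV" unfolding slice_def using v_image[of i y] v_kernel[OF y(2)] by blast
qed

lemma stable_subslice: "stable (subslice i j UNIV)"
  unfolding stable_def
proof (intro conjI ballI)
  show "pm.subspace (subslice i j UNIV)" by (rule pm_subspace_subslice) simp
  fix z assume "z \<in> subslice i j UNIV"
  then obtain y where y: "z \<in> slice i j UNIV" "act (r ^ j) (z - act (r ^ Suc i) y) = 0"
    unfolding subslice_def by blast
  obtain y' where y': "v (act (r ^ Suc i) y) = act (r ^ Suc i) y'" using v_image by blast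
  have "v (z - act (r ^ Suc i) y) = v z - act (r ^ Suc i) y'"
    unfolding v_diff_add v_add y' ..
  then have "act (r ^ j) (v z - act (r ^ Suc i) y') = 0" using v_kernel[OF y(2)] by simp
  then show "v z \<in> subslice i j UNIV"
    unfolding subslice_def using y(1) stable_slice unfolding stable_def by blast
qed

text \<open>So \<open>r(u)\<close> is zero on the quotient of the slice, where consequently
  \<open>u\<close> and \<open>v\<close> commute.\<close>

lemma act_r_slice:
  assumes "z \<in> slice i i UNIV"
  shows "act r z \<in> subslice i i UNIV"
proof -
  obtain y where y: "z = act (r ^ i) y" "act (r ^ Suc i) z = 0" using assms unfolding slice_def by blast
  have "act r z \<in> slice i i UNIV"
    using pm.subspace_scale[OF pm_subspace_slice assms] by simp
  moreover have "act r z = act (r ^ Suc i) y" unfolding y(1) act_mult[symmetric] by simp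
  ultimately show ?thesis unfolding subslice_def by (auto intro!: exI[of _ y] bexI[of _ y])
qed

text \<open>Two cyclic modules are enough: \<open>v\<^sup>2\<close> is a combination of
  \<open>v\<close> and the identity, and moving \<open>v\<close> past a polynomial in
  \<open>u\<close> only adds another polynomial in \<open>u\<close>.\<close>

definition adjoin :: "'v set \<Rightarrow> 'v \<Rightarrow> 'v set"
  where "adjoin W x = set_sum W (set_sum (range (\<lambda>f. act f x)) (range (\<lambda>g. act g (v x))))"

lemma adjoinI: "z \<in> W \<Longrightarrow> z + (act f x + act g (v x)) \<in> adjoin W x"
  unfolding adjoin_def by (intro set_sumI) auto

lemma adjoinE:
  assumes "y \<in> adjoin W x"
  obtains z f g where "y = z + (act f x + act g (v x))" "z \<in> W"
proof -
  from assms obtain z y' where 1: "y = z + y'" "z \<in> W"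
    "y' \<in> set_sum (range (\<lambda>f. act f x)) (range (\<lambda>g. act g (v x)))"
    unfolding adjoin_def by (rule set_sumE)
  from 1(3) obtain y1 y2 where 2: "y' = y1 + y2" "y1 \<in> range (\<lambda>f. act f x)" "y2 \<in> range (\<lambda>g. act g (v x))"
    by (rule set_sumE)
  from 2(2) obtain f where "y1 = act f x" by (rule rangeE)
  moreover from 2(3) obtain g where "y2 = act g (v x)" by (rule rangeE)
  ultimately show ?thesis using that[of z f g] 1 2 by simp
qed

lemma stable_adjoin:
  assumes "stable W"
  shows "stable (adjoin W x)"
  unfolding stable_def
proof (intro conjI ballI)
  show "pm.subspace (adjoin W x)" unfolding adjoin_def
    using assms by (intro pm_subspace_set_sum pm_subspace_cyclic) (simp add: stable_def)
  fix y assume "y \<in> adjoin W x"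
  then obtain z f g where y: "y = z + (act f x + act g (v x))" "z \<in> W" by (rule adjoinE)
  have vv: "act g (v (v x)) = act ([:\<tau>:] * g) (v x) + act ([:a:] * g) x"
    unfolding v_v act_add_right act_scale act_mult act_const ..
  have "v y = v z + (act (der f + [:a:] * g) x + act (f + [:\<tau>:] * g + der g) (v x))"
    unfolding y(1) v_add v_act vv act_add_left by (simp only: add_ac)
  moreover have "v z \<in> W" using assms y(2) by (simp add: stable_def)
  ultimately show "v y \<in> adjoin W x" using adjoinI by simp
qed

lemma adjoin_superset: "W \<subseteq> adjoin W x"
proof
  fix z assume "z \<in> W"
  from adjoinI[OF this, of 0 x 0] show "z \<in> adjoin W x" by simp
qed

lemma adjoin_mem:
  assumes "stable W"
  shows "x \<in> adjoin W x"
proof -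
  have "0 \<in> W" using assms pm.subspace_0 by (simp add: stable_def)
  from adjoinI[OF this, of 1 x 0] show ?thesis by simp
qed

lemma adjoin_subset:
  assumes "stable V" "W \<subseteq> V" "x \<in> V"
  shows "adjoin W x \<subseteq> V"
proof
  fix y assume "y \<in> adjoin W x"
  then obtain z f g where y: "y = z + (act f x + act g (v x))" "z \<in> W" by (rule adjoinE)
  have V: "pm.subspace V" "v x \<in> V" using assms by (auto simp: stable_def)
  show "y \<in> V" unfolding y(1)
    using assms y(2) V by (intro pm.subspace_add[OF V(1)] pm.subspace_scale[OF V(1)]) auto
qed

text \<open>
  Modulo \<open>W\<close> the elements \<open>f(u) + g(u) v\<close> act through the field generated by \<open>u\<close> and \<open>v\<close>: multiplying by the
  conjugate \<open>f(u) + g(u) (v + \<tau>)\<close> turns them into values of the anisotropic form.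
\<close>

lemma adjoin_independent:
  assumes W: "stable W" and V: "stable V" "W \<subseteq> V" "\<And>y. y \<in> V \<Longrightarrow> act r y \<in> W"
    and x: "x \<in> V" "x \<notin> W" and mem: "act f x + act g (v x) \<in> W"
  shows "r dvd f \<and> r dvd g"
proof -
  note pmW = conjunct1[OF W[unfolded stable_def]]
  have vW: "v y \<in> W" if "y \<in> W" for y using W that by (simp add: stable_def)
  have vx: "v x \<in> V" using V(1) x(1) by (simp add: stable_def)
  \<comment> \<open>Values of \<open>der\<close> are multiples of \<open>r\<close>, so every
    correction from moving \<open>v\<close> past a polynomial lands in \<open>W\<close>.\<close>
  have rW: "act (der h) y \<in> W" if "y \<in> V" for h y
    unfolding der_def mult.commute[of r] act_mult by (rule pm.subspace_scale[OF pmW V(3)[OF that]])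
  define y where "y = act f x + act g (v x)"
  define N where "N = f ^ 2 + [:\<tau>:] * f * g + [:a:] * g ^ 2"
  have "act f y + act ([:\<tau>:] * g) y + v (act g y)
      = act N x + (act (der (f * g)) x + act (der (g * g)) (v x))"
  proof -
    have 1: "act f y = act (f * f) x + act (f * g) (v x)"
      by (simp only: y_def act_add_right act_mult)
    have 2: "act ([:\<tau>:] * g) y = act ([:\<tau>:] * f * g) x + act ([:\<tau>:] * g * g) (v x)"
      by (simp only: y_def act_add_right act_mult[symmetric] mult_ac)
    have "act g y = act (f * g) x + act (g * g) (v x)"
      by (simp only: y_def act_add_right act_mult[symmetric] mult_ac)
    then have "v (act g y) = act (f * g) (v x) + act (der (f * g)) x
        + (act (g * g) (v (v x)) + act (der (g * g)) (v x))"
      by (simp only: v_add v_act)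
    moreover have "act (g * g) (v (v x)) = act ([:\<tau>:] * g * g) (v x) + act ([:a:] * (g * g)) x"
      unfolding v_v act_add_right act_scale by (simp only: act_mult act_const mult.assoc)
    ultimately have 3: "v (act g y) = act (f * g) (v x) + act (der (f * g)) x
        + (act ([:\<tau>:] * g * g) (v x) + act ([:a:] * (g * g)) x + act (der (g * g)) (v x))" by simp
    have N: "act N x = act (f * f) x + act ([:\<tau>:] * f * g) x + act ([:a:] * (g * g)) x"
      unfolding N_def power2_eq_square act_add_left ..
    have *: "A + B + (C + D) + (B + E + (D + F + G)) = A + C + F + (E + G)" for A B C D E F G :: 'v
    proof -
      have "A + B + (C + D) + (B + E + (D + F + G)) = A + C + F + (E + G) + (B + B) + (D + D)"
        by (simp only: add_ac)
      then show ?thesis by simp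
    qed
    show ?thesis unfolding 1 2 3 N by (rule *)
  qed
  moreover have "act f y + act ([:\<tau>:] * g) y + v (act g y) \<in> W"
    using mem unfolding y_def[symmetric]
    by (intro pm.subspace_add[OF pmW] pm.subspace_scale[OF pmW] vW)
  ultimately have NW: "act N x + (act (der (f * g)) x + act (der (g * g)) (v x)) \<in> W" by simp
  have "act (der (f * g)) x + act (der (g * g)) (v x) \<in> W"
    by (intro pm.subspace_add[OF pmW] rW x vx)
  from pm.subspace_diff[OF pmW NW this] have N: "act N x \<in> W" by simp
  have "r dvd N"
  proof (rule ccontr)
    assume "\<not> r dvd N"
    then obtain h s where "h * N + s * r = 1" using r_coprime by blast
    then have "x = act (h * N + s * r) x" by simp
    also have "\<dots> = act h (act N x) + act s (act r x)" by (simp only: act_add_left act_mult)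
    also have "\<dots> \<in> W"
      by (rule pm.subspace_add[OF pmW pm.subspace_scale[OF pmW N] pm.subspace_scale[OF pmW V(3)[OF x(1)]]])
    finally show False using x(2) by simp
  qed
  then show ?thesis unfolding N_def by (rule norm_form_anisotropic)
qed

text \<open>Modulo \<open>W\<close> the vectors \<open>x\<close>, \<open>u x\<close>,
  \<open>v x\<close>, \<open>u (v x)\<close> are a basis of the line through \<open>x\<close> over a
  field of degree 4.\<close>

lemma dim_adjoin:
  assumes W: "stable W" and V: "stable V" "W \<subseteq> V" "\<And>y. y \<in> V \<Longrightarrow> act r y \<in> W"
    and x: "x \<in> V" "x \<notin> W"
  shows "dim (adjoin W x) = dim W + 4"
proof -
  note pmW = conjunct1[OF W[unfolded stable_def]]
  note sW = pm_subspace_imp[OF pmW]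
  have spW: "span W = W" using sW by (simp add: span_eq_iff)
  have vx: "v x \<in> V" using V(1) x(1) by (simp add: stable_def)
  have zero: "k = 0 \<and> l = 0 \<and> m = 0 \<and> n = 0"
    if "k *s x + l *s u x + m *s v x + n *s u (v x) \<in> W" for k l m n
  proof -
    have "act [:k, l:] x + act [:m, n:] (v x) \<in> W"
      using that by (simp add: u_scale add_ac)
    then have "r dvd [:k, l:] \<and> r dvd [:m, n:]" using adjoin_independent[OF W V x] by blast
    then show ?thesis using r_dvd_linear[of k l] r_dvd_linear[of m n] by simp
  qed
  have n1: "x \<notin> span W" unfolding spW by (rule x(2))
  have n2: "u x \<notin> span (insert x W)"
  proof
    assume "u x \<in> span (insert x W)"
    then obtain k where "u x - k *s x \<in> W" unfolding span_breakdown_eq spW by blast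
    then have "k *s x + 1 *s u x + 0 *s v x + 0 *s u (v x) \<in> W" unfolding v_diff_add by (simp add: add_ac)
    from zero[OF this] show False by simp
  qed
  have n3: "v x \<notin> span (insert (u x) (insert x W))"
  proof
    assume "v x \<in> span (insert (u x) (insert x W))"
    then obtain l k where "v x - l *s u x - k *s x \<in> W" unfolding span_breakdown_eq spW by blast
    then have "k *s x + l *s u x + 1 *s v x + 0 *s u (v x) \<in> W" unfolding v_diff_add by (simp add: add_ac)
    from zero[OF this] show False by simp
  qed
  have n4: "u (v x) \<notin> span (insert (v x) (insert (u x) (insert x W)))"
  proof
    assume "u (v x) \<in> span (insert (v x) (insert (u x) (insert x W)))"
    then obtain m l k where "u (v x) - m *s v x - l *s u x - k *s x \<in> W" unfolding span_breakdown_eq spW by blast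
    then have "k *s x + l *s u x + m *s v x + 1 *s u (v x) \<in> W" unfolding v_diff_add by (simp add: add_ac)
    from zero[OF this] show False by simp
  qed
  let ?S = "insert (u (v x)) (insert (v x) (insert (u x) (insert x W)))"
  note st = stable_adjoin[OF W, of x]
  have A: "pm.subspace (adjoin W x)" using st by (simp add: stable_def)
  have xA: "x \<in> adjoin W x" "v x \<in> adjoin W x" using adjoin_mem[OF W] st by (auto simp: stable_def)
  have "span ?S = adjoin W x"
  proof (intro equalityI span_minimal pm_subspace_imp[OF A])
    show "?S \<subseteq> adjoin W x" using xA adjoin_superset pm_subspace_u[OF A] by auto
    have lin: "act f y \<in> span ?S" if "y \<in> V" "y \<in> ?S" "u y \<in> ?S" for f y
    proof -
      obtain k l where kl: "f mod r = [:k, l:]" by (rule mod_r)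
      have "f = (f div r) * r + [:k, l:]" unfolding kl[symmetric] by (rule div_mult_mod_eq[symmetric])
      then have "act f y = act ((f div r) * r + [:k, l:]) y" by simp
      also have "\<dots> = act (f div r) (act r y) + (k *s y + l *s u y)"
        unfolding act_add_left act_mult by (simp add: u_scale)
      also have "\<dots> \<in> span ?S"
        using pm.subspace_scale[OF pmW V(3)[OF that(1)]] that(2,3)
        by (intro span_add span_scale) (auto intro: span_base)
      finally show ?thesis .
    qed
    show "adjoin W x \<subseteq> span ?S"
    proof
      fix y assume "y \<in> adjoin W x"
      then obtain z f g where y: "y = z + (act f x + act g (v x))" "z \<in> W" by (rule adjoinE)
      show "y \<in> span ?S" unfolding y(1)
        using y(2) by (intro span_add lin x vx) (auto intro: span_base)
    qed
  qed
  then have "dim (adjoin W x) = dim ?S" using dim_span[of ?S] by simp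
  also have "\<dots> = dim W + 4" using n1 n2 n3 n4 by (simp add: dim_insert)
  finally show ?thesis .
qed

text \<open>Lines over that field are adjoined until \<open>V\<close> is exhausted; the condition
  that \<open>r(u)\<close> maps \<open>V\<close> into \<open>W\<close> persists as \<open>W\<close>
  grows.\<close>

lemma four_dvd_dim_diff:
  assumes "stable W" "stable V" "W \<subseteq> V" "\<And>y. y \<in> V \<Longrightarrow> act r y \<in> W"
  shows "4 dvd dim V - dim W"
  using assms(1,3,4)
proof (induction "dim V - dim W" arbitrary: W rule: less_induct)
  case less
  show ?case
  proof (cases "W = V")
    case False
    then obtain x where x: "x \<in> V" "x \<notin> W" using less.prems(2) by blast
    let ?A = "adjoin W x"
    have d: "dim ?A = dim W + 4" by (rule dim_adjoin[OF less.prems(1) assms(2) less.prems(2,3) x])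
    have sub: "?A \<subseteq> V" by (rule adjoin_subset[OF assms(2) less.prems(2) x(1)])
    have le: "dim ?A \<le> dim V" by (rule dim_subset[OF sub])
    have "4 dvd dim V - dim ?A"
    proof (rule less.hyps)
      show "dim V - dim ?A < dim V - dim W" using d le by linarith
      show "act r y \<in> ?A" if "y \<in> V" for y using less.prems(3)[OF that] adjoin_superset by blast
    qed (use stable_adjoin[OF less.prems(1)] sub in auto)
    moreover have "dim V - dim W = (dim V - dim ?A) + 4" using d le by linarith
    ultimately show ?thesis by simp
  qed simp
qed

end

section \<open>The radical of \<open>b\<close> on a slice\<close>

context symplectic_endo
begin

text \<open>Since polynomials in \<open>u\<close> are self-adjoint, the image of one and its kernel
  are the full orthogonals of each other. So the slice, an image intersected with a kernel, is the
  orthogonal of \<open>Q\<close>, the sum of the kernel of \<open>r(u)\<^sup>m\<close> and the image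
  of \<open>r(u)\<^sup>m\<^sup>+\<^sup>1\<close>; nondegeneracy returns \<open>Q\<close> as the
  orthogonal of the slice.\<close>

lemma subslice_eq_radical:
  "subslice m m UNIV = perp_in (slice m m UNIV) (slice m m UNIV)"
proof -
  define Sl where "Sl = slice m m UNIV"
  define Q where "Q = {z. \<exists>y. act (r ^ m) (z - act (r ^ Suc m) y) = 0}"
  have Q: "subspace Q"
    unfolding subspace_def Q_def mem_Collect_eq
  proof (intro conjI ballI allI)
    show "\<exists>y. act (r ^ m) (0 - act (r ^ Suc m) y) = 0" by (rule exI[of _ 0]) simp
  next
    fix x y assume "x \<in> {z. \<exists>y. act (r ^ m) (z - act (r ^ Suc m) y) = 0}"
      "y \<in> {z. \<exists>y. act (r ^ m) (z - act (r ^ Suc m) y) = 0}"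
    then obtain x' y' where *: "act (r ^ m) (x - act (r ^ Suc m) x') = 0"
      "act (r ^ m) (y - act (r ^ Suc m) y') = 0" by auto
    have "act (r ^ m) (x + y - act (r ^ Suc m) (x' + y'))
        = act (r ^ m) (x - act (r ^ Suc m) x') + act (r ^ m) (y - act (r ^ Suc m) y')"
      by (simp only: act_add_right[symmetric] add_diff_add[symmetric])
    also have "\<dots> = 0" unfolding * by simp
    finally show "\<exists>z. act (r ^ m) (x + y - act (r ^ Suc m) z) = 0" by blast
  next
    fix k x assume "x \<in> {z. \<exists>y. act (r ^ m) (z - act (r ^ Suc m) y) = 0}"
    then obtain x' where *: "act (r ^ m) (x - act (r ^ Suc m) x') = 0" by auto
    have "act (r ^ m) (k *s x - act (r ^ Suc m) (k *s x')) = k *s act (r ^ m) (x - act (r ^ Suc m) x')"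
      by (simp only: act_scale scale_right_diff_distrib[symmetric])
    also have "\<dots> = 0" unfolding * by simp
    finally show "\<exists>z. act (r ^ m) (k *s x - act (r ^ Suc m) z) = 0" by blast
  qed
  define K where "K = {z. act (r ^ m) z = 0}"
  define R where "R = range (act (r ^ m))"
  have R: "subspace R"
    unfolding subspace_def R_def by (auto simp flip: act_add_right act_scale intro: rev_image_eqI[of 0])
  have right0: "z = 0" if "\<And>y. b y z = 0" for z
    using that b_nondegenerate[of z] b_sym[of z] by simp
  have "perp_in UNIV R = K"
  proof (intro equalityI subsetI)
    fix z assume "z \<in> perp_in UNIV R"
    then have "b (act (r ^ m) y) z = 0" for y by (simp add: perp_in_def R_def)
    then have "act (r ^ m) z = 0" unfolding b_act by (rule right0)
    then show "z \<in> K" by (simp add: K_def)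
  next
    fix z assume "z \<in> K"
    then have "b (act (r ^ m) y) z = 0" for y unfolding b_act K_def by simp
    then show "z \<in> perp_in UNIV R" by (auto simp: perp_in_def R_def)
  qed
  then have perpK: "perp_in UNIV K = R"
    using perp_in_perp_in[OF subspace_UNIV R perp_UNIV] by simp
  have XQ: "Sl = perp_in UNIV Q"
  proof (intro equalityI subsetI)
    fix x assume "x \<in> Sl"
    then obtain y0 where x: "x = act (r ^ m) y0" "act (r ^ Suc m) x = 0" unfolding Sl_def slice_def by blast
    have "b z x = 0" if zQ: "z \<in> Q" for z
    proof -
      obtain y where y: "act (r ^ m) (z - act (r ^ Suc m) y) = 0" using zQ unfolding Q_def by blast
      have "b z x = b (z - act (r ^ Suc m) y) x + b (act (r ^ Suc m) y) x"
        unfolding b_add_left[symmetric] by simp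
      also have "b (act (r ^ Suc m) y) x = 0" unfolding b_act x(2) by simp
      also have "b (z - act (r ^ Suc m) y) x = 0" unfolding x(1) b_act[symmetric] y by simp
      finally show ?thesis by simp
    qed
    then show "x \<in> perp_in UNIV Q" by (simp add: perp_in_def)
  next
    fix x assume x: "x \<in> perp_in UNIV Q"
    have "b (act (r ^ Suc m) y) x = 0" for y
    proof -
      have "act (r ^ Suc m) y \<in> Q" unfolding Q_def by (auto intro!: exI[of _ y])
      then show ?thesis using x by (simp add: perp_in_def)
    qed
    then have 1: "act (r ^ Suc m) x = 0" unfolding b_act by (rule right0)
    have "K \<subseteq> Q" unfolding K_def Q_def by (auto intro!: exI[of _ 0])
    then have "x \<in> perp_in UNIV K" using x by (auto simp: perp_in_def)
    then have "x \<in> R" unfolding perpK .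
    then show "x \<in> Sl" using 1 unfolding Sl_def slice_def R_def by blast
  qed
  then have "perp_in UNIV Sl = Q"
    using perp_in_perp_in[OF subspace_UNIV Q perp_UNIV] by simp
  moreover have "perp_in Sl Sl = Sl \<inter> perp_in UNIV Sl" by (auto simp: perp_in_def)
  moreover have "subslice m m UNIV = Sl \<inter> Q" unfolding subslice_def Sl_def Q_def by blast
  ultimately show ?thesis unfolding Sl_def[symmetric] by simp
qed

end

locale symplectic_splitting = symplectic_endo scale Basis u a c \<tau> b + splitting scale Basis u a c \<tau> v
  for scale :: "'a::field \<Rightarrow> 'v::ab_group_add \<Rightarrow> 'v" (infixr "*s" 75)
    and Basis :: "'v set" and u :: "'v \<Rightarrow> 'v" and a c \<tau> :: 'a and b :: "'v \<Rightarrow> 'v \<Rightarrow> 'a"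
    and v :: "'v \<Rightarrow> 'v" +
  assumes b_v_self [simp]: "b x (v x) = 0"
begin

lemma b_v: "b (v x) y = b x (v y)"
  by (rule alternating_adjoint) (simp_all add: v_add)

text \<open>
  The form \<open>b\<close> on \<open>S / S\<^sup>\<bottom>\<close> takes values through the field generated by \<open>u\<close> and \<open>v\<close>; it is alternating over
  that field because \<open>u v\<close> is recovered from its square.
\<close>

lemma b_uv_self:
  assumes x: "x \<in> slice m m UNIV"
  shows "b x (u (v x)) = 0"
proof -
  let ?Sl = "slice m m UNIV"
  have Sl: "stable ?Sl" by (rule stable_slice)
  have vx: "v x \<in> ?Sl" using Sl x by (simp add: stable_def)
  have "act r (v x) \<in> perp_in ?Sl ?Sl"
    using act_r_slice[OF vx] unfolding subslice_eq_radical .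
  then have br: "b x (act r (v x)) = 0" using x by (simp add: perp_in_def)
  \<comment> \<open>The polynomial \<open>t\<^sup>2\<close> has derivative zero, so
    \<open>u\<^sup>2\<close> commutes with \<open>v\<close>. Moving everything in
    \<open>b (u (v x)) (u (v x)) = 0\<close> to the right argument, then reducing
    \<open>v\<^sup>2\<close> by its equation and \<open>u\<^sup>2\<close> modulo \<open>r\<close>,
    leaves \<open>\<tau>\<^sup>2\<close> times the wanted value.\<close>
  let ?s = "[:0, 0, 1:] :: 'a poly"
  have der_s: "der ?s = 0" by (simp add: der_def pderiv_pCons two)
  have s: "?s = r + [:a + c, \<tau>:]" by (simp add: r_def two)
  have act_s: "act ?s y = u (u y)" for y by simp
  have "0 = b (u (v x)) (u (v x))" by simp
  also have "\<dots> = b (v x) (act ?s (v x))" by (simp only: b_u act_s)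
  also have "\<dots> = b x (v (act ?s (v x)))" by (rule b_v)
  also have "v (act ?s (v x)) = act ?s (v (v x))" unfolding v_act der_s by simp
  also have "\<dots> = \<tau> *s act ?s (v x) + a *s act ?s x" unfolding v_v by (simp only: act_add_right act_scale)
  also have "b x \<dots> = \<tau> * b x (act ?s (v x))"
    by (simp only: b_add_right b_scale_right b_act_self mult_zero_right add_0_right)
  also have "b x (act ?s (v x)) = \<tau> * b x (u (v x))"
    unfolding s act_add_left b_add_right br by (simp add: b_add_right b_scale_right u_scale)
  finally show ?thesis using tau_nz by simp
qed

lemma b_act_v_self:
  assumes x: "x \<in> slice m m UNIV"
  shows "b x (act h (v x)) = 0"
proof -
  have vx: "v x \<in> slice m m UNIV" using stable_slice x by (simp add: stable_def)
  obtain k l where kl: "h mod r = [:k, l:]" by (rule mod_r)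
  have "h = (h div r) * r + [:k, l:]" unfolding kl[symmetric] by (rule div_mult_mod_eq[symmetric])
  then have "act h (v x) = act ((h div r) * r + [:k, l:]) (v x)" by simp
  then have h: "act h (v x) = act (h div r) (act r (v x)) + (k *s v x + l *s u (v x))"
    unfolding act_add_left act_mult by (simp add: u_scale)
  have "pm.subspace (subslice m m UNIV)" by (rule pm_subspace_subslice) simp
  from pm.subspace_scale[OF this act_r_slice[OF vx]]
  have "act (h div r) (act r (v x)) \<in> perp_in (slice m m UNIV) (slice m m UNIV)"
    unfolding subslice_eq_radical .
  then have "b x (act (h div r) (act r (v x))) = 0" using x by (simp add: perp_in_def)
  then show ?thesis unfolding h by (simp add: b_add_right b_scale_right b_uv_self[OF x] del: pm.scale_scale)
qed

lemma eight_dvd_dim_diff: "8 dvd dim (slice m m UNIV) - dim (subslice m m UNIV)"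
proof -
  define Sl where "Sl = slice m m UNIV"
  define R where "R = subslice m m UNIV"
  have RX: "R = perp_in Sl Sl" unfolding R_def Sl_def by (rule subslice_eq_radical)
  have Sl: "stable Sl" and R: "stable R" unfolding Sl_def R_def by (rule stable_slice stable_subslice)+
  have rX: "act r y \<in> R" if "y \<in> Sl" for y using that unfolding Sl_def R_def by (rule act_r_slice)
  have sub: "R \<subseteq> Sl" unfolding R_def Sl_def subslice_def by blast
  define P where "P = (\<lambda>W. stable W \<and> R \<subseteq> W \<and> W \<subseteq> Sl \<and> (\<forall>x\<in>W. \<forall>y\<in>W. b x y = 0))"
  have "b x y = 0" if "x \<in> R" "y \<in> R" for x y
  proof -
    have "x \<in> Sl" using that(1) sub by blast
    then show ?thesis using that(2) unfolding RX perp_in_def by blast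
  qed
  then have PR: "P R" using R sub unfolding P_def by blast
  have "\<exists>W. P W \<and> (\<forall>W'. P W' \<longrightarrow> dim W' \<le> dim W)"
    by (rule ex_has_greatest_nat[of P R dim "Suc dimension"])
      (simp_all add: PR dim_subset_UNIV less_Suc_eq_le)
  then obtain W where W: "P W" and max: "\<And>W'. P W' \<Longrightarrow> dim W' \<le> dim W" by auto
  have sW: "stable W" "R \<subseteq> W" "W \<subseteq> Sl" and iso: "\<And>x y. x \<in> W \<Longrightarrow> y \<in> W \<Longrightarrow> b x y = 0"
    using W unfolding P_def by blast+
  have pmW: "pm.subspace W" using sW(1) by (simp add: stable_def)
  have vW: "v z \<in> W" if "z \<in> W" for z using sW(1) that by (simp add: stable_def)
  have "perp_in Sl W = W"
  proof (rule ccontr)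
    assume "perp_in Sl W \<noteq> W"
    moreover have "W \<subseteq> perp_in Sl W"
    proof
      fix y assume y: "y \<in> W"
      then have "\<forall>x\<in>W. b x y = 0" using iso by simp
      then show "y \<in> perp_in Sl W" using y sW(3) unfolding perp_in_def by blast
    qed
    ultimately obtain x where "x \<in> perp_in Sl W" "x \<notin> W" by blast
    then have x: "x \<in> Sl" "x \<notin> W" and xW: "\<And>z. z \<in> W \<Longrightarrow> b z x = 0"
      unfolding perp_in_def by blast+
    have zx: "b z (act f x) = 0" if "z \<in> W" for z f
      unfolding b_act[symmetric] by (rule xW[OF pm.subspace_scale[OF pmW that]])
    have zv: "b z (act f (v x)) = 0" if "z \<in> W" for z f
      unfolding b_act[symmetric] b_v[symmetric] by (rule xW[OF vW[OF pm.subspace_scale[OF pmW that]]])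
    have xv: "b (act f x) (act g (v x)) = 0" for f g
      unfolding b_act act_mult[symmetric] using x(1) unfolding Sl_def by (rule b_act_v_self)
    have xx: "b (act f y) (act g y) = 0" for f g y
      unfolding b_act act_mult[symmetric] by (rule b_act_self)
    \<comment> \<open>\<open>W\<close> is stable and orthogonal to \<open>x\<close>, hence to
      \<open>v x\<close> and to all polynomial multiples of both; these multiples pair to zero among
      themselves by \<open>b_act_self\<close> and \<open>b_act_v_self\<close>. A larger isotropic
      space contradicts the choice of \<open>W\<close>.\<close>
    have "P (adjoin W x)" unfolding P_def
    proof (intro conjI ballI)
      show "stable (adjoin W x)" by (rule stable_adjoin[OF sW(1)])
      show "R \<subseteq> adjoin W x" using sW(2) adjoin_superset by blast
      show "adjoin W x \<subseteq> Sl" by (rule adjoin_subset[OF Sl sW(3) x(1)])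
      fix y y' assume "y \<in> adjoin W x" "y' \<in> adjoin W x"
      then obtain z f g z' f' g' where y: "y = z + (act f x + act g (v x))" "z \<in> W"
        and y': "y' = z' + (act f' x + act g' (v x))" "z' \<in> W" by (elim adjoinE) blast
      show "b y y' = 0"
        unfolding y(1) y'(1) b_add_left b_add_right
        using zx[OF y(2)] zv[OF y(2)] zx[OF y'(2)] zv[OF y'(2)] xx xv iso[OF y(2) y'(2)]
        by (simp add: b_sym[of "act f x" z'] b_sym[of "act g (v x)" z'] b_sym[of "act g (v x)" "act f' x"])
    qed
    then have "dim (adjoin W x) \<le> dim W" by (rule max)
    moreover have "dim (adjoin W x) = dim W + 4"
      using rX sW(2) by (intro dim_adjoin[OF sW(1) Sl sW(3) _ x]) blast
    ultimately show False by simp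
  qed
  moreover have "subspace Sl" using Sl by (intro pm_subspace_imp) (simp add: stable_def)
  ultimately have "dim W + dim W = dim Sl + dim R"
    using dim_plus_perp[of Sl W] sW(2,3) pm_subspace_imp[OF pmW] unfolding RX by simp
  moreover have "4 dvd dim W - dim R"
    using four_dvd_dim_diff[OF R sW(1,2)] rX sW(3) by blast
  moreover have "dim R \<le> dim W" by (rule dim_subset[OF sW(2)])
  ultimately have "dim Sl - dim R = 2 * (dim W - dim R)" "4 dvd dim W - dim R" by linarith+
  then show ?thesis unfolding Sl_def[symmetric] R_def[symmetric] by auto
qed

end

section \<open>Orthogonal sums of planes\<close>

context char2_quadratics
begin

text \<open>The greatest common divisor of \<open>f\<close> and
  \<open>r\<^sup>k\<^sup>+\<^sup>1\<close> divides \<open>r\<^sup>k\<close>. Hence a vector killed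
  by \<open>r\<^sup>k\<^sup>+\<^sup>1\<close> but not by \<open>r\<^sup>k\<close> is killed only by
  multiples of \<open>r\<^sup>k\<^sup>+\<^sup>1\<close>.\<close>

lemma r_power_bezout:
  assumes "\<not> r ^ Suc k dvd f"
  shows "\<exists>h s. h * f + s * r ^ Suc k = r ^ k"
  using assms
proof (induction k arbitrary: f)
  case 0
  then show ?case using r_coprime[of f] by simp
next
  case (Suc k)
  show ?case
  proof (cases "r dvd f")
    case True
    then obtain g where f: "f = r * g" by (elim dvdE)
    have "\<not> r ^ Suc k dvd g" using Suc.prems unfolding f power_Suc[of r "Suc k"] by simp
    from Suc.IH[OF this] obtain h s where "h * g + s * r ^ Suc k = r ^ k" by blast
    then have "r * (h * g + s * r ^ Suc k) = r ^ Suc k" unfolding power_Suc[of r k] by (rule arg_cong)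
    moreover have "r * (h * g + s * r ^ Suc k) = h * f + s * r ^ Suc (Suc k)"
      unfolding f by (simp add: algebra_simps)
    ultimately have "h * f + s * r ^ Suc (Suc k) = r ^ Suc k" by simp
    then show ?thesis by blast
  next
    case False
    then have "\<not> r ^ Suc k dvd f" using dvd_mult_left[of r "r ^ k" f] unfolding power_Suc by blast
    from Suc.IH[OF this] obtain h s where "h * f + s * r ^ Suc k = r ^ k" by blast
    then have "r * (h * f + s * r ^ Suc k) = r ^ Suc k" unfolding power_Suc[of r k] by (rule arg_cong)
    moreover have "r * (h * f + s * r ^ Suc k) = (r * h) * f + s * r ^ Suc (Suc k)"
      by (simp add: algebra_simps)
    ultimately have "(r * h) * f + s * r ^ Suc (Suc k) = r ^ Suc k" by simp
    then show ?thesis by blast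
  qed
qed

text \<open>A power of \<open>r\<close> is determined by its degree, and divisibility orders powers
  by degree, so this is the uniqueness of a sorted list with a given multiset.\<close>

lemma r_powers_list_eq:
  assumes "\<forall>s\<in>set rs. \<exists>k. s = r ^ k" "\<forall>s\<in>set rs'. \<exists>k. s = r ^ k"
    and "sorted_wrt (\<lambda>f g. g dvd f) rs" "sorted_wrt (\<lambda>f g. g dvd f) rs'"
    and "mset rs = mset rs'"
  shows "rs = rs'"
proof -
  have pow: "map (\<lambda>d. r ^ (d div 2)) (map Polynomial.degree ss) = ss" if "\<forall>s\<in>set ss. \<exists>k. s = r ^ k" for ss
    using that by (induction ss) (auto simp: degree_r_power)
  have deg: "sorted (rev (map Polynomial.degree ss))"
    if "\<forall>s\<in>set ss. \<exists>k. s = r ^ k" "sorted_wrt (\<lambda>f g. g dvd f) ss" for ss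
  proof -
    have "sorted_wrt (\<lambda>f g. Polynomial.degree g \<le> Polynomial.degree f) ss"
    proof (rule sorted_wrt_mono_rel[OF _ that(2)])
      fix f g assume "f \<in> set ss" "g dvd f"
      then show "Polynomial.degree g \<le> Polynomial.degree f"
        using that(1) by (auto intro!: dvd_imp_degree_le)
    qed
    then show ?thesis by (simp add: sorted_wrt_rev sorted_wrt_map)
  qed
  have "mset (rev (map Polynomial.degree rs)) = mset (rev (map Polynomial.degree rs'))"
    using assms(5) by simp
  then have "sort (rev (map Polynomial.degree rs')) = rev (map Polynomial.degree rs)"
    using deg[OF assms(1,3)] by (rule properties_for_sort)
  then have "rev (map Polynomial.degree rs') = rev (map Polynomial.degree rs)"
    using sort_key_id_if_sorted[of "\<lambda>x. x" "rev (map Polynomial.degree rs')"] deg[OF assms(2,4)] by simp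
  then have "map Polynomial.degree rs = map Polynomial.degree rs'" by simp
  then have "map (\<lambda>d. r ^ (d div 2)) (map Polynomial.degree rs) = map (\<lambda>d. r ^ (d div 2)) (map Polynomial.degree rs')"
    by (rule arg_cong)
  then show ?thesis unfolding pow[OF assms(1)] pow[OF assms(2)] .
qed

end

section \<open>Uniqueness of the invariant factors in the \<open>r\<close>-primary case\<close>

context r_endo
begin

lemma act_dvd_zero:
  assumes "act s x = 0" "s dvd f"
  shows "act f x = 0"
proof -
  from assms(2) obtain g where "f = s * g" by (elim dvdE)
  then have "act f x = act g (act s x)" unfolding act_mult[symmetric] by (simp only: mult.commute)
  then show ?thesis using assms(1) by simp
qed

lemma nilpotent_cyclic_sum_powers:
  assumes "\<And>x. act (r ^ N) x = 0" "cyclic_sum W rs"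
  shows "\<forall>s\<in>set rs. \<exists>k. s = r ^ k"
proof
  fix s assume s: "s \<in> set rs"
  have "s dvd r ^ N" by (rule cyclic_sum_dvd[OF assms(2) _ s]) (rule assms(1))
  then show "\<exists>k. s = r ^ k" using monic_dvd_r_power cyclic_sum_monic[OF assms(2) s] by blast
qed

lemma count_cyclic_sum:
  assumes "\<And>x. act (r ^ N) x = 0" "cyclic_sum UNIV rs"
  shows "2 * count_list rs (r ^ (i + j + 1)) = dim (slice i j UNIV) - dim (subslice i j UNIV)"
  using slice_dim[OF assms(2), of i j] nilpotent_cyclic_sum_powers[OF assms] by simp

text \<open>This evaluates the definite description in \<open>invariant_factors\<close>. Any two
  candidates have the same multiplicities by \<open>count_cyclic_sum\<close>, and divisibility
  forces their order.\<close>

lemma invariant_factors_eq: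
  assumes nil: "\<And>x. act (r ^ N) x = 0" and rs: "is_invariant_factors scale u rs"
  shows "invariant_factors scale u = rs"
  unfolding invariant_factors_def
proof (rule the_equality)
  show "is_invariant_factors scale u rs" by (rule rs)
  fix rs' assume rs': "is_invariant_factors scale u rs'"
  have cs: "cyclic_sum UNIV rs" "cyclic_sum UNIV rs'"
    and so: "sorted_wrt (\<lambda>f g. g dvd f) rs" "sorted_wrt (\<lambda>f g. g dvd f) rs'"
    using rs rs' unfolding is_invariant_factors_iff by blast+
  note pw = nilpotent_cyclic_sum_powers[OF nil cs(1)] nilpotent_cyclic_sum_powers[OF nil cs(2)]
  have cnt: "count_list rs' s = count_list rs s" for s
  proof (cases "\<exists>k. s = r ^ Suc k")
    case True
    then obtain k where s: "s = r ^ (0 + k + 1)" by auto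
    show ?thesis unfolding s
      using count_cyclic_sum[OF nil cs(1), of 0 k] count_cyclic_sum[OF nil cs(2), of 0 k] by linarith
  next
    case False
    have "s \<notin> set ss" if ss: "cyclic_sum UNIV ss" "\<forall>s\<in>set ss. \<exists>k. s = r ^ k" for ss
    proof
      assume s: "s \<in> set ss"
      then obtain k where k: "s = r ^ k" using ss(2) by blast
      have "Polynomial.degree s > 0" using cyclic_sum_monic[OF ss(1) s] by simp
      then have "k \<noteq> 0" unfolding k by (auto simp: degree_r_power)
      then obtain k' where "k = Suc k'" by (cases k) auto
      then show False using False k by blast
    qed
    then show ?thesis using cs pw by simp
  qed
  have "mset rs' = mset rs" by (rule multiset_eqI) (simp add: count_mset cnt)
  then show "rs' = rs" by (intro r_powers_list_eq pw so)
qed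

end

section \<open>Planes and the orthogonal decomposition into planes\<close>

context symplectic_endo
begin

text \<open>Only the pairing between the two cyclic modules is prescribed; within each of them
  \<open>b\<close> vanishes by \<open>b_act_self\<close>, so this fixes \<open>b\<close> on the
  whole plane.\<close>

definition plane :: "nat \<Rightarrow> 'v \<Rightarrow> 'v \<Rightarrow> bool"
  where "plane k x y \<longleftrightarrow> act (r ^ k) x = 0 \<and> act (r ^ k) y = 0 \<and> (\<forall>f. b (act f x) y = top_coeff k f)"

definition plane_span :: "'v \<Rightarrow> 'v \<Rightarrow> 'v set"
  where "plane_span x y = set_sum (range (\<lambda>f. act f x)) (range (\<lambda>g. act g y))"

lemma pm_subspace_plane_span: "pm.subspace (plane_span x y)"
  unfolding plane_span_def by (intro pm_subspace_set_sum pm_subspace_cyclic)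

lemma plane_spanI: "act f x + act g y \<in> plane_span x y"
  unfolding plane_span_def by (intro set_sumI) auto

lemma plane_spanE:
  assumes "z \<in> plane_span x y"
  obtains f g where "z = act f x + act g y"
proof -
  from assms obtain z1 z2 where z: "z = z1 + z2" "z1 \<in> range (\<lambda>f. act f x)" "z2 \<in> range (\<lambda>g. act g y)"
    unfolding plane_span_def by (rule set_sumE)
  from z(2) obtain f where "z1 = act f x" by (rule rangeE)
  moreover from z(3) obtain g where "z2 = act g y" by (rule rangeE)
  ultimately show ?thesis using that[of f g] z(1) by simp
qed

lemma plane_form:
  assumes "plane k x y"
  shows "b (act f x + act g y) (act f' x + act g' y) = top_coeff k (f * g' + g * f')"
proof -
  have xy: "b (act f x) (act g y) = top_coeff k (f * g)" for f g
  proof -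
    have "b (act f x) (act g y) = b (act g (act f x)) y" by (rule b_act[symmetric])
    also have "act g (act f x) = act (f * g) x" unfolding act_mult[symmetric] by (simp only: mult.commute)
    finally show ?thesis using assms unfolding plane_def by simp
  qed
  have xx: "b (act f z) (act g z) = 0" for f g z
    unfolding b_act act_mult[symmetric] by (rule b_act_self)
  show ?thesis
    by (simp only: b_add_left b_add_right xx xy b_sym[of "act g y" "act f' x"] top_coeff_add
        add_0_left add_0_right mult.commute[of f' g] add.commute[of "top_coeff k (g * f')"])
qed

text \<open>Nondegeneracy of \<open>top_coeff\<close> passes to the plane. With \<open>z = 0\<close>
  this gives freeness modulo \<open>r\<^sup>k\<close>, with \<open>z\<close> in an orthogonal
  subspace it gives directness of the sum.\<close>

lemma plane_independent:
  assumes "plane k x y" "\<And>h. b z (act h x) = 0" "\<And>h. b z (act h y) = 0" "z = act f x + act g y"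
  shows "r ^ k dvd f \<and> r ^ k dvd g"
proof (intro conjI top_coeff_nondegenerate)
  fix h
  have "top_coeff k (f * h) = b (act f x + act g y) (act 0 x + act h y)"
    unfolding plane_form[OF assms(1)] by simp
  also have "\<dots> = 0" unfolding assms(4)[symmetric] b_add_right assms(2,3) by simp
  finally show "top_coeff k (f * h) = 0" .
  have "top_coeff k (g * h) = b (act f x + act g y) (act h x + act 0 y)"
    unfolding plane_form[OF assms(1)] by simp
  also have "\<dots> = 0" unfolding assms(4)[symmetric] b_add_right assms(2,3) by simp
  finally show "top_coeff k (g * h) = 0" .
qed

definition orth :: "'v \<Rightarrow> 'v set \<Rightarrow> bool"
  where "orth x W \<longleftrightarrow> (\<forall>z\<in>W. b z x = 0)"

lemma orth_act: "pm.subspace W \<Longrightarrow> orth x W \<Longrightarrow> z \<in> W \<Longrightarrow> b z (act h x) = 0"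
  unfolding orth_def b_act[symmetric] by (simp add: pm.subspace_scale)

inductive plane_sum :: "'v set \<Rightarrow> nat list \<Rightarrow> bool" where
  plane_sum_Nil: "plane_sum {0} []"
| plane_sum_Cons: "plane_sum W ks \<Longrightarrow> k > 0 \<Longrightarrow> plane k x y \<Longrightarrow> orth x W \<Longrightarrow> orth y W
    \<Longrightarrow> plane_sum (set_sum (plane_span x y) W) (k # ks)"

lemma plane_sum_subspace: "plane_sum W ks \<Longrightarrow> pm.subspace W"
  by (induction rule: plane_sum.induct) (auto intro: pm_subspace_set_sum pm_subspace_plane_span)

lemma cyclic_sum_plane_sum:
  "plane_sum W ks \<Longrightarrow> cyclic_sum W (concat (map (\<lambda>k. [r ^ k, r ^ k]) ks))"
proof (induction rule: plane_sum.induct)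
  case plane_sum_Nil
  show ?case by (simp add: cyclic_sum_Nil)
next
  case (plane_sum_Cons W ks k x y)
  note W = plane_sum_subspace[OF plane_sum_Cons(1)]
  let ?rs = "concat (map (\<lambda>k. [r ^ k, r ^ k]) ks)"
  let ?W1 = "{z. \<exists>g. z - act g y \<in> W}"
  have key: "r ^ k dvd f \<and> r ^ k dvd g" if fg: "act f x + act g y \<in> W" for f g
    by (rule plane_independent[OF plane_sum_Cons(3) orth_act[OF W plane_sum_Cons(4) fg]
          orth_act[OF W plane_sum_Cons(5) fg] refl])
  have monic: "lead_coeff (r ^ k) = 1" "Polynomial.degree (r ^ k) > 0"
    using plane_sum_Cons(2) lead_r_power[of k] degree_r_power[of k] by simp_all
  have xy: "act (r ^ k) x = 0" "act (r ^ k) y = 0" using plane_sum_Cons(3) by (auto simp: plane_def)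
  have "cyclic_sum ?W1 (r ^ k # ?rs)"
  proof (rule cyclic_sum_Cons[OF plane_sum_Cons(6) monic xy(2)])
    fix g assume "act g y \<in> W"
    then show "r ^ k dvd g" using key[of 0 g] by simp
  qed
  then have "cyclic_sum {z. \<exists>f. z - act f x \<in> ?W1} (r ^ k # r ^ k # ?rs)"
  proof (rule cyclic_sum_Cons[OF _ monic xy(1)])
    fix f assume "act f x \<in> ?W1"
    then obtain g where "act f x + act g y \<in> W" by (auto simp: v_diff_add)
    then show "r ^ k dvd f" using key by blast
  qed
  moreover have "{z. \<exists>f. z - act f x \<in> ?W1} = set_sum (plane_span x y) W"
  proof (intro equalityI subsetI)
    fix z assume "z \<in> {z. \<exists>f. z - act f x \<in> ?W1}"
    then obtain f g where "z - act f x - act g y \<in> W" by auto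
    from set_sumI[OF plane_spanI[of f x g y] this] show "z \<in> set_sum (plane_span x y) W"
      by (simp add: diff_diff_add)
  next
    fix z assume "z \<in> set_sum (plane_span x y) W"
    then obtain t w where t: "z = t + w" "t \<in> plane_span x y" "w \<in> W" by (rule set_sumE)
    from t(2) obtain f g where "t = act f x + act g y" by (rule plane_spanE)
    then have "z - act f x - act g y = w" using t(1) by (simp add: diff_diff_add)
    then show "z \<in> {z. \<exists>f. z - act f x \<in> ?W1}" using t(3) by auto
  qed
  ultimately show ?case by simp
qed

text \<open>The iterates of \<open>x\<close> up to index \<open>2 * k + 1\<close> are independent,
  so by nondegeneracy of \<open>b\<close> on \<open>W\<close> some \<open>y\<close> is orthogonal to
  all of them but the last. Scaled to pair to 1 with the last, it reads off exactly the coefficient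
  of index \<open>2 * (k + 1) - 1\<close>.\<close>

lemma plane_exists:
  assumes W: "pm.subspace W" "perp_in W W \<subseteq> {0}" and kill: "\<And>z. z \<in> W \<Longrightarrow> act (r ^ Suc k) z = 0"
    and x: "x \<in> W" "act (r ^ k) x \<noteq> 0"
  shows "\<exists>y\<in>W. plane (Suc k) x y"
proof -
  let ?e = "\<lambda>j. (u ^^ j) x"
  define n where "n = Suc (2 * k)"
  have ann: "act f x \<notin> {0}" if f: "f \<noteq> 0" "Polynomial.degree f < Suc n" for f
  proof
    assume "act f x \<in> {0}"
    then have f0: "act f x = 0" by simp
    have "\<not> r ^ Suc k dvd f"
    proof
      assume "r ^ Suc k dvd f"
      then have "Polynomial.degree (r ^ Suc k) \<le> Polynomial.degree f" using f(1) by (rule dvd_imp_degree_le)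
      then show False using f(2) unfolding degree_r_power_Suc n_def by simp
    qed
    then obtain h s where "h * f + s * r ^ Suc k = r ^ k" using r_power_bezout by blast
    then have "act (r ^ k) x = act (h * f + s * r ^ Suc k) x" by simp
    also have "\<dots> = act h (act f x) + act s (act (r ^ Suc k) x)" by (simp only: act_add_left act_mult)
    also have "\<dots> = 0" unfolding f0 kill[OF x(1)] by simp
    finally show False using x(2) by simp
  qed
  have kry: "independent (?e ` {..<Suc n} \<union> {}) \<and> inj_on ?e {..<Suc n} \<and> ?e ` {..<Suc n} \<inter> {} = {}"
    by (rule krylov_independent[OF span_empty independent_empty]) (rule ann)
  let ?A = "?e ` {..<n}"
  have "?e ` {..<Suc n} = insert (?e n) ?A" by (simp add: lessThan_Suc)
  then have ind: "independent (insert (?e n) ?A)" using kry unfolding Un_empty_right by simp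
  have "?e n \<notin> ?A"
  proof
    assume "?e n \<in> ?A"
    then obtain j where "j < n" "?e n = ?e j" by blast
    then show False using kry by (auto dest!: inj_onD[of ?e "{..<Suc n}" n j])
  qed
  then have nspan: "?e n \<notin> span ?A" using ind unfolding independent_insert by simp
  have eW: "?e j \<in> W" for j by (induction j) (simp_all add: x(1) pm_subspace_u[OF W(1)])
  have "span ?A \<subseteq> W" using eW by (intro span_minimal pm_subspace_imp[OF W(1)]) auto
  from perp_in_perp_in[OF pm_subspace_imp[OF W(1)] subspace_span W(2) this]
  have "?e n \<notin> perp_in W (perp_in W (span ?A))" using nspan by simp
  then obtain y where y: "y \<in> perp_in W (span ?A)" "b y (?e n) \<noteq> 0"
    using eW[of n] unfolding perp_in_def by blast
  have yW: "y \<in> W" and yA: "b (?e j) y = 0" if "j < n" for j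
  proof -
    show "y \<in> W" using y(1) by (simp add: perp_in_def)
    have "?e j \<in> span ?A" using that by (intro span_base) blast
    then show "b (?e j) y = 0" using y(1) by (simp add: perp_in_def)
  qed
  define y' where "y' = (1 / b y (?e n)) *s y"
  have y': "b (?e j) y' = (if j = n then 1 else 0)" if "j < Suc n" for j
    using that yA[of j] y(2) b_sym[of "?e n" y] unfolding y'_def b_scale_right by auto
  have "0 < n" by (simp add: n_def)
  have "y' \<in> W" unfolding y'_def by (rule subspace_scale[OF pm_subspace_imp[OF W(1)] yW[OF \<open>0 < n\<close>]])
  moreover have "b (act f x) y' = top_coeff (Suc k) f" for f
  proof -
    define f0 where "f0 = f mod r ^ Suc k"
    have "f = (f div r ^ Suc k) * r ^ Suc k + f0" unfolding f0_def by (rule div_mult_mod_eq[symmetric])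
    then have "act f x = act ((f div r ^ Suc k) * r ^ Suc k + f0) x" by simp
    also have "\<dots> = act f0 x" unfolding act_add_left act_mult kill[OF x(1)] by simp
    finally have f0: "act f x = act f0 x" .
    have "Polynomial.degree f0 < Suc n"
      using degree_mod_less[of "r ^ Suc k" f] unfolding f0_def n_def degree_r_power_Suc by auto
    then have "act f0 x = (\<Sum>j<Suc n. Polynomial.coeff f0 j *s ?e j)" by (rule act_bound)
    moreover have "b (\<Sum>j\<in>B. Polynomial.coeff f0 j *s ?e j) y' = (\<Sum>j\<in>B. Polynomial.coeff f0 j * b (?e j) y')" for B
      by (induction B rule: infinite_finite_induct) (simp_all add: b_add_left b_scale_left)
    ultimately have "b (act f x) y' = (\<Sum>j<Suc n. Polynomial.coeff f0 j * b (?e j) y')" unfolding f0 by (simp only:)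
    also have "\<dots> = (\<Sum>j<Suc n. if j = n then Polynomial.coeff f0 j else 0)"
      by (intro sum.cong refl) (use y' in auto)
    also have "\<dots> = Polynomial.coeff f0 n" by (simp only: sum.delta' sum.delta finite_lessThan lessThan_iff lessI if_True)
    finally show ?thesis unfolding top_coeff_def f0_def n_def by simp
  qed
  ultimately show ?thesis unfolding plane_def using kill x(1) by blast
qed

text \<open>A plane of the largest exponent is nondegenerate, so its orthogonal in \<open>W\<close>
  is a complement to which induction applies. The final conjunct is carried along to keep the list
  decreasing, as invariant factors require.\<close>

lemma plane_sum_exists:
  assumes "pm.subspace W" "perp_in W W \<subseteq> {0}" "\<And>z. z \<in> W \<Longrightarrow> act (r ^ N) z = 0"
  shows "\<exists>ks. plane_sum W ks \<and> sorted_wrt (\<ge>) ks \<and>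
    (\<forall>N. (\<forall>z\<in>W. act (r ^ N) z = 0) \<longrightarrow> (\<forall>k\<in>set ks. k \<le> N))"
  using assms
proof (induction "dim W" arbitrary: W rule: less_induct)
  case less
  note W = less.prems(1)
  show ?case
  proof (cases "W = {0}")
    case True
    then show ?thesis by (intro exI[of _ "[]"]) (simp add: plane_sum_Nil)
  next
    case False
    define K where "K = (LEAST n. \<forall>z\<in>W. act (r ^ n) z = 0)"
    have ex: "\<forall>z\<in>W. act (r ^ N) z = 0" using less.prems(3) by blast
    then have K: "\<forall>z\<in>W. act (r ^ K) z = 0" unfolding K_def by (rule LeastI)
    have K_le: "K \<le> n" if "\<forall>z\<in>W. act (r ^ n) z = 0" for n
      unfolding K_def using that by (rule Least_le)
    have "K \<noteq> 0"
    proof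
      assume "K = 0"
      then have "\<forall>z\<in>W. z = 0" using K by simp
      then show False using False pm.subspace_0[OF W] by blast
    qed
    then obtain k where k: "K = Suc k" by (cases K) auto
    have "\<not> (\<forall>z\<in>W. act (r ^ k) z = 0)" using K_le[of k] k by auto
    then obtain x where x: "x \<in> W" "act (r ^ k) x \<noteq> 0" by blast
    obtain y where y: "y \<in> W" "plane K x y"
      using plane_exists[OF W less.prems(2) _ x] K unfolding k by blast
    let ?H = "plane_span x y"
    note pmH = pm_subspace_plane_span[of x y]
    have HW: "?H \<subseteq> W"
    proof
      fix z assume "z \<in> ?H"
      then obtain f g where "z = act f x + act g y" by (rule plane_spanE)
      then show "z \<in> W" using x(1) y(1) by (simp add: pm.subspace_add[OF W] pm.subspace_scale[OF W])
    qed
    define W' where "W' = perp_in W ?H"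
    have W': "pm.subspace W'" unfolding W'_def by (rule pm_subspace_perp_in[OF W pmH])
    have "W' \<subseteq> W" by (auto simp: W'_def perp_in_def)
    have xH: "act h x \<in> ?H" and yH: "act h y \<in> ?H" for h
      using plane_spanI[of h x 0 y] plane_spanI[of 0 x h y] by simp_all
    have HW': "?H \<inter> W' = {0}"
    proof (intro equalityI subsetI)
      fix z assume z: "z \<in> ?H \<inter> W'"
      then obtain f g where fg: "z = act f x + act g y" by (auto elim: plane_spanE)
      have zH: "b z t = 0" if "t \<in> ?H" for t
        using z that b_sym[of z t] by (simp add: W'_def perp_in_def)
      have "r ^ K dvd f \<and> r ^ K dvd g" by (rule plane_independent[OF y(2) zH[OF xH] zH[OF yH] fg])
      then have "act f x = 0" "act g y = 0"
        using y(2) act_dvd_zero[of "r ^ K" x f] act_dvd_zero[of "r ^ K" y g] unfolding plane_def by simp_all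
      then show "z \<in> {0}" using fg by simp
    next
      fix z assume "z \<in> {0::'v}"
      then show "z \<in> ?H \<inter> W'" using pm.subspace_0[OF pmH] pm.subspace_0[OF W'] by simp
    qed
    have sW: "subspace W" "subspace ?H" "subspace W'" using W pmH W' by (auto intro: pm_subspace_imp)
    have "perp_in W W \<subseteq> ?H" using less.prems(2) pm.subspace_0[OF pmH] by blast
    from dim_plus_perp[OF sW(1,2) this HW]
    have "dim ?H + dim W' = dim W + dim (perp_in W W)" unfolding W'_def .
    moreover have "dim (perp_in W W) = 0" using less.prems(2) by simp
    ultimately have dims: "dim ?H + dim W' = dim W" by linarith
    have "set_sum ?H W' \<subseteq> W"
    proof
      fix z assume "z \<in> set_sum ?H W'"
      then obtain s t where "z = s + t" "s \<in> ?H" "t \<in> W'" by (rule set_sumE)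
      then show "z \<in> W" using HW \<open>W' \<subseteq> W\<close> by (auto intro: pm.subspace_add[OF W])
    qed
    moreover have "dim (set_sum ?H W') = dim W"
      using dim_set_sum[OF sW(2,3) subset_refl subset_refl HW'] dims by simp
    ultimately have sum: "set_sum ?H W' = W"
      using subspace_dim_equal[OF pm_subspace_imp[OF pm_subspace_set_sum[OF pmH W']] sW(1)] by simp
    have "dim ?H \<noteq> 0"
    proof
      assume "dim ?H = 0"
      then have "?H \<subseteq> {0}" by simp
      then show False using xH[of "r ^ k"] x(2) by blast
    qed
    then have less: "dim W' < dim W" using dims by linarith
    have "perp_in W' W' \<subseteq> {0}"
    proof
      fix z assume z: "z \<in> perp_in W' W'"
      have "b t z = 0" if t: "t \<in> W" for t
      proof -
        have "t \<in> set_sum ?H W'" using t unfolding sum .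
        then obtain s s' where s: "t = s + s'" "s \<in> ?H" "s' \<in> W'" by (rule set_sumE)
        have "b s z = 0" "b s' z = 0" using z s(2,3) unfolding perp_in_def W'_def by blast+
        then show ?thesis unfolding s(1) b_add_left by simp
      qed
      then have "z \<in> perp_in W W" using z \<open>W' \<subseteq> W\<close> unfolding perp_in_def by blast
      then show "z \<in> {0}" using less.prems(2) by blast
    qed
    moreover have "act (r ^ N) z = 0" if "z \<in> W'" for z using less.prems(3) that \<open>W' \<subseteq> W\<close> by blast
    ultimately obtain ks where ks: "plane_sum W' ks" "sorted_wrt (\<ge>) ks"
      "\<forall>N. (\<forall>z\<in>W'. act (r ^ N) z = 0) \<longrightarrow> (\<forall>k\<in>set ks. k \<le> N)"
      using less.hyps[OF less W'] by blast
    have "orth x W'" "orth y W'"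
      unfolding orth_def using xH[of 1] yH[of 1] b_sym unfolding W'_def perp_in_def by auto
    then have "plane_sum W (K # ks)"
      using plane_sum_Cons[OF ks(1) _ y(2)] \<open>K \<noteq> 0\<close> unfolding sum by simp
    moreover have "sorted_wrt (\<ge>) (K # ks)" using ks(2,3) K \<open>W' \<subseteq> W\<close> by auto
    moreover have "\<forall>N. (\<forall>z\<in>W. act (r ^ N) z = 0) \<longrightarrow> (\<forall>k\<in>set (K # ks). k \<le> N)"
      using ks(3) K_le \<open>W' \<subseteq> W\<close> by auto
    ultimately show ?thesis by blast
  qed
qed

end

section \<open>Construction of the splitting map\<close>

context symplectic_endo
begin

text \<open>The conditions are relative to \<open>W\<close> so that maps found on orthogonal
  summands can be glued; outside \<open>W\<close> the function \<open>v\<close> is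
  arbitrary.\<close>

definition splits :: "('v \<Rightarrow> 'v) \<Rightarrow> 'v set \<Rightarrow> bool"
  where "splits v W \<longleftrightarrow> (\<forall>x\<in>W. v x \<in> W \<and> v (v x) = \<tau> *s v x + a *s x \<and> v (u x) = u (v x) + act r x \<and> b x (v x) = 0)
    \<and> (\<forall>x\<in>W. \<forall>y\<in>W. v (x + y) = v x + v y) \<and> (\<forall>k. \<forall>x\<in>W. v (k *s x) = k *s v x)"

lemma splits_sum:
  assumes A: "pm.subspace A" and B: "pm.subspace B" and AB: "A \<inter> B = {0}"
    and perp: "\<And>x y. x \<in> A \<Longrightarrow> y \<in> B \<Longrightarrow> b x y = 0"
    and vA: "splits vA A" and vB: "splits vB B"
  shows "\<exists>v. splits v (set_sum A B)"
proof -
  define dec where "dec = (\<lambda>z. SOME xy. fst xy \<in> A \<and> snd xy \<in> B \<and> z = fst xy + snd xy)"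
  define v where "v = (\<lambda>z. vA (fst (dec z)) + vB (snd (dec z)))"
  have v: "v (x + y) = vA x + vB y" if x: "x \<in> A" and y: "y \<in> B" for x y
  proof -
    have "\<exists>xy. fst xy \<in> A \<and> snd xy \<in> B \<and> x + y = fst xy + snd xy"
      by (rule exI[of _ "(x, y)"]) (simp add: x y)
    then have "fst (dec (x + y)) \<in> A \<and> snd (dec (x + y)) \<in> B \<and> x + y = fst (dec (x + y)) + snd (dec (x + y))"
      unfolding dec_def by (rule someI_ex)
    then obtain x' y' where xy': "dec (x + y) = (x', y')" "x' \<in> A" "y' \<in> B" "x + y = x' + y'"
      by (cases "dec (x + y)") auto
    have "(x - x') + (y - y') = 0" using xy'(4) by (simp add: add_diff_add[symmetric])
    from direct_zero[OF A AB pm.subspace_diff[OF A x xy'(2)] pm.subspace_diff[OF B y xy'(3)] this]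
    have "x' = x" "y' = y" by simp_all
    then show ?thesis unfolding v_def xy'(1) by simp
  qed
  have vA': "vA x \<in> A" "vA (vA x) = \<tau> *s vA x + a *s x" "vA (u x) = u (vA x) + act r x" "b x (vA x) = 0"
    if "x \<in> A" for x using vA that unfolding splits_def by simp_all
  have vB': "vB x \<in> B" "vB (vB x) = \<tau> *s vB x + a *s x" "vB (u x) = u (vB x) + act r x" "b x (vB x) = 0"
    if "x \<in> B" for x using vB that unfolding splits_def by simp_all
  have addA: "vA (x + y) = vA x + vA y" if "x \<in> A" "y \<in> A" for x y using vA that unfolding splits_def by simp
  have addB: "vB (x + y) = vB x + vB y" if "x \<in> B" "y \<in> B" for x y using vB that unfolding splits_def by simp
  have scA: "vA (k *s x) = k *s vA x" if "x \<in> A" for k x using vA that unfolding splits_def by simp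
  have scB: "vB (k *s x) = k *s vB x" if "x \<in> B" for k x using vB that unfolding splits_def by simp
  have "splits v (set_sum A B)"
    unfolding splits_def
  proof (intro conjI ballI allI)
    fix z assume "z \<in> set_sum A B"
    then obtain x y where z: "z = x + y" "x \<in> A" "y \<in> B" by (rule set_sumE)
    note vz = v[OF z(2,3), folded z(1)]
    note x = vA'[OF z(2)] and y = vB'[OF z(3)]
    show "v z \<in> set_sum A B" unfolding vz by (rule set_sumI[OF x(1) y(1)])
    show "v (v z) = \<tau> *s v z + a *s z"
      unfolding vz v[OF x(1) y(1)] x(2) y(2) unfolding z(1) scale_right_distrib by (simp only: add_ac)
    show "v (u z) = u (v z) + act r z"
      unfolding vz unfolding z(1) u_add act_add_right
        v[OF pm_subspace_u[OF A z(2)] pm_subspace_u[OF B z(3)]] x(3) y(3) by (simp only: add_ac)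
    show "b z (v z) = 0"
      unfolding vz unfolding z(1) b_add_left b_add_right x(4) y(4) perp[OF z(2) y(1)] b_sym[of y "vA x"]
        perp[OF x(1) z(3)] by simp
    show "v (k *s z) = k *s v z" for k
      unfolding vz unfolding z(1) scale_right_distrib
        v[OF subspace_scale[OF pm_subspace_imp[OF A] z(2)] subspace_scale[OF pm_subspace_imp[OF B] z(3)]]
        scA[OF z(2)] scB[OF z(3)] ..
    fix z' assume "z' \<in> set_sum A B"
    then obtain x' y' where z': "z' = x' + y'" "x' \<in> A" "y' \<in> B" by (rule set_sumE)
    have eq: "z + z' = (x + x') + (y + y')" unfolding z(1) z'(1) by (simp only: add_ac)
    show "v (z + z') = v z + v z'"
      unfolding eq v[OF pm.subspace_add[OF A z(2) z'(2)] pm.subspace_add[OF B z(3) z'(3)]]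
        addA[OF z(2) z'(2)] addB[OF z(3) z'(3)] vz v[OF z'(2,3), folded z'(1)] by (simp only: add_ac)
  qed
  then show ?thesis by blast
qed

text \<open>
  On a free module over \<open>F[t]/(r\<^sup>k)\<close> with basis \<open>e\<close>, the map \<open>v\<close> is the derivation \<open>r d/dt\<close> on coordinates
  plus a constant matrix \<open>M\<close> with \<open>M\<^sup>2 + \<tau> M + a = 0\<close>.
\<close>

lemma splits_free_module:
  fixes M :: "nat \<Rightarrow> nat \<Rightarrow> 'a" and e :: "nat \<Rightarrow> 'v" and n :: nat
  defines "G \<equiv> \<lambda>f. \<Sum>i<n. act (f i) (e i)"
    and "T \<equiv> \<lambda>f i. der (f i) + (\<Sum>j<n. Polynomial.smult (M i j) (f j))"
  assumes kill: "\<And>i. i < n \<Longrightarrow> act (r ^ k) (e i) = 0"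
    and free: "\<And>f i. G f = 0 \<Longrightarrow> i < n \<Longrightarrow> r ^ k dvd f i"
    and M: "\<And>i l. i < n \<Longrightarrow> l < n \<Longrightarrow> (\<Sum>j<n. M i j * M j l) = \<tau> * M i l + (if i = l then a else 0)"
    and form: "\<And>f. b (G f) (G (T f)) = 0"
  shows "\<exists>v. splits v (range G)"
proof -
  have G_add: "G f + G g = G (\<lambda>i. f i + g i)" for f g
    unfolding G_def by (simp add: act_add_left sum.distrib)
  have G_act: "act h (G f) = G (\<lambda>i. h * f i)" for h f
    unfolding G_def pm.scale_sum_right by (simp only: act_mult)
  have T_add: "T (\<lambda>i. f i + g i) = (\<lambda>i. T f i + T g i)" for f g
    unfolding T_def by (rule ext) (simp add: der_add smult_add_right sum.distrib add_ac)
  have G_zero: "G f = 0" if dvd: "\<And>i. i < n \<Longrightarrow> r ^ k dvd f i" for f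
    unfolding G_def
  proof (intro sum.neutral ballI)
    fix i assume "i \<in> {..<n}"
    then have "i < n" by simp
    then show "act (f i) (e i) = 0" using act_dvd_zero[OF kill dvd] by blast
  qed
  \<comment> \<open>Coordinates are unique only modulo \<open>r\<^sup>k\<close>; every choice gives
    the same value because \<open>T\<close> preserves families of multiples of
    \<open>r\<^sup>k\<close>.\<close>
  define v where "v = (\<lambda>z. G (T (SOME f. z = G f)))"
  have v: "v (G f) = G (T f)" for f
  proof -
    define g where "g = (SOME g. G f = G g)"
    have "\<exists>g. G f = G g" by blast
    then have "G f = G g" unfolding g_def by (rule someI_ex)
    then have "G (\<lambda>i. f i + g i) = 0" unfolding G_add[symmetric] by simp
    then have d: "r ^ k dvd f i + g i" if "i < n" for i using free[of "\<lambda>i. f i + g i" i] that by simp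
    have "r ^ k dvd T (\<lambda>i. f i + g i) i" if "i < n" for i
      unfolding T_def by (rule dvd_add[OF der_dvd[OF d[OF that]] dvd_sum]) (simp add: d dvd_smult)
    then have "G (T (\<lambda>i. f i + g i)) = 0" by (rule G_zero)
    then have "G (T f) + G (T g) = 0" unfolding T_add G_add .
    then have "G (T f) = G (T g)" by (simp add: add_eq_0_iff)
    then show ?thesis unfolding v_def g_def by simp
  qed
  have G_cong: "G f = G g" if "\<And>i. i < n \<Longrightarrow> f i = g i" for f g
    unfolding G_def using that by simp
  have TT: "T (T f) i = [:\<tau>:] * T f i + [:a:] * f i" if i: "i < n" for f i
  proof -
    have "(\<Sum>j<n. Polynomial.smult (M i j) (\<Sum>l<n. Polynomial.smult (M j l) (f l)))
        = (\<Sum>j<n. \<Sum>l<n. Polynomial.smult (M i j * M j l) (f l))"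
      by (simp add: smult_sum2)
    also have "\<dots> = (\<Sum>l<n. \<Sum>j<n. Polynomial.smult (M i j * M j l) (f l))"
      by (rule sum.swap)
    also have "\<dots> = (\<Sum>l<n. Polynomial.smult (\<tau> * M i l + (if i = l then a else 0)) (f l))"
    proof (rule sum.cong[OF refl])
      fix l assume "l \<in> {..<n}"
      then have l: "l < n" by simp
      have "(\<Sum>j<n. Polynomial.smult (M i j * M j l) (f l)) = Polynomial.smult (\<Sum>j<n. M i j * M j l) (f l)"
        by (simp only: smult_sum)
      then show "(\<Sum>j<n. Polynomial.smult (M i j * M j l) (f l))
          = Polynomial.smult (\<tau> * M i l + (if i = l then a else 0)) (f l)" unfolding M[OF i l] .
    qed
    also have "\<dots> = (\<Sum>l<n. Polynomial.smult (\<tau> * M i l) (f l)) + (\<Sum>l<n. if l = i then Polynomial.smult a (f l) else 0)"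
      unfolding sum.distrib[symmetric] by (intro sum.cong refl) (simp add: smult_add_left)
    also have "(\<Sum>l<n. if l = i then Polynomial.smult a (f l) else 0) = Polynomial.smult a (f i)"
      using i by simp
    finally have NN: "(\<Sum>j<n. Polynomial.smult (M i j) (\<Sum>l<n. Polynomial.smult (M j l) (f l)))
        = (\<Sum>l<n. Polynomial.smult (\<tau> * M i l) (f l)) + Polynomial.smult a (f i)" .
    have der_sum: "der (\<Sum>j\<in>B. Polynomial.smult (M i j) (f j)) = (\<Sum>j\<in>B. Polynomial.smult (M i j) (der (f j)))" for B
      by (induction B rule: infinite_finite_induct) (simp_all add: der_add der_smult, simp_all add: der_def)
    let ?D = "\<Sum>j<n. Polynomial.smult (M i j) (der (f j))"
    \<comment> \<open>The matrix is constant and so commutes with \<open>der\<close>; the mixed term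
      \<open>?D\<close> occurs twice and cancels, leaving the quadratic relations of
      \<open>der\<close> and of \<open>M\<close>.\<close>
    have "T (T f) i = (der (der (f i)) + ?D) + (?D + (\<Sum>j<n. Polynomial.smult (M i j) (\<Sum>l<n. Polynomial.smult (M j l) (f l))))"
      unfolding T_def der_add der_sum smult_add_right sum.distrib ..
    also have "\<dots> = der (der (f i)) + ((\<Sum>l<n. Polynomial.smult (\<tau> * M i l) (f l)) + Polynomial.smult a (f i))"
      unfolding NN by (simp add: add.assoc[symmetric] add.assoc[of _ ?D ?D])
    also have "\<dots> = [:\<tau>:] * T f i + [:a:] * f i"
      unfolding T_def der_der by (simp add: smult_add_right smult_sum2 add.assoc)
    finally show ?thesis .
  qed
  have Tu: "T (\<lambda>i. [:0, 1:] * f i) i = [:0, 1:] * T f i + r * f i" for f i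
  proof -
    have "der ([:0, 1:] * g) = [:0, 1:] * der g + r * g" for g
      unfolding der_mult by (simp add: der_def pderiv_pCons)
    then show ?thesis unfolding T_def distrib_left sum_distrib_left
      by (simp only: mult_smult_right add_ac)
  qed
  have uG: "u (G f) = G (\<lambda>i. [:0, 1:] * f i)" for f using G_act[of "[:0, 1:]" f] by simp
  have scG: "h *s G f = G (\<lambda>i. [:h:] * f i)" for h f using G_act[of "[:h:]" f] by simp
  have "splits v (range G)"
    unfolding splits_def
  proof (intro conjI ballI allI)
    fix z assume "z \<in> range G"
    then obtain f where z: "z = G f" by (rule rangeE)
    show "v z \<in> range G" unfolding z v by simp
    show "v (v z) = \<tau> *s v z + a *s z"
      unfolding z v scG G_add by (rule G_cong) (rule TT)
    show "v (u z) = u (v z) + act r z"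
      unfolding z uG v G_act G_add by (rule G_cong) (rule Tu)
    show "b z (v z) = 0" unfolding z v by (rule form)
    show "v (h *s z) = h *s v z" for h
    proof -
      have "T (\<lambda>i. [:h:] * f i) i = [:h:] * T f i" for i
        unfolding T_def distrib_left sum_distrib_left
        by (simp add: der_smult mult.commute[of h])
      then show ?thesis unfolding z scG v by (intro G_cong)
    qed
    fix z' assume "z' \<in> range G"
    then obtain g where z': "z' = G g" by (rule rangeE)
    show "v (z + z') = v z + v z'" unfolding z z' G_add v T_add ..
  qed
  then show ?thesis by blast
qed

end

lemma sum_lessThan_4: "(\<Sum>i<4::nat. h i) = h 0 + h 1 + h 2 + (h 3 :: 'b::comm_monoid_add)"
  by (simp add: eval_nat_numeral)

section \<open>Splitting maps on planes and on their sums\<close>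

context symplectic_endo
begin

text \<open>The matrix is the transposed companion matrix of \<open>p\<close>. The derivation
  contributes \<open>\<tau>\<close> times the top coefficient of \<open>f 0 * f 1\<close>, which the
  trace of \<open>M\<close> cancels; the off-diagonal entries contribute squares, whose top
  coefficients vanish for even \<open>k\<close>.\<close>

lemma splits_even_plane:
  assumes P: "plane k x y" and k: "even k" "k > 0"
  shows "\<exists>v. splits v (plane_span x y)"
proof -
  define M :: "nat \<Rightarrow> nat \<Rightarrow> 'a" where "M = (\<lambda>i j. if i = 0 then (if j = 0 then 0 else 1) else (if j = 0 then a else \<tau>))"
  define e where "e = (\<lambda>i. if i = (0::nat) then x else y)"
  let ?n = "2::nat"
  have G: "(\<Sum>i<?n. act (f i) (e i)) = act (f 0) x + act (f 1) y" for f
    by (simp add: e_def numeral_2_eq_2)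
  have two_cases: "i = 0 \<or> i = 1" if "i < ?n" for i using that by auto
  have "\<exists>v. splits v (range (\<lambda>f. \<Sum>i<?n. act (f i) (e i)))"
  proof (rule splits_free_module[where k = k and M = "M"])
    show "act (r ^ k) (e i) = 0" for i using P by (simp add: e_def plane_def)
    show "r ^ k dvd f i" if "(\<Sum>i<?n. act (f i) (e i)) = 0" "i < ?n" for f i
    proof -
      have "r ^ k dvd f 0 \<and> r ^ k dvd f 1"
        using that(1) unfolding G by (intro plane_independent[OF P, of 0]) simp_all
      then show ?thesis using two_cases[OF that(2)] by auto
    qed
    show "(\<Sum>j<?n. M i j * M j l) = \<tau> * M i l + (if i = l then a else 0)" if "i < ?n" "l < ?n" for i l
      using two_cases[OF that(1)] two_cases[OF that(2)] by (auto simp: M_def numeral_2_eq_2 add.commute)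
    fix f
    let ?T = "\<lambda>i. der (f i) + (\<Sum>j<?n. Polynomial.smult (M i j) (f j))"
    have T: "?T 0 = der (f 0) + f 1"
      "?T 1 = der (f 1) + (Polynomial.smult a (f 0) + Polynomial.smult \<tau> (f 1))"
      by (simp_all add: M_def numeral_2_eq_2)
    obtain k' where k': "k = Suc k'" "odd k'" using k by (cases k) auto
    have "top_coeff k (f 0 * (der (f 1) + (Polynomial.smult a (f 0) + Polynomial.smult \<tau> (f 1))) + f 1 * (der (f 0) + f 1))
        = top_coeff k (der (f 0 * f 1) + (Polynomial.smult a (f 0 ^ 2) + (Polynomial.smult \<tau> (f 0 * f 1) + f 1 ^ 2)))"
      by (rule arg_cong[of _ _ "top_coeff k"])
        (simp add: der_mult algebra_simps power2_eq_square)
    also have "\<dots> = 0"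
      unfolding top_coeff_add top_coeff_smult top_coeff_square[OF k(1)]
      using top_coeff_der[of k' "f 0 * f 1"] k' by simp
    finally show "b (\<Sum>i<?n. act (f i) (e i)) (\<Sum>i<?n. act (?T i) (e i)) = 0"
      unfolding G T plane_form[OF P] .
  qed
  moreover have "range (\<lambda>f. \<Sum>i<?n. act (f i) (e i)) = plane_span x y"
  proof (intro equalityI subsetI)
    fix z assume "z \<in> range (\<lambda>f. \<Sum>i<?n. act (f i) (e i))"
    then obtain f where "z = (\<Sum>i<?n. act (f i) (e i))" by (rule rangeE)
    then show "z \<in> plane_span x y" unfolding G by (simp only: plane_spanI)
  next
    fix z assume "z \<in> plane_span x y"
    then obtain f g where "z = act f x + act g y" by (rule plane_spanE)
    then show "z \<in> range (\<lambda>f. \<Sum>i<?n. act (f i) (e i))"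
      unfolding G by (intro range_eqI[of _ _ "\<lambda>i. if i = 0 then f else g"]) simp
  qed
  ultimately show ?thesis by simp
qed

lemma plane_span_inter:
  assumes "plane k x y" "pm.subspace W" "orth x W" "orth y W"
  shows "plane_span x y \<inter> W = {0}"
proof (intro equalityI subsetI)
  fix z assume z: "z \<in> plane_span x y \<inter> W"
  then have zW: "z \<in> W" by blast
  from z obtain f g where fg: "z = act f x + act g y" by (auto elim: plane_spanE)
  have "r ^ k dvd f \<and> r ^ k dvd g"
    by (rule plane_independent[OF assms(1) orth_act[OF assms(2,3) zW] orth_act[OF assms(2,4) zW] fg])
  then show "z \<in> {0}" using fg assms(1) act_dvd_zero[of "r ^ k" x f] act_dvd_zero[of "r ^ k" y g]
    unfolding plane_def by simp
next
  fix z assume "z \<in> {0::'v}"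
  then show "z \<in> plane_span x y \<inter> W"
    using pm.subspace_0[OF assms(2)] pm.subspace_0[OF pm_subspace_plane_span] by simp
qed

lemma plane_span_perp:
  assumes "pm.subspace W" "orth x W" "orth y W" "h \<in> plane_span x y" "z \<in> W"
  shows "b h z = 0"
proof -
  from assms(4) obtain f g where "h = act f x + act g y" by (rule plane_spanE)
  then have "b z h = 0"
    unfolding b_add_right using orth_act[OF assms(1,2,5)] orth_act[OF assms(1,3,5)] b_add_right by simp
  then show ?thesis using b_sym[of h z] by simp
qed

text \<open>For odd \<open>k\<close> the derivation contributes nothing, so the constant matrix must
  itself be alternating. In the order \<open>x\<close>, \<open>x'\<close>, \<open>y\<close>,
  \<open>y'\<close> it has the companion matrix of \<open>p\<close> as first block and its transpose
  as second. The form pairs the first block with the second, so every term occurs twice and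
  cancels.\<close>

lemma splits_odd_planes:
  assumes P: "plane k x y" and P': "plane k x' y'" and k: "odd k"
    and orth: "orth x (plane_span x' y')" "orth y (plane_span x' y')"
  shows "\<exists>v. splits v (set_sum (plane_span x y) (plane_span x' y'))"
proof -
  define M :: "nat \<Rightarrow> nat \<Rightarrow> 'a" where "M = (\<lambda>i j. if i = 0 then (if j = 1 then a else 0)
    else if i = 1 then (if j = 0 then 1 else if j = 1 then \<tau> else 0)
    else if i = 2 then (if j = 3 then 1 else 0)
    else (if j = 2 then a else if j = 3 then \<tau> else 0))"
  define e where "e = (\<lambda>i. if i = (0::nat) then x else if i = 1 then x' else if i = 2 then y else y')"
  let ?n = "4::nat"
  have G: "(\<Sum>i<?n. act (f i) (e i)) = (act (f 0) x + act (f 2) y) + (act (f 1) x' + act (f 3) y')" for f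
    unfolding sum_lessThan_4 by (simp add: e_def add_ac)
  have four: "i = 0 \<or> i = 1 \<or> i = 2 \<or> i = 3" if "i < ?n" for i using that by auto
  let ?H = "plane_span x y" and ?H' = "plane_span x' y'"
  note pm' = pm_subspace_plane_span[of x' y']
  have inter: "?H \<inter> ?H' = {0}" by (rule plane_span_inter[OF P pm' orth])
  have "\<exists>v. splits v (range (\<lambda>f. \<Sum>i<?n. act (f i) (e i)))"
  proof (rule splits_free_module[where k = k and M = "M"])
    show "act (r ^ k) (e i) = 0" for i using P P' by (simp add: e_def plane_def)
    show "r ^ k dvd f i" if f: "(\<Sum>i<?n. act (f i) (e i)) = 0" "i < ?n" for f i
    proof -
      have "act (f 0) x + act (f 2) y = 0 \<and> act (f 1) x' + act (f 3) y' = 0"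
        using f(1) unfolding G by (rule direct_zero[OF pm_subspace_plane_span inter plane_spanI plane_spanI])
      then have "(r ^ k dvd f 0 \<and> r ^ k dvd f 2) \<and> (r ^ k dvd f 1 \<and> r ^ k dvd f 3)"
        by (intro conjI[of "_ \<and> _" "_ \<and> _"] plane_independent[OF P, of 0] plane_independent[OF P', of 0]) simp_all
      then show ?thesis using four[OF f(2)] by auto
    qed
    show "(\<Sum>j<?n. M i j * M j l) = \<tau> * M i l + (if i = l then a else 0)" if "i < ?n" "l < ?n" for i l
      unfolding sum_lessThan_4 using four[OF that(1)] four[OF that(2)] by (auto simp: M_def add.commute)
    fix f
    let ?T = "\<lambda>i. der (f i) + (\<Sum>j<?n. Polynomial.smult (M i j) (f j))"
    have T: "?T 0 = der (f 0) + Polynomial.smult a (f 1)"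
      "?T 1 = der (f 1) + (f 0 + Polynomial.smult \<tau> (f 1))"
      "?T 2 = der (f 2) + f 3"
      "?T 3 = der (f 3) + (Polynomial.smult a (f 2) + Polynomial.smult \<tau> (f 3))"
      unfolding sum_lessThan_4 by (simp_all add: M_def)
    obtain k' where k': "k = Suc k'" "even k'" using k by (cases k) auto
    have der0: "top_coeff k (der h) = 0" for h using top_coeff_der[of k' h] k' by simp
    have "top_coeff k (f 0 * (der (f 2) + f 3) + f 2 * (der (f 0) + Polynomial.smult a (f 1)))
        + top_coeff k (f 1 * (der (f 3) + (Polynomial.smult a (f 2) + Polynomial.smult \<tau> (f 3)))
          + f 3 * (der (f 1) + (f 0 + Polynomial.smult \<tau> (f 1))))
        = top_coeff k (der (f 0 * f 2) + der (f 1 * f 3)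
          + ((f 0 * f 3 + f 0 * f 3) + (Polynomial.smult a (f 1 * f 2) + Polynomial.smult a (f 1 * f 2))
            + (Polynomial.smult \<tau> (f 1 * f 3) + Polynomial.smult \<tau> (f 1 * f 3))))"
      unfolding top_coeff_add[symmetric]
      by (rule arg_cong[of _ _ "top_coeff k"]) (simp add: der_mult algebra_simps poly_two)
    also have "\<dots> = 0" unfolding poly_add_self by (simp add: top_coeff_add der0)
    finally have zero: "top_coeff k (f 0 * (der (f 2) + f 3) + f 2 * (der (f 0) + Polynomial.smult a (f 1)))
        + top_coeff k (f 1 * (der (f 3) + (Polynomial.smult a (f 2) + Polynomial.smult \<tau> (f 3)))
          + f 3 * (der (f 1) + (f 0 + Polynomial.smult \<tau> (f 1)))) = 0" .
    have perp: "b (act p x + act q y) (act p' x' + act q' y') = 0" for p q p' q'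
      by (rule plane_span_perp[OF pm' orth plane_spanI plane_spanI])
    have perp': "b (act p' x' + act q' y') (act p x + act q y) = 0" for p q p' q'
      by (rule trans[OF b_sym perp])
    show "b (\<Sum>i<?n. act (f i) (e i)) (\<Sum>i<?n. act (?T i) (e i)) = 0"
      unfolding G T b_add_left[of "act (f 0) x + act (f 2) y"]
        b_add_right[of _ "act (der (f 0) + Polynomial.smult a (f 1)) x + act (der (f 2) + f 3) y"]
        perp perp' plane_form[OF P] plane_form[OF P'] add_0_left add_0_right by (rule zero)
  qed
  moreover have "range (\<lambda>f. \<Sum>i<?n. act (f i) (e i)) = set_sum ?H ?H'"
  proof (intro equalityI subsetI)
    fix z assume "z \<in> range (\<lambda>f. \<Sum>i<?n. act (f i) (e i))"
    then obtain f where "z = (\<Sum>i<?n. act (f i) (e i))" by (rule rangeE)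
    then show "z \<in> set_sum ?H ?H'" unfolding G by (simp only: set_sumI[OF plane_spanI plane_spanI])
  next
    fix z assume "z \<in> set_sum ?H ?H'"
    then obtain h h' where h: "z = h + h'" "h \<in> ?H" "h' \<in> ?H'" by (rule set_sumE)
    from h(2) obtain f g where fg: "h = act f x + act g y" by (rule plane_spanE)
    from h(3) obtain f' g' where fg': "h' = act f' x' + act g' y'" by (rule plane_spanE)
    show "z \<in> range (\<lambda>f. \<Sum>i<?n. act (f i) (e i))"
      unfolding G h(1) fg fg'
      by (intro range_eqI[of _ _ "\<lambda>i. if i = 0 then f else if i = 1 then f' else if i = 2 then g else g'"]) simp
  qed
  ultimately show ?thesis by simp
qed


lemma set_sum_left_commute: "set_sum A (set_sum B D) = set_sum B (set_sum A D)"
  unfolding set_sum_def by (auto; metis add.left_commute)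

lemma set_sum_assoc: "set_sum (set_sum A B) D = set_sum A (set_sum B D)"
  unfolding set_sum_def by (auto; metis add.assoc)

text \<open>An orthogonal sum does not depend on the order of its summands, so a plane of a chosen
  exponent can be brought to the front; this lets equal odd exponents be paired.\<close>

lemma plane_sum_extract:
  assumes "plane_sum W ks" "k \<in> set ks"
  shows "\<exists>x y W'. plane k x y \<and> orth x W' \<and> orth y W' \<and> plane_sum W' (remove1 k ks)
    \<and> W = set_sum (plane_span x y) W'"
  using assms
proof (induction rule: plane_sum.induct)
  case plane_sum_Nil
  then show ?case by simp
next
  case (plane_sum_Cons W ks k0 x0 y0)
  show ?case
  proof (cases "k = k0")
    case True
    have "remove1 k (k0 # ks) = ks" using True by simp
    then show ?thesis using plane_sum_Cons.hyps True
      by (intro exI[of _ x0] exI[of _ y0] exI[of _ W]) simp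
  next
    case False
    then obtain x y W' where IH: "plane k x y" "orth x W'" "orth y W'" "plane_sum W' (remove1 k ks)"
      "W = set_sum (plane_span x y) W'" using plane_sum_Cons by auto
    let ?K = "plane_span x0 y0" and ?H = "plane_span x y"
    note W = plane_sum_subspace[OF plane_sum_Cons.hyps(1)] and W' = plane_sum_subspace[OF IH(4)]
    have "W' \<subseteq> W"
    proof
      fix z assume "z \<in> W'"
      from set_sumI[OF pm.subspace_0[OF pm_subspace_plane_span[of x y]] this] show "z \<in> W"
        unfolding IH(5) by simp
    qed
    have HW: "h \<in> W" if "h \<in> ?H" for h
      using set_sumI[OF that pm.subspace_0[OF W']] unfolding IH(5) by simp
    have o: "orth x0 W'" "orth y0 W'"
      using plane_sum_Cons.hyps(4,5) \<open>W' \<subseteq> W\<close> unfolding orth_def by blast+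
    have ps: "plane_sum (set_sum ?K W') (k0 # remove1 k ks)"
      by (rule plane_sum.plane_sum_Cons[OF IH(4) plane_sum_Cons.hyps(2,3) o])
    have orth_t: "orth t (set_sum ?K W')" if t: "t \<in> ?H" "orth t W'" for t
      unfolding orth_def
    proof
      fix z assume "z \<in> set_sum ?K W'"
      then obtain h w where z: "z = h + w" "h \<in> ?K" "w \<in> W'" by (rule set_sumE)
      have "b h t = 0" by (rule plane_span_perp[OF W plane_sum_Cons.hyps(4,5) z(2) HW[OF t(1)]])
      moreover have "b w t = 0" using t(2) z(3) unfolding orth_def by blast
      ultimately show "b z t = 0" unfolding z(1) b_add_left by simp
    qed
    have xy: "x \<in> ?H" "y \<in> ?H" using plane_spanI[of 1 x 0 y] plane_spanI[of 0 x 1 y] by simp_all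
    have "remove1 k (k0 # ks) = k0 # remove1 k ks" using False by simp
    moreover have "set_sum ?K W = set_sum ?H (set_sum ?K W')"
      unfolding IH(5) by (rule set_sum_left_commute)
    ultimately show ?thesis
      using IH(1) orth_t[OF xy(1) IH(2)] orth_t[OF xy(2) IH(3)] ps
      by (intro exI[of _ x] exI[of _ y] exI[of _ "set_sum ?K W'"]) simp
  qed
qed

lemma splits_plane_sum:
  assumes "plane_sum W ks" "\<forall>k. odd k \<longrightarrow> even (count (mset ks) k)"
  shows "\<exists>v. splits v W"
  using assms
proof (induction "length ks" arbitrary: W ks rule: less_induct)
  case less
  show ?case
  proof (cases ks)
    case Nil
    then have "W = {0}" using less.prems(1) by (auto elim: plane_sum.cases)
    then have "splits (\<lambda>x. 0) W" by (simp add: splits_def)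
    then show ?thesis by blast
  next
    case (Cons k ks')
    have "k \<in> set ks" using Cons by simp
    from plane_sum_extract[OF less.prems(1) this] obtain x y W' where
      P: "plane k x y" and o: "orth x W'" "orth y W'" and ps: "plane_sum W' (remove1 k ks)"
        and W: "W = set_sum (plane_span x y) W'" by blast
    have rm: "remove1 k ks = ks'" using Cons by simp
    note W' = plane_sum_subspace[OF ps]
    have inter: "plane_span x y \<inter> W' = {0}" by (rule plane_span_inter[OF P W' o])
    have perp: "b h z = 0" if "h \<in> plane_span x y" "z \<in> W'" for h z
      by (rule plane_span_perp[OF W' o that])
    have "k > 0" using less.prems(1) unfolding Cons by (auto elim: plane_sum.cases)
    show ?thesis
    proof (cases "even k")
      case True
      have cnt: "even (count (mset ks') j)" if "odd j" for j
      proof -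
        have "j \<noteq> k" using True that by auto
        then show ?thesis using less.prems(2) that unfolding Cons by auto
      qed
      obtain v where v: "splits v W'"
        using less.hyps[of ks' W'] ps cnt unfolding rm Cons by auto
      obtain v' where v': "splits v' (plane_span x y)"
        using splits_even_plane[OF P True \<open>k > 0\<close>] by blast
      show ?thesis unfolding W
        by (rule splits_sum[OF pm_subspace_plane_span W' inter perp v' v])
    next
      case False
      have "even (count (mset ks) k)" using less.prems(2) False by blast
      \<comment> \<open>Even multiplicity guarantees a second plane of the same odd exponent among
        the remaining ones.\<close>
      then have "odd (count (mset ks') k)" unfolding Cons by simp
      then have "count (mset ks') k \<noteq> 0" by (intro notI) simp
      then have "k \<in> set ks'" by simp
      from plane_sum_extract[OF ps[unfolded rm] this] obtain x' y' W'' where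
        P': "plane k x' y'" and o': "orth x' W''" "orth y' W''" and ps': "plane_sum W'' (remove1 k ks')"
          and W'': "W' = set_sum (plane_span x' y') W''" by blast
      let ?H = "plane_span x y" and ?H' = "plane_span x' y'"
      note pm = plane_sum_subspace[OF ps']
      have HW: "h \<in> W'" if "h \<in> ?H'" for h
        using set_sumI[OF that pm.subspace_0[OF pm]] unfolding W'' by simp
      have sub: "w \<in> W'" if "w \<in> W''" for w
        using set_sumI[OF pm.subspace_0[OF pm_subspace_plane_span] that] unfolding W'' by simp
      have inter': "?H' \<inter> W'' = {0}" by (rule plane_span_inter[OF P' pm o'])
      have "orth x ?H'" "orth y ?H'" using o HW unfolding orth_def by blast+
      then obtain v' where v': "splits v' (set_sum ?H ?H')"
        using splits_odd_planes[OF P P' False] by blast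
      have cnt: "even (count (mset (remove1 k ks')) j)" if "odd j" for j
      proof (cases "j = k")
        case True
        then show ?thesis using \<open>odd (count (mset ks') k)\<close> by simp
      next
        case jk: False
        have "even (count (mset ks) j)" using less.prems(2) that by blast
        then show ?thesis using jk unfolding Cons by simp
      qed
      have len: "length (remove1 k ks') < length ks" unfolding Cons by (simp add: length_remove1 less_Suc_eq_le)
      have "\<forall>j. odd j \<longrightarrow> even (count (mset (remove1 k ks')) j)" by (intro allI impI cnt)
      from less.hyps[OF len ps' this] obtain v where v: "splits v W''" by (elim exE)
      have WW: "W = set_sum (set_sum ?H ?H') W''" unfolding W W'' set_sum_assoc ..
      show ?thesis unfolding WW
      proof (rule splits_sum[OF pm_subspace_set_sum[OF pm_subspace_plane_span pm_subspace_plane_span] pm _ _ v' v])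
        show "set_sum ?H ?H' \<inter> W'' = {0}"
        proof (intro equalityI subsetI)
          fix z assume "z \<in> set_sum ?H ?H' \<inter> W''"
          then have z: "z \<in> set_sum ?H ?H'" "z \<in> W''" by blast+
          from z(1) obtain h h' where h: "z = h + h'" "h \<in> ?H" "h' \<in> ?H'" by (rule set_sumE)
          have "h + (h' + z) = z + z" by (simp only: add.assoc[symmetric] h(1)[symmetric])
          then have "h + (h' + z) = 0" by simp
          from direct_zero[OF pm_subspace_plane_span inter h(2) pm.subspace_add[OF W' HW[OF h(3)] sub[OF z(2)]] this]
          have "h = 0" ..
          then have "z \<in> ?H' \<inter> W''" using h z(2) by simp
          then show "z \<in> {0}" unfolding inter' .
        next
          fix z assume "z \<in> {0::'v}"
          then show "z \<in> set_sum ?H ?H' \<inter> W''"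
            using pm.subspace_0[OF pm]
              pm.subspace_0[OF pm_subspace_set_sum[OF pm_subspace_plane_span pm_subspace_plane_span]] by simp
        qed
        fix s w assume "s \<in> set_sum ?H ?H'" and w: "w \<in> W''"
        then obtain h h' where h: "s = h + h'" "h \<in> ?H" "h' \<in> ?H'" by (elim set_sumE)
        have "b h w = 0" by (rule perp[OF h(2) sub[OF w]])
        moreover have "b h' w = 0" by (rule plane_span_perp[OF pm o' h(3) w])
        ultimately show "b s w = 0" unfolding h(1) b_add_left by simp
      qed
    qed
  qed
qed

end

section \<open>The main equivalence\<close>

lemma poly_to_ac_pCons: "poly (map_poly to_ac (pCons k f)) l = to_ac k + l * poly (map_poly to_ac f) l"
  by (cases "k = 0 \<and> f = 0") (auto simp: map_poly_pCons)

lemma poly_to_ac_add: "poly (map_poly to_ac (f + g)) l = poly (map_poly to_ac f) l + poly (map_poly to_ac g) l"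
  by (induction f g rule: poly_induct2) (simp_all add: poly_to_ac_pCons algebra_simps)

lemma poly_to_ac_smult: "poly (map_poly to_ac (Polynomial.smult k f)) l = to_ac k * poly (map_poly to_ac f) l"
  by (induction f) (simp_all add: poly_to_ac_pCons algebra_simps)

lemma poly_to_ac_mult: "poly (map_poly to_ac (f * g)) l = poly (map_poly to_ac f) l * poly (map_poly to_ac g) l"
  by (induction f) (simp_all add: poly_to_ac_pCons algebra_simps poly_to_ac_add poly_to_ac_smult)

lemma generate_field_minimal:
  assumes "A \<subseteq> generate_field R B"
  shows "generate_field R A \<subseteq> generate_field R B"
proof
  fix x assume "x \<in> generate_field R A"
  then show "x \<in> generate_field R B"
  proof (induction rule: generate_field.induct)
    case (incl h)
    then show ?case using assms by blast
  qed (auto intro: generate_field.intros)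
qed

lemma no_root_of_irreducible:
  assumes "Factorial_Ring.irreducible (f :: 'a::field poly)" "Polynomial.degree f = 2"
  shows "poly f s \<noteq> 0"
proof
  assume "poly f s = 0"
  then obtain g where g: "f = [:- s, 1:] * g" by (auto simp: poly_eq_0_iff_dvd elim!: dvdE)
  then have "g \<noteq> 0" using assms(2) by auto
  then have "Polynomial.degree f = 1 + Polynomial.degree g"
    unfolding g by (subst degree_mult_eq) auto
  then have dg: "Polynomial.degree g = 1" using assms(2) by simp
  have "is_unit [:- s, 1:] \<or> is_unit g" using assms(1) g by (rule irreducibleD)
  then show False using dg \<open>g \<noteq> 0\<close> by (auto simp: poly_dvd_1)
qed

lemma monic_quadratic:
  assumes "lead_coeff f = 1" "Polynomial.degree f = 2"
  shows "f = [:Polynomial.coeff f 0, Polynomial.coeff f 1, 1:]"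
proof (rule poly_eqI)
  fix n :: nat
  consider "n = 0" | "n = 1" | "n = 2" | "n > 2" by linarith
  then show "Polynomial.coeff f n = Polynomial.coeff [:Polynomial.coeff f 0, Polynomial.coeff f 1, 1:] n"
  proof cases
    case 3
    then show ?thesis using assms by (simp add: numeral_2_eq_2)
  next
    case 4
    define m where "m = n - 3"
    then have "n = Suc (Suc (Suc m))" using 4 by simp
    moreover have "Polynomial.coeff f n = 0" using 4 assms(2) by (intro coeff_eq_0) simp
    ultimately show ?thesis by simp
  qed auto
qed

context char2_quadratics
begin

lemma r_power_decompose:
  assumes "f \<noteq> 0"
  shows "\<exists>n g. f = r ^ n * g \<and> \<not> r dvd g"
  using assms
proof (induction "Polynomial.degree f" arbitrary: f rule: less_induct)
  case less
  show ?case
  proof (cases "r dvd f")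
    case True
    then obtain h where h: "f = r * h" by (elim dvdE)
    then have "h \<noteq> 0" using less.prems by auto
    then have "Polynomial.degree h < Polynomial.degree f" unfolding h by (simp add: degree_mult_eq)
    from less.hyps[OF this \<open>h \<noteq> 0\<close>] obtain n g where "h = r ^ n * g" "\<not> r dvd g" by blast
    then have "f = r ^ Suc n * g \<and> \<not> r dvd g" using h by (simp add: mult.assoc)
    then show ?thesis by blast
  next
    case False
    then have "f = r ^ 0 * f \<and> \<not> r dvd f" by simp
    then show ?thesis by blast
  qed
qed

lemma two_ac: "(2::'a alg_closure) = 0"
  using two by (metis to_ac_0 to_ac_numeral)

text \<open>The two quadratics share the linear coefficient, so in characteristic 2 their equations
  at \<open>x\<close> and \<open>y\<close> add up to the equation of \<open>r\<close> at
  \<open>x - y\<close>.\<close>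

lemma root_difference:
  assumes "x \<in> Root [:a, \<tau>, 1:]" "y \<in> Root [:c, \<tau>, 1:]"
  shows "poly (map_poly to_ac r) (x - y) = 0"
proof -
  have "to_ac a + x * (to_ac \<tau> + x) = 0" "to_ac c + y * (to_ac \<tau> + y) = 0"
    using assms by (simp_all add: Root_def map_poly_pCons)
  then have "(to_ac a + x * (to_ac \<tau> + x)) + (to_ac c + y * (to_ac \<tau> + y)) = 0" by simp
  moreover have "poly (map_poly to_ac r) (x - y)
      = (to_ac a + x * (to_ac \<tau> + x)) + (to_ac c + y * (to_ac \<tau> + y)) - 2 * (y * to_ac \<tau> + x * y)"
    by (simp add: r_def map_poly_pCons algebra_simps)
  ultimately show ?thesis using two_ac by simp
qed

lemma count_doubled_powers:
  "count_list (concat (map (\<lambda>k. [r ^ k, r ^ k]) ks)) (r ^ k) = 2 * count (mset ks) k"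
  by (induction ks) (simp_all add: r_power_inject)

lemma sorted_doubled_powers:
  "sorted_wrt (\<ge>) ks \<Longrightarrow> sorted_wrt (\<lambda>f g. g dvd f) (concat (map (\<lambda>k. [r ^ k, r ^ k]) ks))"
  by (induction ks) (auto simp: le_imp_power_dvd)

end

text \<open>Translation by the root \<open>s\<close> of \<open>r\<close>, an element of the base
  field, carries roots of the first quadratic to roots of the second.\<close>

lemma splitting_fields_eq:
  fixes a c \<tau> s :: "'a::field"
  assumes two: "(2::'a) = 0" and s: "s ^ 2 + \<tau> * s + (a + c) = 0"
  shows "splitting_field [:a, \<tau>, 1:] \<subseteq> splitting_field [:c, \<tau>, 1:]"
proof -
  have two_ac: "(2::'a alg_closure) = 0" using two by (metis to_ac_0 to_ac_numeral)
  let ?R = "ring_of_type_algebra :: 'a alg_closure ring"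
  let ?B = "range to_ac \<union> Root [:c, \<tau>, 1:]"
  have "Root [:a, \<tau>, 1:] \<subseteq> generate_field ?R ?B"
  proof
    fix x assume "x \<in> Root [:a, \<tau>, 1:]"
    then have x: "to_ac a + x * (to_ac \<tau> + x) = 0" by (simp add: Root_def map_poly_pCons)
    have "to_ac (s ^ 2 + \<tau> * s + (a + c)) = 0" unfolding s by simp
    then have S: "to_ac s ^ 2 + to_ac \<tau> * to_ac s + (to_ac a + to_ac c) = 0" by simp
    have "to_ac c + (x + to_ac s) * (to_ac \<tau> + (x + to_ac s))
        = (to_ac a + x * (to_ac \<tau> + x)) + (to_ac s ^ 2 + to_ac \<tau> * to_ac s + (to_ac a + to_ac c))
          + 2 * (x * to_ac s - to_ac a)"
      by (simp add: algebra_simps power2_eq_square)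
    also have "\<dots> = 0" unfolding x S two_ac by simp
    finally have "x + to_ac s \<in> Root [:c, \<tau>, 1:]" by (simp add: Root_def map_poly_pCons)
    then have "x + to_ac s \<in> generate_field ?R ?B" by (intro generate_field.incl) simp
    moreover have "to_ac s \<in> generate_field ?R ?B" by (intro generate_field.incl) simp
    ultimately have "(x + to_ac s) \<oplus>\<^bsub>?R\<^esub> to_ac s \<in> generate_field ?R ?B"
      by (rule generate_field.eng_add)
    moreover have "(x + to_ac s) \<oplus>\<^bsub>?R\<^esub> to_ac s = x + 2 * to_ac s"
      by (simp add: ring_of_type_algebra_def)
    ultimately show "x \<in> generate_field ?R ?B" unfolding two_ac by simp
  qed
  then have "range to_ac \<union> Root [:a, \<tau>, 1:] \<subseteq> generate_field ?R ?B"
    using generate_field.incl[of _ ?B ?R] by blast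
  then show ?thesis unfolding splitting_field_def by (rule generate_field_minimal)
qed

context r_endo
begin

text \<open>Write an annihilating polynomial as \<open>r\<^sup>n g\<close> with \<open>g\<close>
  prime to \<open>r\<close>. A nonzero vector killed by \<open>g(u)\<close> would yield an
  eigenvalue that is a root of \<open>g\<close> and, by exceptionality, of \<open>r\<close>, against
  the Bezout identity. So \<open>g(u)\<close> is injective and \<open>r(u)\<^sup>n\<close>
  vanishes.\<close>

lemma nilpotent_of_exceptional:
  assumes "exceptional_endo scale [:a, \<tau>, 1:] [:c, \<tau>, 1:] u"
  shows "\<exists>N. \<forall>x. act (r ^ N) x = 0"
proof -
  obtain f where f: "f \<noteq> 0" "\<And>x. act f x = 0" using annihilator_exists by blast
  from r_power_decompose[OF f(1)] obtain n g where g: "f = r ^ n * g" "\<not> r dvd g" by blast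
  have inj: "x = 0" if gx: "act g x = 0" for x
  proof (rule ccontr)
    assume "x \<noteq> 0"
    have "g \<noteq> 0" using f(1) g(1) by auto
    from ac_eigenvalue_of_annihilated[OF \<open>x \<noteq> 0\<close> gx this]
    obtain l where l: "l \<in> ac_eigenvalues scale u" "poly (map_poly to_ac g) l = 0" by blast
    then obtain x y where "l = x - y" "x \<in> Root [:a, \<tau>, 1:]" "y \<in> Root [:c, \<tau>, 1:]"
      using assms unfolding exceptional_endo_def by blast
    then have rl: "poly (map_poly to_ac r) l = 0" using root_difference by simp
    from r_coprime[OF g(2)] obtain h s where "h * g + s * r = 1" by blast
    then have "poly (map_poly to_ac (h * g + s * r)) l = 1" by simp
    then show False unfolding poly_to_ac_add poly_to_ac_mult l(2) rl by simp
  qed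
  have "act (r ^ n) x = 0" for x
  proof (rule inj)
    have "act g (act (r ^ n) x) = act f x" unfolding g(1) act_mult[symmetric] by (simp only: mult.commute)
    then show "act g (act (r ^ n) x) = 0" using f(2) by simp
  qed
  then show ?thesis by blast
qed

end

context symplectic_endo
begin

lemma symplectic_difference_iff:
  "symplectic_difference scale [:a, \<tau>, 1:] [:c, \<tau>, 1:] b u \<longleftrightarrow> (\<exists>v. splits v UNIV)"
proof -
  have quad: "poly_endo scale [:k, \<tau>, 1:] h x = h (h x) + \<tau> *s h x + k *s x"
    if "Vector_Spaces.linear scale scale h" for h k x
  proof -
    interpret h: endo scale h by (rule endo.intro[OF vector_space_axioms endo_axioms.intro[OF that]])
    have "poly_endo scale [:k, \<tau>, 1:] h x = h.act [:k, \<tau>, 1:] x" by (simp add: h.act_def)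
    also have "\<dots> = h (h x) + \<tau> *s h x + k *s x" by (simp add: h.u_add h.u_scale add_ac)
    finally show ?thesis .
  qed
  have actr: "act r x = u (u x) + \<tau> *s u x + (a *s x + c *s x)" for x
    by (simp add: r_def u_add u_scale scale_left_distrib add_ac)
  show ?thesis
  proof
    assume "symplectic_difference scale [:a, \<tau>, 1:] [:c, \<tau>, 1:] b u"
    then obtain u1 u2 where alt: "alternating_endo scale b u1" "alternating_endo scale b u2"
      and diff: "\<And>x. u x = u1 x - u2 x"
      and p: "\<And>x. poly_endo scale [:a, \<tau>, 1:] u1 x = 0" and q: "\<And>x. poly_endo scale [:c, \<tau>, 1:] u2 x = 0"
      unfolding symplectic_difference_def by blast
    have lin: "Vector_Spaces.linear scale scale u1" "Vector_Spaces.linear scale scale u2"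
      and b1: "\<And>x. b x (u1 x) = 0" using alt unfolding alternating_endo_def by blast+
    have add: "u1 (x + y) = u1 x + u1 y" for x y
      using lin(1) by (rule Vector_Spaces.linear.axioms(3)[THEN module_hom.add])
    have sc: "u1 (k *s x) = k *s u1 x" for k x
      using lin(1) by (rule Vector_Spaces.linear.axioms(3)[THEN module_hom.scale])
    have vv: "u1 (u1 x) = \<tau> *s u1 x + a *s x" for x
    proof -
      have "u1 (u1 x) + (\<tau> *s u1 x + a *s x) = 0" using p[of x] unfolding quad[OF lin(1)] by (simp only: add.assoc)
      then show ?thesis by (simp add: add_eq_0_iff)
    qed
    have u2: "u2 x = u1 x + u x" for x unfolding diff[of x] v_diff_add by (simp add: add.assoc[symmetric])
    have vu: "u1 (u x) = u (u1 x) + act r x" for x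
    proof -
      have "u1 (u1 x) + u1 (u x) + (u (u1 x) + u (u x)) + \<tau> *s (u1 x + u x) + c *s x = 0"
        using q[of x] unfolding quad[OF lin(2)] u2 add u_add .
      then have "(\<tau> *s u1 x + a *s x) + u1 (u x) + (u (u1 x) + u (u x)) + (\<tau> *s u1 x + \<tau> *s u x) + c *s x = 0"
        unfolding vv scale_right_distrib .
      moreover have "(\<tau> *s u1 x + a *s x) + u1 (u x) + (u (u1 x) + u (u x)) + (\<tau> *s u1 x + \<tau> *s u x) + c *s x
          = (\<tau> *s u1 x + \<tau> *s u1 x) + (u1 (u x) + (u (u1 x) + (u (u x) + \<tau> *s u x + (a *s x + c *s x))))"
        by (simp only: add_ac)
      ultimately have "u1 (u x) + (u (u1 x) + act r x) = 0" unfolding actr by simp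
      then show ?thesis by (simp add: add_eq_0_iff)
    qed
    have "splits u1 UNIV" unfolding splits_def using vv vu b1 add sc by simp
    then show "\<exists>v. splits v UNIV" by blast
  next
    assume "\<exists>v. splits v UNIV"
    then obtain v where "splits v UNIV" by blast
    then have v: "\<And>x. v (v x) = \<tau> *s v x + a *s x" "\<And>x. v (u x) = u (v x) + act r x" "\<And>x. b x (v x) = 0"
      "\<And>x y. v (x + y) = v x + v y" "\<And>k x. v (k *s x) = k *s v x" unfolding splits_def by simp_all
    have lin: "Vector_Spaces.linear scale scale h"
      if "\<And>x y. h (x + y) = h x + h y" "\<And>k x. h (k *s x) = k *s h x" for h
      by (unfold_locales) (simp_all add: that)
    have l1: "Vector_Spaces.linear scale scale v" by (rule lin[OF v(4,5)])
    \<comment> \<open>This is the map \<open>u2\<close>; in characteristic 2 it equals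
      \<open>v - u\<close>.\<close>
    define w where "w = (\<lambda>x. v x + u x)"
    have l2: "Vector_Spaces.linear scale scale w"
      by (rule lin) (simp_all add: w_def v(4,5) u_add u_scale scale_right_distrib add_ac)
    have "poly_endo scale [:a, \<tau>, 1:] v x = 0" for x
      unfolding quad[OF l1] v(1) by (simp only: add.assoc[of "\<tau> *s v x + a *s x"] v_add_self)
    moreover have "poly_endo scale [:c, \<tau>, 1:] w x = 0" for x
    proof -
      have "poly_endo scale [:c, \<tau>, 1:] w x
          = v (v x) + v (u x) + (u (v x) + u (u x)) + \<tau> *s (v x + u x) + c *s x"
        unfolding quad[OF l2] unfolding w_def v(4) u_add ..
      also have "\<dots> = (\<tau> *s v x + \<tau> *s v x) + (u (v x) + u (v x)) + (u (u x) + u (u x)) + (\<tau> *s u x + \<tau> *s u x)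
          + (a *s x + a *s x) + (c *s x + c *s x)"
        unfolding v(1,2) actr scale_right_distrib by (simp only: add_ac)
      finally show ?thesis by simp
    qed
    moreover have "u x = v x - w x" for x
      unfolding w_def v_diff_add by (simp add: add.assoc[symmetric])
    moreover have "alternating_endo scale b v" unfolding alternating_endo_def using l1 v(3) by blast
    moreover have "alternating_endo scale b w"
      unfolding alternating_endo_def using l2 v(3) by (simp add: w_def b_add_right)
    ultimately show "symplectic_difference scale [:a, \<tau>, 1:] [:c, \<tau>, 1:] b u"
      unfolding symplectic_difference_def by blast
  qed
qed

text \<open>Each plane of exponent \<open>k\<close> contributes two invariant factors
  \<open>r\<^sup>k\<close>, so their number is a multiple of 4 exactly when the planes of exponent
  \<open>k\<close> are even in number.\<close>

lemma symplectic_difference_iff_count: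
  assumes "exceptional_endo scale [:a, \<tau>, 1:] [:c, \<tau>, 1:] u"
  shows "symplectic_difference scale [:a, \<tau>, 1:] [:c, \<tau>, 1:] b u \<longleftrightarrow>
    (\<forall>k. odd k \<longrightarrow> 4 dvd count_list (invariant_factors scale u) (r ^ k))"
proof -
  obtain N where nil: "\<And>x. act (r ^ N) x = 0" using nilpotent_of_exceptional[OF assms] by blast
  have "pm.subspace UNIV" by simp
  from plane_sum_exists[OF this perp_UNIV nil]
  obtain ks where ks: "plane_sum UNIV ks" "sorted_wrt (\<ge>) ks" by blast
  let ?rs = "concat (map (\<lambda>k. [r ^ k, r ^ k]) ks)"
  have cs: "cyclic_sum UNIV ?rs" by (rule cyclic_sum_plane_sum[OF ks(1)])
  have "is_invariant_factors scale u ?rs"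
    unfolding is_invariant_factors_iff using cs sorted_doubled_powers[OF ks(2)] by simp
  then have inv: "invariant_factors scale u = ?rs" by (rule invariant_factors_eq[OF nil])
  show ?thesis
  proof
    assume "symplectic_difference scale [:a, \<tau>, 1:] [:c, \<tau>, 1:] b u"
    then obtain v where v: "splits v UNIV" unfolding symplectic_difference_iff by blast
    interpret symplectic_splitting scale Basis u a c \<tau> b v
      using v unfolding splits_def by unfold_locales simp_all
    show "\<forall>k. odd k \<longrightarrow> 4 dvd count_list (invariant_factors scale u) (r ^ k)"
    proof (intro allI impI)
      fix k :: nat assume "odd k"
      then obtain m where "k = 2 * m + 1" by (elim oddE)
      then have m: "k = m + m + 1" by simp
      have "8 dvd 2 * count_list ?rs (r ^ k)"
        using eight_dvd_dim_diff[of m] unfolding m count_cyclic_sum[OF nil cs] .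
      then have "4 dvd count_list ?rs (r ^ k)" by presburger
      then show "4 dvd count_list (invariant_factors scale u) (r ^ k)" unfolding inv .
    qed
  next
    assume count: "\<forall>k. odd k \<longrightarrow> 4 dvd count_list (invariant_factors scale u) (r ^ k)"
    have "even (count (mset ks) k)" if "odd k" for k
    proof -
      have "4 dvd 2 * count (mset ks) k"
        using count that unfolding inv count_doubled_powers by blast
      then show ?thesis by presburger
    qed
    then show "symplectic_difference scale [:a, \<tau>, 1:] [:c, \<tau>, 1:] b u"
      unfolding symplectic_difference_iff using splits_plane_sum[OF ks(1)] by blast
  qed
qed

end

theorem theorem6p2:
  fixes p q :: "'a::field poly"
    and scale :: "'a \<Rightarrow> 'v::ab_group_add \<Rightarrow> 'v"
    and Basis :: "'v set"
    and b :: "'v \<Rightarrow> 'v \<Rightarrow> 'a"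
    and u :: "'v \<Rightarrow> 'v"
  assumes "Polynomial.lead_coeff p = 1" and "Polynomial.degree p = 2"
    and "Polynomial.lead_coeff q = 1" and "Polynomial.degree q = 2"
    and "Factorial_Ring.irreducible p" and "Factorial_Ring.irreducible q"
    and "splitting_field p \<noteq> splitting_field q"
    and "CHAR('a) = 2"
    and "poly_tr p = poly_tr q" and "poly_tr p \<noteq> 0"
    and "finite_dimensional_vector_space scale Basis"
    and "symplectic_pair scale b u"
    and "exceptional_endo scale p q u"
  shows "symplectic_difference scale p q b u \<longleftrightarrow>
    (\<forall>k::nat. odd k \<longrightarrow>
      4 dvd count_list (invariant_factors scale u) ([:poly p 0 + poly q 0, - poly_tr p, 1:] ^ k))"
proof -
  define a where "a = Polynomial.coeff p 0"
  define c where "c = Polynomial.coeff q 0"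
  define \<tau> where "\<tau> = - poly_tr p"
  have p: "p = [:a, \<tau>, 1:]"
    using monic_quadratic[OF assms(1,2)] assms(2) by (simp add: a_def \<tau>_def poly_tr_def)
  have "Polynomial.coeff q 1 = - poly_tr q" using assms(4) by (simp add: poly_tr_def)
  then have q: "q = [:c, \<tau>, 1:]"
    using monic_quadratic[OF assms(3,4)] unfolding c_def \<tau>_def assms(9) by simp
  have two: "(2::'a) = 0" using of_nat_CHAR[where 'a = 'a] unfolding assms(8) by simp
  have no_root: "s ^ 2 + \<tau> * s + k \<noteq> 0" if "Factorial_Ring.irreducible [:k, \<tau>, 1:]" for k s
    using no_root_of_irreducible[OF that, of s] by (simp add: algebra_simps power2_eq_square)
  have np: "s ^ 2 + \<tau> * s + a \<noteq> 0" for s by (rule no_root) (use assms(5) p in simp)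
  have nq: "s ^ 2 + \<tau> * s + c \<noteq> 0" for s by (rule no_root) (use assms(6) q in simp)
  \<comment> \<open>A root of \<open>r\<close> would give inclusions between the splitting fields
    both ways, since the equation of that root is symmetric in \<open>a\<close> and
    \<open>c\<close>.\<close>
  have nr: "s ^ 2 + \<tau> * s + (a + c) \<noteq> 0" for s
  proof
    assume s: "s ^ 2 + \<tau> * s + (a + c) = 0"
    then have s': "s ^ 2 + \<tau> * s + (c + a) = 0" by (simp only: add.commute)
    from splitting_fields_eq[OF two s] splitting_fields_eq[OF two s'] show False
      using assms(7) unfolding p q by blast
  qed
  have tau: "\<tau> \<noteq> 0" using assms(10) by (simp add: \<tau>_def)
  have lin: "Vector_Spaces.linear scale scale u"
    using assms(12) unfolding symplectic_pair_def alternating_endo_def by blast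
  note vs = finite_dimensional_vector_space.axioms(1)[OF assms(11)]
  interpret symplectic_endo scale Basis u a c \<tau> b
    by (intro symplectic_endo.intro symplectic_endo_axioms.intro r_endo.intro fd_endo.intro endo.intro
        endo_axioms.intro char2_quadratics.intro assms(11,12) vs lin two tau np nq nr)
  have "[:poly p 0 + poly q 0, - poly_tr p, 1:] = r"
    unfolding r_def by (simp add: a_def c_def \<tau>_def poly_0_coeff_0)
  then show ?thesis
    using symplectic_difference_iff_count assms(13) unfolding p[symmetric] q[symmetric] by simp
qed

end
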